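(* Let $\Omega\in\mathcal{D}^\infty$ with billiard map $f$ and curvature $\kappa$, and let $n\ge 1$. There is $\delta>0$ such that the following holds. Let $(s_i,\phi_i)=f^i(s_0,\phi_0)$, $0\le i\le n+3$, be an orbit segment (not necessarily part of a periodic orbit) with $s_i\ne s_j$ in $\mathbb{R}/\mathbb{Z}$ for $i\neq j$, with each $(s_i,\phi_i)$ at distance less than $\delta$ from the boundary ($0<\phi_i<\delta$), and with $$\frac{\partial s_j}{\partial\phi_i}\neq 0\qquad\text{for } 0\le i<j\le n+3 .$$ Let $(\Omega_\varepsilon)$, $\varepsilon=(\varepsilon_1,\dots,\varepsilon_{n+2})$ in a neighbourhood of $0\in\mathbb{R}^{n+2}$, be a smooth family in $\mathcal{D}^\infty$ with $\Omega_0=\Omega$ and curvatures $\kappa+\Delta\kappa_\varepsilon$ such that the orbit segment remains fixed (it is an orbit segment of the billiard map of $\Omega_\varepsilon$ for every $\varepsilon$), $\Delta\kappa_\varepsilon$ is supported in small neighbourhoods of $s_1,\dots,s_{n+2}$ not containing $s_0$ or $s_{n+3}$, and for $1\le i\le n+2$ $$\Delta\kappa_\varepsilon^{(j)}(s_i)=0\ \ (0\le j\le n-2),\qquad \Delta\kappa_\varepsilon^{(n-1)}(s_i)=\varepsilon_i .$$ Then the $n+2$ quantities $$\left\{\frac{\partial^n s_{n+3}}{\partial s_0^{n-k}\partial\phi_0^k}:0\le k\le n\right\}\cup\left\{\frac{\partial^n\phi_{n+3}}{\partial s_0^n}\right\},$$ computed for the billiard map of $\Omega_\varepsilon$ at $(s_0,\phi_0)$,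 can be varied independently: $$\det\left.\frac{\partial\left(\frac{\partial^n s_{n+3}}{\partial s_0^{n}},\frac{\partial^n s_{n+3}}{\partial s_0^{n-1}\partial\phi_0},\dots,\frac{\partial^n s_{n+3}}{\partial\phi_0^n},\frac{\partial^n\phi_{n+3}}{\partial s_0^n}\right)(\varepsilon)}{\partial\varepsilon}\right|_{\varepsilon=0}\neq 0 .$$
   Context: $\mathcal{D}^\infty$ denotes the set of bounded strictly convex domains $\Omega\subset\mathbb{R}^2$ of perimeter $1$ with $C^\infty$ boundary whose curvature is everywhere positive. The boundary is parametrized by arc length $s\in\mathbb{R}/\mathbb{Z}$ as $\gamma(s)$, and a domain is identified with the curvature function $\kappa\in C^\infty(\mathbb{R}/\mathbb{Z})$, $\kappa>0$. The billiard map $f(s_0,\phi_0)=(s_1,\phi_1)$ acts on $\mathbb{A}=\mathbb{R}/\mathbb{Z}\times[0,\pi]$: the ray leaving $\gamma(s_0)$ at angle $\phi_0$ with $\gamma'(s_0)$ into $\Omega$ next hits the boundary at $\gamma(s_1)$, and $\phi_1$ is the angle with $\gamma'(s_1)$ of the reflected ray. For $i\le j$, $(s_j,\phi_j)=f^{j-i}(s_i,\phi_i)$ is regarded as a function of $(s_i,\phi_i)$, and $\partial s_j/\partial\phi_i$, etc., denote its partial derivatives evaluated along the given orbit segment. $\Delta\kappa^{(j)}$ denotes the $j$-th derivative in $s$. "Close to the boundary" refers to the boundary $\{\phi=0\}$ of the cylinder (by symmetry $\{\phi=\pi\}$ may be treated alike).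
   Formalization: The orbit segment is assumed fixed as a broken line in the plane (the points at s_i do not move), not only in its coordinates (s_i, φ_i); with coordinates alone the chord lengths could vary with ε and the determinant could vanish. *)

theory Defs
  imports "HOL-Analysis.Analysis"
begin

text \<open>C-infinity regularity on an open set: all iterated directional derivatives exist and
  are continuous.\<close>

primrec Ck_on :: "nat \<Rightarrow> 'a::real_normed_vector set \<Rightarrow> ('a \<Rightarrow> 'b::real_normed_vector) \<Rightarrow> bool" where
  "Ck_on 0 S f \<longleftrightarrow> continuous_on S f"
| "Ck_on (Suc k) S f \<longleftrightarrow>
     (\<forall>x\<in>S. f differentiable (at x)) \<and> (\<forall>v. Ck_on k S (\<lambda>x. frechet_derivative f (at x) v))"

definition smooth_on :: "'a::real_normed_vector set \<Rightarrow> ('a \<Rightarrow> 'b::real_normed_vector) \<Rightarrow> bool" where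
  "smooth_on S f \<longleftrightarrow> (\<forall>k. Ck_on k S f)"

text \<open>The plane is the type of complex numbers, so that the unit vector at angle \<open>\<phi>\<close> from a unit
  vector \<open>T\<close> is \<open>cis \<phi> * T\<close>.\<close>

definition strictly_convex_domain :: "complex set \<Rightarrow> bool" where
  "strictly_convex_domain \<Omega> \<longleftrightarrow> \<Omega> \<noteq> {} \<and> open \<Omega> \<and> bounded \<Omega> \<and>
     (\<forall>x\<in>closure \<Omega>. \<forall>y\<in>closure \<Omega>. x \<noteq> y \<longrightarrow> open_segment x y \<subseteq> \<Omega>)"

definition tangent :: "(real \<Rightarrow> complex) \<Rightarrow> real \<Rightarrow> complex" where
  "tangent \<gamma> s = vector_derivative \<gamma> (at s)"

text \<open>Signed curvature of a unit speed curve, i.e. \<open>\<kappa>\<close> in \<open>\<gamma>'' = \<kappa> * \<i> * \<gamma>'\<close>.\<close>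

definition curvature :: "(real \<Rightarrow> complex) \<Rightarrow> real \<Rightarrow> real" where
  "curvature \<gamma> s = vector_derivative (tangent \<gamma>) (at s) \<bullet> (\<i> * tangent \<gamma> s)"

text \<open>Functions on \<open>\<real>/\<int>\<close> are 1-periodic functions on the line. Injectivity on a period
  together with unit speed says that the perimeter is 1; positivity of the signed curvature also
  fixes the counterclockwise orientation, so that \<open>\<i> * tangent \<gamma> s\<close> is the inner normal.\<close>

definition arc_param :: "complex set \<Rightarrow> (real \<Rightarrow> complex) \<Rightarrow> bool" where
  "arc_param \<Omega> \<gamma> \<longleftrightarrow> strictly_convex_domain \<Omega> \<and> smooth_on UNIV \<gamma> \<and>
     (\<forall>s. \<gamma> (s + 1) = \<gamma> s) \<and> inj_on \<gamma> {0..<1} \<and> range \<gamma> = frontier \<Omega> \<and>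
     (\<forall>s. norm (tangent \<gamma> s) = 1) \<and> (\<forall>s. curvature \<gamma> s > 0)"

definition Dinf :: "complex set set" where
  "Dinf = {\<Omega>. \<exists>\<gamma>. arc_param \<Omega> \<gamma>}"

text \<open>One flight and reflection: the ray from \<open>\<gamma> s\<close> in direction \<open>u\<close> next meets the boundary at
  \<open>\<gamma> s'\<close>, and \<open>2 (u \<bullet> T) T - u\<close> is the mirror image of \<open>u\<close> in the tangent line spanned by \<open>T\<close>.
  The map is lifted from the annulus to the strip \<open>\<real> \<times> [0, \<pi>]\<close>; the requirement
  \<open>s < s' < s + 1\<close> selects the lift that extends continuously to the boundary lines.\<close>

definition billiard_step :: "(real \<Rightarrow> complex) \<Rightarrow> real \<times> real \<Rightarrow> real \<times> real \<Rightarrow> bool" where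
  "billiard_step \<gamma> = (\<lambda>(s, \<phi>) (s', \<phi>').
     let u = cis \<phi> * tangent \<gamma> s; T = tangent \<gamma> s' in
       s < s' \<and> s' < s + 1 \<and> 0 < \<phi>' \<and> \<phi>' < pi \<and>
       (\<exists>t>0. \<gamma> s' = \<gamma> s + t *\<^sub>R u) \<and> open_segment (\<gamma> s) (\<gamma> s') \<inter> range \<gamma> = {} \<and>
       cis \<phi>' * T = (2 * (u \<bullet> T)) *\<^sub>R T - u)"

definition billiard_map :: "(real \<Rightarrow> complex) \<Rightarrow> real \<times> real \<Rightarrow> real \<times> real" where
  "billiard_map \<gamma> p =
     (if snd p = 0 then p else if snd p = pi then (fst p + 1, pi)
      else (THE q. billiard_step \<gamma> p q))"

definition orbit_segment :: "(real \<Rightarrow> complex) \<Rightarrow> nat \<Rightarrow> (nat \<Rightarrow> real) \<Rightarrow> (nat \<Rightarrow> real) \<Rightarrow> bool" where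
  "orbit_segment \<gamma> N s \<phi> \<longleftrightarrow> (\<forall>i\<le>N. (s i, \<phi> i) = (billiard_map \<gamma> ^^ i) (s 0, \<phi> 0))"

definition mixed_deriv :: "nat \<Rightarrow> nat \<Rightarrow> (real \<times> real \<Rightarrow> real) \<Rightarrow> real \<times> real \<Rightarrow> real" where
  "mixed_deriv a b g p = (deriv ^^ a) (\<lambda>x. (deriv ^^ b) (\<lambda>y. g (x, y)) (snd p)) (fst p)"

text \<open>The vector of the \<open>n + 2\<close> quantities. Coordinates of \<open>real ^ 'm\<close> are numbered
  \<open>1, \<dots>, n + 2\<close> by \<open>ix\<close>: number \<open>k + 1\<close> with \<open>k \<le> n\<close> carries the derivative of
  \<open>s\<^sub>n\<^sub>+\<^sub>3\<close> taken \<open>n - k\<close> times in \<open>s\<^sub>0\<close> and \<open>k\<close> times in \<open>\<phi>\<^sub>0\<close>, number \<open>n + 2\<close> the \<open>n\<close>-th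
  derivative of \<open>\<phi>\<^sub>n\<^sub>+\<^sub>3\<close> in \<open>s\<^sub>0\<close>.\<close>

definition jet_vector ::
  "nat \<Rightarrow> ('m::finite \<Rightarrow> nat) \<Rightarrow> (real \<Rightarrow> complex) \<Rightarrow> real \<times> real \<Rightarrow> real ^ 'm" where
  "jet_vector n ix \<gamma> p = (\<chi> r.
     if ix r \<le> n + 1
     then mixed_deriv (n + 1 - ix r) (ix r - 1) (\<lambda>q. fst ((billiard_map \<gamma> ^^ (n + 3)) q)) p
     else mixed_deriv n 0 (\<lambda>q. snd ((billiard_map \<gamma> ^^ (n + 3)) q)) p)"

text \<open>Smoothness of a family of domains is joint smoothness of the curvatures, through which
  domains are identified; \<open>\<Gamma> \<epsilon>\<close> is an arc length parametrization of \<open>\<partial>(Om \<epsilon>)\<close>.\<close>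

definition smooth_family ::
  "(real ^ 'm::finite) set \<Rightarrow> (real ^ 'm \<Rightarrow> complex set) \<Rightarrow> (real ^ 'm \<Rightarrow> real \<Rightarrow> complex) \<Rightarrow> bool"
  where
  "smooth_family U Om \<Gamma> \<longleftrightarrow> open U \<and> 0 \<in> U \<and> (\<forall>\<epsilon>\<in>U. arc_param (Om \<epsilon>) (\<Gamma> \<epsilon>)) \<and>
     smooth_on (U \<times> UNIV) (\<lambda>(\<epsilon>, x). curvature (\<Gamma> \<epsilon>) x)"

text \<open>Open subsets of \<open>\<real>/\<int>\<close>, as periodic open subsets of the line.\<close>

definition circle_open :: "real set \<Rightarrow> bool" where
  "circle_open V \<longleftrightarrow> open V \<and> (\<forall>x. x + 1 \<in> V \<longleftrightarrow> x \<in> V)"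

text \<open>The orbit segment is kept as a broken line in the plane: its vertices \<open>\<gamma> (s i)\<close> do not
  move, and \<open>(s i, \<phi> i)\<close> is an orbit segment for each member of the family. The second condition
  alone would fix the directions of the chords but not their lengths.\<close>

definition fixes_orbit ::
  "(real ^ 'm::finite) set \<Rightarrow> (real ^ 'm \<Rightarrow> real \<Rightarrow> complex) \<Rightarrow> (real \<Rightarrow> complex) \<Rightarrow>
     nat \<Rightarrow> (nat \<Rightarrow> real) \<Rightarrow> (nat \<Rightarrow> real) \<Rightarrow> bool" where
  "fixes_orbit U \<Gamma> \<gamma> N s \<phi> \<longleftrightarrow>
     (\<forall>\<epsilon>\<in>U. orbit_segment (\<Gamma> \<epsilon>) N s \<phi> \<and> (\<forall>i\<le>N. \<Gamma> \<epsilon> (s i) = \<gamma> (s i)))"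

end

theory Submission
  imports Defs "HOL-Computational_Algebra.Polynomial"
begin

text \<open>In the coordinates (arc length, direction angle) a flight between two boundary points depends
  only on the positions, while a reflection involves twice the tangent angle. The perturbation
  leaves the \<open>n\<close>-jet of the position at \<open>s\<^sub>i\<close> unchanged and changes the \<open>n\<close>-jet of the tangent angle
  by \<open>\<epsilon>\<^sub>i (s - s\<^sub>i)\<^sup>n / n!\<close>. Hence, with \<open>N = n + 3\<close>, \<open>a\<^sub>i = \<partial>s\<^sub>i/\<partial>s\<^sub>0\<close> and \<open>c\<^sub>i = \<partial>s\<^sub>i/\<partial>\<phi>\<^sub>0\<close>, the \<open>n\<close>-th
  differential of \<open>(s\<^sub>N, \<phi>\<^sub>N)\<close> changes to first order by
  \<open>\<Sum>\<^sub>i 2 \<epsilon>\<^sub>i (\<partial>s\<^sub>N/\<partial>\<phi>\<^sub>i, \<partial>\<phi>\<^sub>N/\<partial>\<phi>\<^sub>i) (a\<^sub>i ds\<^sub>0 + c\<^sub>i d\<phi>\<^sub>0)\<^sup>n\<close>.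

  Put \<open>t\<^sub>i = a\<^sub>i / c\<^sub>i\<close>, \<open>A = \<partial>s\<^sub>N/\<partial>s\<^sub>0\<close>, \<open>B = \<partial>s\<^sub>N/\<partial>\<phi>\<^sub>0\<close>, \<open>C = \<partial>\<phi>\<^sub>N/\<partial>s\<^sub>0\<close> and \<open>D = \<partial>\<phi>\<^sub>N/\<partial>\<phi>\<^sub>0\<close>. Wronskians
  show that the \<open>t\<^sub>i\<close> are distinct and that \<open>\<partial>\<phi>\<^sub>N/\<partial>\<phi>\<^sub>i : \<partial>s\<^sub>N/\<partial>\<phi>\<^sub>i = (D t\<^sub>i - C) : (B t\<^sub>i - A)\<close>. A linear
  relation between the rows of the Jacobian matrix therefore gives a polynomial
  \<open>P(t) (B t - A) + \<nu> t\<^sup>n (D t - C)\<close> of degree at most \<open>n + 1\<close> with \<open>n + 2\<close> roots, which must vanish. At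
  \<open>t = A / B\<close> this yields \<open>\<nu> = 0\<close>, provided that \<open>A \<noteq> 0\<close>, and then \<open>P = 0\<close>. Smallness of the angles
  is only used for \<open>A > 0\<close>: near the boundary each factor of the product of Jacobians tends to a
  shear.\<close>

section \<open>Smooth functions\<close>

text \<open>The billiard map is a definite description, with no formula to differentiate n times,
  and n-th derivatives of its iterates would call for chain rules of all orders. The way around is
  to differentiate only differences between a perturbed and the unperturbed table. Along the orbit
  these vanish together with all derivatives of order below n, so that every product or chain rule
  of order n reduces to its leading terms, which are linear in the differences. The arrival point
  enters through the equation saying that the chord is parallel to the ray; there the change of
  position drops out, since it is flatter by one order than the change of tangent angle. The 2 comes
  from \<phi>' = \<theta>(s') - \<theta>(s) - \<phi>: a tangent angle counts once on arrival and
  once on the next departure. Each \<epsilon> is treated separately, and the difference of the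
  n-jets is an exact sum whose coefficients depend on \<epsilon> only through the curvatures at the
  vertices, that is, only for n = 1. The Wronskian identities express the invariance of sin \<phi>
  ds d\<phi>.\<close>

lemma Ck_on_Suc_differentiable: "Ck_on (Suc k) S f \<Longrightarrow> x \<in> S \<Longrightarrow> f differentiable (at x)"
  by simp

lemma Ck_on_Suc_deriv: "Ck_on (Suc k) S f \<Longrightarrow> Ck_on k S (\<lambda>x. frechet_derivative f (at x) v)"
  by simp

declare Ck_on.simps(2) [simp del]

text \<open>\<open>Ck_on\<close> differentiates in the whole space, not within S, so agreement on S
  fixes the derivatives because S is a neighbourhood of each of its points.\<close>

lemma Ck_on_cong:
  assumes "open S" "\<And>x. x \<in> S \<Longrightarrow> f x = g x"
  shows "Ck_on k S f \<longleftrightarrow> Ck_on k S g"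
  using assms(2)
proof (induction k arbitrary: f g)
  case 0
  then show ?case by (simp cong: continuous_on_cong)
next
  case (Suc k)
  have *: "Ck_on (Suc k) S g" if eq: "\<And>x. x \<in> S \<Longrightarrow> f x = g x" and f: "Ck_on (Suc k) S f" for f g :: "'a \<Rightarrow> 'b"
  proof -
    have d: "f differentiable (at x)" if "x \<in> S" for x
      using Ck_on_Suc_differentiable[OF f that] .
    have dg: "g differentiable (at x)" if "x \<in> S" for x
      using has_derivative_transform_within_open[OF _ \<open>open S\<close> that] d[OF that] eq
      unfolding differentiable_def by blast
    have "frechet_derivative f (at x) = frechet_derivative g (at x)" if "x \<in> S" for x
      using frechet_derivative_transform_within_open[OF d[OF that] \<open>open S\<close> that] eq by blast
    then have "Ck_on k S (\<lambda>x. frechet_derivative g (at x) v)" for v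
      using f Suc.IH[of "\<lambda>x. frechet_derivative f (at x) v" "\<lambda>x. frechet_derivative g (at x) v"]
        Ck_on_Suc_deriv[OF f] by auto
    with dg show ?thesis by (simp add: Ck_on.simps(2))
  qed
  show ?case using *[of f g] *[of g f] Suc.prems by metis
qed

text \<open>Replaces the chosen \<open>frechet_derivative\<close> by an explicit one, the form in
  which the later smoothness inductions run.\<close>

lemma Ck_on_SucI:
  assumes "open S" "\<And>x. x \<in> S \<Longrightarrow> (f has_derivative f' x) (at x)"
    and "\<And>v. Ck_on k S (\<lambda>x. f' x v)"
  shows "Ck_on (Suc k) S f"
proof -
  have "frechet_derivative f (at x) = f' x" if "x \<in> S" for x
    using frechet_derivative_at[OF assms(2)[OF that]] by simp
  then have "Ck_on k S (\<lambda>x. frechet_derivative f (at x) v)" for v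
    using Ck_on_cong[OF assms(1), of "\<lambda>x. frechet_derivative f (at x) v" "\<lambda>x. f' x v" k] assms(3) by auto
  then show ?thesis using assms(2) by (auto simp: differentiable_def Ck_on.simps(2))
qed

lemma Ck_on_SucD: "Ck_on (Suc k) S f \<Longrightarrow> Ck_on k S f"
proof (induction k arbitrary: f)
  case 0
  then show ?case
    by (auto intro!: continuous_at_imp_continuous_on differentiable_imp_continuous_within
        simp: Ck_on_Suc_differentiable)
next
  case (Suc k)
  have "Ck_on k S (\<lambda>x. frechet_derivative f (at x) v)" for v
    by (rule Suc.IH[OF Ck_on_Suc_deriv[OF Suc.prems]])
  then show ?case
    using Ck_on_Suc_differentiable[OF Suc.prems] unfolding Ck_on.simps(2)[of k] by blast
qed

lemma Ck_on_Suc_has_derivative: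
  "Ck_on (Suc k) S f \<Longrightarrow> x \<in> S \<Longrightarrow> (f has_derivative frechet_derivative f (at x)) (at x)"
  using Ck_on_Suc_differentiable frechet_derivative_works by blast

lemma Ck_on_const: "Ck_on k S (\<lambda>x. c)"
  by (induction k arbitrary: c) (auto simp: Ck_on.simps(2))

lemma Ck_on_bounded_linear:
  assumes "bounded_linear L"
  shows "Ck_on k S L"
proof (cases k)
  case 0
  then show ?thesis using assms by (simp add: linear_continuous_on)
next
  case (Suc j)
  have "frechet_derivative L (at x) = L" for x
    using frechet_derivative_at[OF bounded_linear_imp_has_derivative[OF assms]] by simp
  then show ?thesis
    using Suc assms by (simp add: Ck_on_const bounded_linear_imp_differentiable Ck_on.simps(2))
qed

lemma Ck_on_compose_bounded_linear:
  assumes "bounded_linear L" "open S"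
  shows "Ck_on k S f \<Longrightarrow> Ck_on k S (\<lambda>x. L (f x))"
proof (induction k arbitrary: f)
  case 0
  then show ?case using assms
    by (auto intro: bounded_linear.continuous_on)
next
  case (Suc k)
  show ?case
  proof (rule Ck_on_SucI[OF assms(2)])
    show "((\<lambda>x. L (f x)) has_derivative (\<lambda>v. L (frechet_derivative f (at x) v))) (at x)" if "x \<in> S" for x
      by (rule bounded_linear.has_derivative[OF assms(1) Ck_on_Suc_has_derivative[OF Suc.prems that]])
    show "Ck_on k S (\<lambda>x. L (frechet_derivative f (at x) v))" for v
      by (rule Suc.IH[OF Ck_on_Suc_deriv[OF Suc.prems]])
  qed
qed

lemma Ck_on_add:
  assumes "open S"
  shows "Ck_on k S f \<Longrightarrow> Ck_on k S g \<Longrightarrow> Ck_on k S (\<lambda>x. f x + g x)"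
proof (induction k arbitrary: f g)
  case 0
  then show ?case by (auto intro: continuous_on_add)
next
  case (Suc k)
  show ?case
    by (rule Ck_on_SucI[OF assms has_derivative_add[OF
          Ck_on_Suc_has_derivative[OF Suc.prems(1)] Ck_on_Suc_has_derivative[OF Suc.prems(2)]]])
      (auto intro!: Suc.IH Ck_on_Suc_deriv Suc.prems)
qed

lemma Ck_on_mult:
  fixes f g :: "'a::real_normed_vector \<Rightarrow> real"
  assumes "open S"
  shows "Ck_on k S f \<Longrightarrow> Ck_on k S g \<Longrightarrow> Ck_on k S (\<lambda>x. f x * g x)"
proof (induction k arbitrary: f g)
  case 0
  then show ?case by (auto intro: continuous_on_mult)
next
  case (Suc k)
  have *: "Ck_on k S (\<lambda>x. f x * frechet_derivative g (at x) v + frechet_derivative f (at x) v * g x)" for v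
    using Suc.prems Ck_on_SucD[OF Suc.prems(1)] Ck_on_SucD[OF Suc.prems(2)]
    by (intro Ck_on_add[OF assms] Suc.IH Ck_on_Suc_deriv)
  show ?case
    by (rule Ck_on_SucI[OF assms has_derivative_mult[OF
          Ck_on_Suc_has_derivative[OF Suc.prems(1)] Ck_on_Suc_has_derivative[OF Suc.prems(2)]] *])
qed

lemma Ck_on_inverse:
  fixes f :: "'a::real_normed_vector \<Rightarrow> real"
  assumes "open S" "\<And>x. x \<in> S \<Longrightarrow> f x \<noteq> 0"
  shows "Ck_on k S f \<Longrightarrow> Ck_on k S (\<lambda>x. inverse (f x))"
proof (induction k)
  case 0
  then show ?case using assms by (auto intro: continuous_on_inverse)
next
  case (Suc k)
  have inv: "Ck_on k S (\<lambda>x. inverse (f x))" using Suc Ck_on_SucD by blast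
  show ?case
  proof (rule Ck_on_SucI[OF assms(1)])
    show "((\<lambda>x. inverse (f x)) has_derivative
       (\<lambda>v. (- 1) * (inverse (f x) * frechet_derivative f (at x) v * inverse (f x)))) (at x)" if "x \<in> S" for x
      using Deriv.has_derivative_inverse[OF assms(2)[OF that] Ck_on_Suc_has_derivative[OF Suc.prems that]] by simp
    show "Ck_on k S (\<lambda>x. (- 1) * (inverse (f x) * frechet_derivative f (at x) v * inverse (f x)))" for v
      using Ck_on_Suc_deriv[OF Suc.prems] inv by (intro Ck_on_mult[OF assms(1)] Ck_on_const)
  qed
qed

text \<open>Outer functions of one real variable suffice later: sine, cosine, tangent angle,
  curvature and the coordinates of the curve. Their derivative is multiplication by a number, so the
  induction needs only products.\<close>

lemma Ck_on_compose_real: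
  fixes f :: "real \<Rightarrow> real" and g :: "'a::real_normed_vector \<Rightarrow> real"
  assumes "open S"
  shows "Ck_on k UNIV f \<Longrightarrow> Ck_on k S g \<Longrightarrow> Ck_on k S (\<lambda>x. f (g x))"
proof (induction k arbitrary: f g)
  case 0
  then show ?case by (auto intro: continuous_on_compose2)
next
  case (Suc k)
  show ?case
  proof (rule Ck_on_SucI[OF assms])
    show "((\<lambda>x. f (g x)) has_derivative
        (\<lambda>v. frechet_derivative f (at (g x)) 1 * frechet_derivative g (at x) v)) (at x)" if "x \<in> S" for x
    proof -
      have f: "(f has_derivative frechet_derivative f (at (g x))) (at (g x))"
        using Ck_on_Suc_has_derivative[OF Suc.prems(1)] by simp
      define c where "c = frechet_derivative f (at (g x)) 1"
      have "frechet_derivative f (at (g x)) y = c * y" for y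
        using linear.scaleR[OF has_derivative_linear[OF f], of y 1] by (simp add: mult.commute c_def)
      then show ?thesis
        using has_derivative_compose[OF Ck_on_Suc_has_derivative[OF Suc.prems(2) that] f]
        unfolding c_def[symmetric] by simp
    qed
    show "Ck_on k S (\<lambda>x. frechet_derivative f (at (g x)) 1 * frechet_derivative g (at x) v)" for v
      by (rule Ck_on_mult[OF assms Suc.IH[OF Ck_on_Suc_deriv[OF Suc.prems(1)]
              Ck_on_SucD[OF Suc.prems(2)]] Ck_on_Suc_deriv[OF Suc.prems(2)]])
  qed
qed

lemma Ck_on_sin_cos: "Ck_on k UNIV (sin :: real \<Rightarrow> real) \<and> Ck_on k UNIV (cos :: real \<Rightarrow> real)"
proof (induction k)
  case 0
  then show ?case by (auto intro: continuous_intros)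
next
  case (Suc k)
  have "Ck_on (Suc k) UNIV (sin :: real \<Rightarrow> real)"
    by (rule Ck_on_SucI[where f' = "\<lambda>x v. v * cos x"])
      (use Suc in \<open>auto intro!: Ck_on_mult Ck_on_const derivative_eq_intros\<close>)
  moreover have "Ck_on (Suc k) UNIV (cos :: real \<Rightarrow> real)"
    by (rule Ck_on_SucI[where f' = "\<lambda>x v. - v * sin x"])
      (use Suc in \<open>auto intro!: Ck_on_mult[where f = "\<lambda>x. - c" for c, simplified] Ck_on_const derivative_eq_intros\<close>)
  ultimately show ?case ..
qed

named_theorems smooth_intros

lemma smooth_on_const [smooth_intros]: "smooth_on S (\<lambda>x. c)"
  by (simp add: smooth_on_def Ck_on_const)

lemma smooth_on_fst [smooth_intros]: "smooth_on S fst"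
  by (simp add: smooth_on_def Ck_on_bounded_linear bounded_linear_fst)

lemma smooth_on_snd [smooth_intros]: "smooth_on S snd"
  by (simp add: smooth_on_def Ck_on_bounded_linear bounded_linear_snd)

lemma smooth_on_add [smooth_intros]:
  "open S \<Longrightarrow> smooth_on S f \<Longrightarrow> smooth_on S g \<Longrightarrow> smooth_on S (\<lambda>x. f x + g x)"
  by (simp add: smooth_on_def Ck_on_add)

lemma smooth_on_mult [smooth_intros]:
  fixes f g :: "'a::real_normed_vector \<Rightarrow> real"
  shows "open S \<Longrightarrow> smooth_on S f \<Longrightarrow> smooth_on S g \<Longrightarrow> smooth_on S (\<lambda>x. f x * g x)"
  by (simp add: smooth_on_def Ck_on_mult)

lemma smooth_on_uminus [smooth_intros]:
  "open S \<Longrightarrow> smooth_on S f \<Longrightarrow> smooth_on S (\<lambda>x. - f x)"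
  unfolding smooth_on_def
  by (rule allI, rule Ck_on_compose_bounded_linear[OF bounded_linear_minus[OF bounded_linear_ident]]) auto

lemma smooth_on_diff [smooth_intros]:
  assumes "open S" "smooth_on S f" "smooth_on S g"
  shows "smooth_on S (\<lambda>x. f x - g x)"
  using smooth_on_add[OF assms(1,2) smooth_on_uminus[OF assms(1,3)]] by simp

lemma smooth_on_compose:
  fixes f :: "real \<Rightarrow> real" and g :: "'a::real_normed_vector \<Rightarrow> real"
  assumes "open S" "smooth_on UNIV f" "smooth_on S g"
  shows "smooth_on S (\<lambda>x. f (g x))"
  unfolding smooth_on_def
proof
  show "Ck_on k S (\<lambda>x. f (g x))" for k
    by (rule Ck_on_compose_real) (use assms in \<open>simp_all add: smooth_on_def\<close>)
qed

lemma smooth_on_sin_real: "smooth_on UNIV (sin :: real \<Rightarrow> real)"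
  and smooth_on_cos_real: "smooth_on UNIV (cos :: real \<Rightarrow> real)"
  by (simp_all add: smooth_on_def Ck_on_sin_cos)

lemmas smooth_on_sin [smooth_intros] = smooth_on_compose[OF _ smooth_on_sin_real]
  and smooth_on_cos [smooth_intros] = smooth_on_compose[OF _ smooth_on_cos_real]

lemma smooth_on_cong:
  "open S \<Longrightarrow> (\<And>x. x \<in> S \<Longrightarrow> f x = g x) \<Longrightarrow> smooth_on S f \<longleftrightarrow> smooth_on S g"
  using Ck_on_cong[of S f g] by (simp add: smooth_on_def)

definition dir_deriv :: "'a::real_normed_vector \<Rightarrow> ('a \<Rightarrow> real) \<Rightarrow> 'a \<Rightarrow> real" where
  "dir_deriv v h x = frechet_derivative h (at x) v"

lemma smooth_on_dir_deriv [smooth_intros]: "smooth_on S h \<Longrightarrow> smooth_on S (dir_deriv v h)"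
  unfolding smooth_on_def dir_deriv_def
proof
  assume h: "\<forall>k. Ck_on k S h"
  show "Ck_on k S (\<lambda>x. frechet_derivative h (at x) v)" for k
    by (rule Ck_on_Suc_deriv[OF h[rule_format]])
qed

lemma smooth_on_has_derivative:
  "smooth_on S h \<Longrightarrow> x \<in> S \<Longrightarrow> (h has_derivative (\<lambda>v. dir_deriv v h x)) (at x)"
  unfolding smooth_on_def dir_deriv_def by (rule Ck_on_Suc_has_derivative) auto

lemma smooth_on_has_real_derivative:
  "smooth_on S h \<Longrightarrow> x \<in> S \<Longrightarrow> (h has_real_derivative dir_deriv 1 h x) (at x)"
proof -
  assume *: "smooth_on S h" "x \<in> S"
  note h = smooth_on_has_derivative[OF *]
  define c where "c = dir_deriv 1 h x"
  have "dir_deriv y h x = c * y" for y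
    using linear.scaleR[OF has_derivative_linear[OF h], of y 1] by (simp add: mult.commute c_def)
  with h show ?thesis
    unfolding c_def[symmetric] by (simp add: has_field_derivative_def)
qed

lemma dir_deriv_unique: "(h has_derivative h') (at x) \<Longrightarrow> dir_deriv v h x = h' v"
  unfolding dir_deriv_def by (drule frechet_derivative_at) simp

lemma smooth_onI:
  assumes "open S" "\<And>x. x \<in> S \<Longrightarrow> (h has_derivative h' x) (at x)" "\<And>v. smooth_on S (\<lambda>x. h' x v)"
  shows "smooth_on S h"
  unfolding smooth_on_def
proof
  fix k
  have "Ck_on (Suc k) S h"
    by (rule Ck_on_SucI[OF assms(1,2)]) (use assms(3) in \<open>auto simp: smooth_on_def\<close>)
  then show "Ck_on k S h" by (rule Ck_on_SucD)
qed

lemma smooth_on_real_antiderivative: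
  assumes "smooth_on UNIV k" "\<And>x. (h has_real_derivative k x) (at x)"
  shows "smooth_on UNIV h"
proof (rule smooth_onI)
  show "(h has_derivative (\<lambda>v. k x * v)) (at x)" for x
    using assms(2) by (simp add: has_field_derivative_def)
  show "smooth_on UNIV (\<lambda>x. k x * v)" for v
    by (intro smooth_intros assms open_UNIV)
qed simp

lemma smooth_on_continuous_on: "smooth_on S h \<Longrightarrow> continuous_on S h"
  using Ck_on.simps(1)[of S h] by (simp add: smooth_on_def)

section \<open>Order of vanishing\<close>

lemma dir_deriv_add:
  "smooth_on S f \<Longrightarrow> smooth_on S g \<Longrightarrow> x \<in> S \<Longrightarrow>
    dir_deriv v (\<lambda>x. f x + g x) x = dir_deriv v f x + dir_deriv v g x"
  by (rule dir_deriv_unique) (rule has_derivative_add; rule smooth_on_has_derivative)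

lemma dir_deriv_mult:
  "smooth_on S f \<Longrightarrow> smooth_on S g \<Longrightarrow> x \<in> S \<Longrightarrow>
    dir_deriv v (\<lambda>x. f x * g x) x = f x * dir_deriv v g x + dir_deriv v f x * g x"
  by (rule dir_deriv_unique) (rule has_derivative_mult; rule smooth_on_has_derivative)

lemma dir_deriv_diff:
  "smooth_on S f \<Longrightarrow> smooth_on S g \<Longrightarrow> x \<in> S \<Longrightarrow>
    dir_deriv v (\<lambda>x. f x - g x) x = dir_deriv v f x - dir_deriv v g x"
  by (rule dir_deriv_unique) (rule has_derivative_diff; rule smooth_on_has_derivative)

lemma dir_deriv_compose:
  assumes "smooth_on UNIV f" "smooth_on S g" "x \<in> S"
  shows "dir_deriv v (\<lambda>x. f (g x)) x = dir_deriv 1 f (g x) * dir_deriv v g x"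
proof (rule dir_deriv_unique)
  have "(f has_derivative (*) (dir_deriv 1 f (g x))) (at (g x))"
    using smooth_on_has_real_derivative[OF assms(1), of "g x"] by (simp add: has_field_derivative_def)
  then show "((\<lambda>x. f (g x)) has_derivative (\<lambda>v. dir_deriv 1 f (g x) * dir_deriv v g x)) (at x)"
    by (rule has_derivative_compose[OF smooth_on_has_derivative[OF assms(2,3)]])
qed

lemma dir_deriv_cong:
  assumes "open S" "smooth_on S f" "\<And>x. x \<in> S \<Longrightarrow> f x = g x" "x \<in> S"
  shows "dir_deriv v f x = dir_deriv v g x"
  by (rule dir_deriv_unique[symmetric])
    (rule has_derivative_transform_within_open[OF smooth_on_has_derivative[OF assms(2,4)] assms(1,4,3)])

text \<open>Lists of directions, the head applied first, stand for multi-indices, so that no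
  symmetry of mixed derivatives has to be proved.\<close>

primrec iter_deriv :: "'a::real_normed_vector list \<Rightarrow> ('a \<Rightarrow> real) \<Rightarrow> 'a \<Rightarrow> real" where
  "iter_deriv [] h = h"
| "iter_deriv (v # vs) h = iter_deriv vs (dir_deriv v h)"

lemma iter_deriv_append: "iter_deriv (vs @ ws) h = iter_deriv ws (iter_deriv vs h)"
  by (induction vs arbitrary: h) auto

lemma iter_deriv_replicate_Suc:
  "iter_deriv (replicate (Suc b) v) h = dir_deriv v (iter_deriv (replicate b v) h)"
  using iter_deriv_append[of "replicate b v" "[v]" h] by (simp add: replicate_append_same)

lemma smooth_on_iter_deriv: "smooth_on S h \<Longrightarrow> smooth_on S (iter_deriv vs h)"
  by (induction vs arbitrary: h) (auto intro: smooth_on_dir_deriv)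

lemma iter_deriv_cong:
  assumes "open S"
  shows "smooth_on S f \<Longrightarrow> (\<And>x. x \<in> S \<Longrightarrow> f x = g x) \<Longrightarrow> x \<in> S \<Longrightarrow>
    iter_deriv vs f x = iter_deriv vs g x"
proof (induction vs arbitrary: f g)
  case (Cons v vs)
  show ?case
    unfolding iter_deriv.simps
    by (rule Cons.IH[OF smooth_on_dir_deriv[OF Cons.prems(1)] dir_deriv_cong[OF assms Cons.prems(1,2)] Cons.prems(3)])
qed simp

lemma iter_deriv_add:
  assumes "open S"
  shows "smooth_on S f \<Longrightarrow> smooth_on S g \<Longrightarrow> x \<in> S \<Longrightarrow>
    iter_deriv vs (\<lambda>x. f x + g x) x = iter_deriv vs f x + iter_deriv vs g x"
proof (induction vs arbitrary: f g)
  case (Cons v vs)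
  have "iter_deriv vs (dir_deriv v (\<lambda>x. f x + g x)) x = iter_deriv vs (\<lambda>x. dir_deriv v f x + dir_deriv v g x) x"
    using Cons.prems by (intro iter_deriv_cong[OF assms] smooth_intros assms dir_deriv_add)
  then show ?case
    using Cons.IH[OF smooth_on_dir_deriv smooth_on_dir_deriv] Cons.prems by simp
qed simp

lemma iter_deriv_cmult:
  assumes "open S"
  shows "smooth_on S f \<Longrightarrow> x \<in> S \<Longrightarrow> iter_deriv vs (\<lambda>x. c * f x) x = c * iter_deriv vs f x"
proof (induction vs arbitrary: f)
  case (Cons v vs)
  have "dir_deriv v (\<lambda>x. c * f x) y = c * dir_deriv v f y" if "y \<in> S" for y
    by (rule dir_deriv_unique) (intro has_derivative_mult_right smooth_on_has_derivative[OF Cons.prems(1) that])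
  then have "iter_deriv vs (dir_deriv v (\<lambda>x. c * f x)) x = iter_deriv vs (\<lambda>x. c * dir_deriv v f x) x"
    using Cons.prems by (intro iter_deriv_cong[OF assms] smooth_intros assms)
  then show ?case
    using Cons.IH[OF smooth_on_dir_deriv] Cons.prems by simp
qed simp

lemma iter_deriv_diff:
  assumes "open S" "smooth_on S f" "smooth_on S g" "x \<in> S"
  shows "iter_deriv vs (\<lambda>x. f x - g x) x = iter_deriv vs f x - iter_deriv vs g x"
  using iter_deriv_add[OF assms(1,2) smooth_on_mult[OF assms(1) smooth_on_const assms(3)] assms(4), of vs "-1"]
    iter_deriv_cmult[OF assms(1,3,4), of vs "-1"] by simp

text \<open>Membership in the k-th power of the ideal of functions vanishing at p: all derivatives
  of order below k are 0, and orders add under multiplication.\<close>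

definition vanishes :: "nat \<Rightarrow> 'a::real_normed_vector \<Rightarrow> ('a \<Rightarrow> real) \<Rightarrow> bool" where
  "vanishes k p h \<longleftrightarrow> (\<forall>vs. length vs < k \<longrightarrow> iter_deriv vs h p = 0)"

lemma vanishes_0 [simp]: "vanishes 0 p h"
  by (simp add: vanishes_def)

lemma vanishes_mono: "vanishes k p h \<Longrightarrow> j \<le> k \<Longrightarrow> vanishes j p h"
  by (auto simp: vanishes_def)

lemma vanishes_Suc: "vanishes (Suc k) p h \<longleftrightarrow> h p = 0 \<and> (\<forall>v. vanishes k p (dir_deriv v h))"
proof
  assume h: "vanishes (Suc k) p h"
  have "iter_deriv vs (dir_deriv v h) p = 0" if "length vs < k" for v vs
    using h[unfolded vanishes_def, rule_format, of "v # vs"] that by simp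
  then show "h p = 0 \<and> (\<forall>v. vanishes k p (dir_deriv v h))"
    using h[unfolded vanishes_def, rule_format, of "[]"] by (simp add: vanishes_def)
next
  assume h: "h p = 0 \<and> (\<forall>v. vanishes k p (dir_deriv v h))"
  have "iter_deriv vs h p = 0" if "length vs < Suc k" for vs
    using h that by (cases vs) (auto simp: vanishes_def)
  then show "vanishes (Suc k) p h" by (simp add: vanishes_def)
qed

lemma vanishes_SucI:
  "vanishes k p h \<Longrightarrow> (\<And>vs. length vs = k \<Longrightarrow> iter_deriv vs h p = 0) \<Longrightarrow> vanishes (Suc k) p h"
  unfolding vanishes_def by (metis less_Suc_eq)

lemma vanishes_at: "vanishes k p h \<Longrightarrow> k \<ge> 1 \<Longrightarrow> h p = 0"
  using vanishes_Suc vanishes_mono by fastforce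

section \<open>Leading terms of products and compositions at a point\<close>

locale smooth_point =
  fixes S :: "'a::real_normed_vector set" and p :: 'a
  assumes open_S: "open S" and p_in: "p \<in> S"
begin

lemma vanishes_cong: "smooth_on S f \<Longrightarrow> (\<And>x. x \<in> S \<Longrightarrow> f x = g x) \<Longrightarrow> vanishes k p f \<longleftrightarrow> vanishes k p g"
  unfolding vanishes_def using iter_deriv_cong[OF open_S _ _ p_in, of f g] by simp

lemma vanishes_add:
  "smooth_on S f \<Longrightarrow> smooth_on S g \<Longrightarrow> vanishes k p f \<Longrightarrow> vanishes k p g \<Longrightarrow> vanishes k p (\<lambda>x. f x + g x)"
  unfolding vanishes_def using iter_deriv_add[OF open_S _ _ p_in, of f g] by simp

lemma vanishes_diff:
  "smooth_on S f \<Longrightarrow> smooth_on S g \<Longrightarrow> vanishes k p f \<Longrightarrow> vanishes k p g \<Longrightarrow> vanishes k p (\<lambda>x. f x - g x)"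
  unfolding vanishes_def using iter_deriv_diff[OF open_S _ _ p_in, of f g] by simp

text \<open>By Leibniz a derivative lowers the order of only one factor in each summand. If the
  differentiated factor has order 0 already, the other one carries the whole order with one to
  spare.\<close>

lemma vanishes_mult:
  "smooth_on S f \<Longrightarrow> smooth_on S g \<Longrightarrow> vanishes j p f \<Longrightarrow> vanishes k p g \<Longrightarrow>
    vanishes (j + k) p (\<lambda>x. f x * g x)"
proof (induction "j + k" arbitrary: j k f g)
  case (Suc m)
  note sm = Suc.prems(1,2)
  have "f p * g p = 0"
    using Suc.hyps(2) Suc.prems(3,4) vanishes_at[of j p f] vanishes_at[of k p g] by (cases j) auto
  moreover have "vanishes m p (dir_deriv v (\<lambda>x. f x * g x))" for v
  proof -
    note d = smooth_on_dir_deriv[OF sm(1), of v] smooth_on_dir_deriv[OF sm(2), of v]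
    have 1: "vanishes m p (\<lambda>x. f x * dir_deriv v g x)"
    proof (cases k)
      case 0
      have "vanishes m p f" by (rule vanishes_mono[OF Suc.prems(3)]) (use Suc.hyps(2) 0 in simp)
      then show ?thesis
        using Suc.hyps(1)[of m 0, OF _ sm(1) d(2)] by simp
    next
      case (Suc k')
      have "vanishes k' p (dir_deriv v g)" using Suc.prems(4) Suc by (simp add: vanishes_Suc)
      then show ?thesis
        using Suc.hyps(1)[of j k', OF _ sm(1) d(2) Suc.prems(3)] Suc.hyps(2) Suc by simp
    qed
    have 2: "vanishes m p (\<lambda>x. dir_deriv v f x * g x)"
    proof (cases j)
      case 0
      have "vanishes m p g" by (rule vanishes_mono[OF Suc.prems(4)]) (use Suc.hyps(2) 0 in simp)
      then show ?thesis
        using Suc.hyps(1)[of 0 m, OF _ d(1) sm(2)] by simp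
    next
      case (Suc j')
      have "vanishes j' p (dir_deriv v f)" using Suc.prems(3) Suc by (simp add: vanishes_Suc)
      then show ?thesis
        using Suc.hyps(1)[of j' k, OF _ d(1) sm(2) _ Suc.prems(4)] Suc.hyps(2) Suc by simp
    qed
    have "vanishes m p (\<lambda>x. f x * dir_deriv v g x + dir_deriv v f x * g x)"
      by (rule vanishes_add[OF smooth_on_mult[OF open_S sm(1) d(2)] smooth_on_mult[OF open_S d(1) sm(2)] 1 2])
    moreover have "vanishes m p (dir_deriv v (\<lambda>x. f x * g x)) \<longleftrightarrow>
        vanishes m p (\<lambda>x. f x * dir_deriv v g x + dir_deriv v f x * g x)"
      by (rule vanishes_cong[OF smooth_on_dir_deriv[OF smooth_on_mult[OF open_S sm]] dir_deriv_mult[OF sm]])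
    ultimately show ?thesis by simp
  qed
  ultimately show ?case
    using vanishes_Suc[of m p "\<lambda>x. f x * g x"] Suc.hyps(2) by simp
qed simp

text \<open>Replacing g by its value at p costs \<open>f x * (g x - g p)\<close>, which vanishes to
  one order more than \<open>vs\<close> can detect.\<close>

lemma iter_deriv_lead_mult:
  assumes sm: "smooth_on S f" "smooth_on S g" and f: "vanishes (length vs) p f"
  shows "iter_deriv vs (\<lambda>x. f x * g x) p = iter_deriv vs f p * g p"
proof -
  have "vanishes 1 p (\<lambda>x. g x - g p)"
    by (simp add: vanishes_def)
  then have "vanishes (length vs + 1) p (\<lambda>x. f x * (g x - g p))"
    by (intro vanishes_mult smooth_intros open_S sm f)
  then have "iter_deriv vs (\<lambda>x. f x * (g x - g p)) p = 0"
    by (simp add: vanishes_def)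
  moreover have "(\<lambda>x. f x * (g x - g p)) = (\<lambda>x. f x * g x - g p * f x)"
    by (auto simp: algebra_simps)
  ultimately show ?thesis
    using iter_deriv_diff[OF open_S _ _ p_in, of "\<lambda>x. f x * g x" "\<lambda>x. g p * f x" vs]
      iter_deriv_cmult[OF open_S sm(1) p_in, of vs "g p"]
    by (simp add: smooth_intros open_S sm)
qed

text \<open>Splits the difference of two chain rules into two products, each containing one
  difference as a factor; this is the form in which orders of vanishing can be counted.\<close>

lemma dir_deriv_compose_diff:
  fixes q :: "real \<Rightarrow> real"
  assumes "smooth_on UNIV q" "smooth_on S f" "smooth_on S g" "x \<in> S"
  shows "dir_deriv v (\<lambda>x. q (f x) - q (g x)) x =
    (dir_deriv 1 q (f x) - dir_deriv 1 q (g x)) * dir_deriv v f x +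
    dir_deriv v (\<lambda>x. f x - g x) x * dir_deriv 1 q (g x)"
proof -
  note fg = smooth_on_compose[OF open_S assms(1,2)] smooth_on_compose[OF open_S assms(1,3)]
  show ?thesis
    unfolding dir_deriv_diff[OF fg assms(4)] dir_deriv_diff[OF assms(2-4)]
      dir_deriv_compose[OF assms(1,2,4)] dir_deriv_compose[OF assms(1,3,4)]
    by (simp add: algebra_simps)
qed

lemma smooth_compose_diff:
  fixes q :: "real \<Rightarrow> real"
  assumes "smooth_on UNIV q" "smooth_on S f" "smooth_on S g"
  shows "smooth_on S (\<lambda>x. q (f x) - q (g x))"
  by (rule smooth_on_diff[OF open_S smooth_on_compose[OF open_S assms(1,2)] smooth_on_compose[OF open_S assms(1,3)]])

text \<open>Differentiation replaces q by its derivative, so the induction has to run over all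
  smooth q at once.\<close>

lemma vanishes_compose_diff:
  fixes q :: "real \<Rightarrow> real"
  assumes "smooth_on S f" "smooth_on S g"
  shows "smooth_on UNIV q \<Longrightarrow> vanishes k p (\<lambda>x. f x - g x) \<Longrightarrow> vanishes k p (\<lambda>x. q (f x) - q (g x))"
proof (induction k arbitrary: q)
  case (Suc k)
  note q = Suc.prems(1)
  have "f p = g p" using vanishes_at[OF Suc.prems(2)] by simp
  moreover have "vanishes k p (dir_deriv v (\<lambda>x. q (f x) - q (g x)))" for v
  proof -
    have sm: "smooth_on S (\<lambda>x. dir_deriv 1 q (f x) - dir_deriv 1 q (g x))"
      "smooth_on S (\<lambda>x. dir_deriv 1 q (g x))"
      "smooth_on S (dir_deriv v (\<lambda>x. f x - g x))"
      by (rule smooth_compose_diff[OF smooth_on_dir_deriv[OF q] assms]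
          smooth_on_compose[OF open_S smooth_on_dir_deriv[OF q] assms(2)]
          smooth_on_dir_deriv[OF smooth_on_diff[OF open_S assms]])+
    have "vanishes (k + 0) p (\<lambda>x. (dir_deriv 1 q (f x) - dir_deriv 1 q (g x)) * dir_deriv v f x)"
      using Suc.IH[OF smooth_on_dir_deriv[OF q]] vanishes_mono[OF Suc.prems(2)]
      by (intro vanishes_mult sm smooth_on_dir_deriv[OF assms(1)]) auto
    moreover have "vanishes (k + 0) p (\<lambda>x. dir_deriv v (\<lambda>x. f x - g x) x * dir_deriv 1 q (g x))"
      using Suc.prems(2) by (intro vanishes_mult sm) (auto simp: vanishes_Suc)
    ultimately have "vanishes k p (\<lambda>x. (dir_deriv 1 q (f x) - dir_deriv 1 q (g x)) * dir_deriv v f x +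
        dir_deriv v (\<lambda>x. f x - g x) x * dir_deriv 1 q (g x))"
      by (intro vanishes_add smooth_on_mult[OF open_S] smooth_on_dir_deriv[OF assms(1)] sm) simp_all
    moreover have "vanishes k p (dir_deriv v (\<lambda>x. q (f x) - q (g x))) \<longleftrightarrow>
      vanishes k p (\<lambda>x. (dir_deriv 1 q (f x) - dir_deriv 1 q (g x)) * dir_deriv v f x +
        dir_deriv v (\<lambda>x. f x - g x) x * dir_deriv 1 q (g x))"
      by (rule vanishes_cong[OF smooth_on_dir_deriv[OF smooth_compose_diff[OF q assms]] dir_deriv_compose_diff[OF q assms]])
    ultimately show ?thesis by simp
  qed
  ultimately show ?case by (simp add: vanishes_Suc)
qed simp

text \<open>The summand with a difference of derivatives of q keeps the full order and is invisible
  to the remaining directions. For an empty list nothing would force f and g to agree at p, and the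
  formula would fail.\<close>

lemma iter_deriv_compose_diff:
  fixes q :: "real \<Rightarrow> real"
  assumes q: "smooth_on UNIV q" and fg: "smooth_on S f" "smooth_on S g"
    and k: "vanishes (length vs) p (\<lambda>x. f x - g x)" "vs \<noteq> []"
  shows "iter_deriv vs (\<lambda>x. q (f x) - q (g x)) p = dir_deriv 1 q (g p) * iter_deriv vs (\<lambda>x. f x - g x) p"
proof (cases vs)
  case (Cons v ws)
  have sm: "smooth_on S (\<lambda>x. dir_deriv 1 q (f x) - dir_deriv 1 q (g x))"
    "smooth_on S (\<lambda>x. dir_deriv 1 q (g x))"
    "smooth_on S (dir_deriv v (\<lambda>x. f x - g x))"
    by (rule smooth_compose_diff[OF smooth_on_dir_deriv[OF q] fg]
        smooth_on_compose[OF open_S smooth_on_dir_deriv[OF q] fg(2)]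
        smooth_on_dir_deriv[OF smooth_on_diff[OF open_S fg]])+
  have "vanishes (length vs + 0) p (\<lambda>x. (dir_deriv 1 q (f x) - dir_deriv 1 q (g x)) * dir_deriv v f x)"
    using vanishes_compose_diff[OF fg smooth_on_dir_deriv[OF q] k(1)]
    by (intro vanishes_mult sm smooth_on_dir_deriv[OF fg(1)]) auto
  then have 1: "iter_deriv ws (\<lambda>x. (dir_deriv 1 q (f x) - dir_deriv 1 q (g x)) * dir_deriv v f x) p = 0"
    by (simp add: vanishes_def Cons)
  have 2: "iter_deriv ws (\<lambda>x. dir_deriv v (\<lambda>x. f x - g x) x * dir_deriv 1 q (g x)) p =
      iter_deriv ws (dir_deriv v (\<lambda>x. f x - g x)) p * dir_deriv 1 q (g p)"
    using k(1) by (intro iter_deriv_lead_mult sm) (auto simp: Cons vanishes_Suc)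
  have "iter_deriv vs (\<lambda>x. q (f x) - q (g x)) p =
      iter_deriv ws (\<lambda>x. (dir_deriv 1 q (f x) - dir_deriv 1 q (g x)) * dir_deriv v f x +
        dir_deriv v (\<lambda>x. f x - g x) x * dir_deriv 1 q (g x)) p"
    unfolding Cons iter_deriv.simps
    by (rule iter_deriv_cong[OF open_S smooth_on_dir_deriv[OF smooth_compose_diff[OF q fg]]
          dir_deriv_compose_diff[OF q fg] p_in])
  also have "\<dots> = iter_deriv ws (dir_deriv v (\<lambda>x. f x - g x)) p * dir_deriv 1 q (g p)"
    using 1 2 iter_deriv_add[OF open_S smooth_on_mult[OF open_S sm(1) smooth_on_dir_deriv[OF fg(1)]]
        smooth_on_mult[OF open_S sm(3,2)] p_in, of ws v] by simp
  finally show ?thesis by (simp add: Cons)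
qed (use k in simp)

lemma vanishes_compose:
  fixes q :: "real \<Rightarrow> real"
  assumes "smooth_on S g"
  shows "smooth_on UNIV q \<Longrightarrow> vanishes k (g p) q \<Longrightarrow> vanishes k p (\<lambda>x. q (g x))"
proof (induction k arbitrary: q)
  case (Suc k)
  note q = Suc.prems(1)
  have "vanishes k p (dir_deriv v (\<lambda>x. q (g x)))" for v
  proof -
    have "vanishes (k + 0) p (\<lambda>x. dir_deriv 1 q (g x) * dir_deriv v g x)"
      using Suc.prems(2)
      by (intro vanishes_mult smooth_on_compose[OF open_S smooth_on_dir_deriv[OF q] assms]
          smooth_on_dir_deriv[OF assms] Suc.IH[OF smooth_on_dir_deriv[OF q]]) (simp_all add: vanishes_Suc)
    moreover have "vanishes k p (dir_deriv v (\<lambda>x. q (g x))) \<longleftrightarrow>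
        vanishes k p (\<lambda>x. dir_deriv 1 q (g x) * dir_deriv v g x)"
      by (rule vanishes_cong[OF smooth_on_dir_deriv[OF smooth_on_compose[OF open_S q assms]] dir_deriv_compose[OF q assms]])
    ultimately show ?thesis by simp
  qed
  then show ?case using Suc.prems(2) by (simp add: vanishes_Suc)
qed simp

text \<open>Of the higher chain rule only the term with all derivatives on q survives, as q vanishes
  to lower orders at \<open>g p\<close>.\<close>

lemma iter_deriv_compose:
  fixes q :: "real \<Rightarrow> real"
  assumes "smooth_on S g"
  shows "smooth_on UNIV q \<Longrightarrow> vanishes (length vs) (g p) q \<Longrightarrow>
    iter_deriv vs (\<lambda>x. q (g x)) p =
    iter_deriv (replicate (length vs) 1) q (g p) * prod_list (map (\<lambda>v. dir_deriv v g p) vs)"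
proof (induction vs arbitrary: q)
  case (Cons v ws)
  note q = Cons.prems(1)
  have d: "vanishes (length ws) (g p) (dir_deriv 1 q)"
    using Cons.prems(2) by (simp add: vanishes_Suc)
  have "iter_deriv (v # ws) (\<lambda>x. q (g x)) p = iter_deriv ws (\<lambda>x. dir_deriv 1 q (g x) * dir_deriv v g x) p"
    unfolding iter_deriv.simps
    by (rule iter_deriv_cong[OF open_S smooth_on_dir_deriv[OF smooth_on_compose[OF open_S q assms]]
          dir_deriv_compose[OF q assms] p_in])
  also have "\<dots> = iter_deriv ws (\<lambda>x. dir_deriv 1 q (g x)) p * dir_deriv v g p"
    by (rule iter_deriv_lead_mult[OF smooth_on_compose[OF open_S smooth_on_dir_deriv[OF q] assms]
          smooth_on_dir_deriv[OF assms] vanishes_compose[OF assms smooth_on_dir_deriv[OF q] d]])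
  also have "\<dots> = iter_deriv (replicate (length ws) 1) (dir_deriv 1 q) (g p) *
      prod_list (map (\<lambda>v. dir_deriv v g p) ws) * dir_deriv v g p"
    by (subst Cons.IH[OF smooth_on_dir_deriv[OF q] d]) simp
  finally show ?case by simp
qed simp

end

section \<open>Ordinary and mixed partial derivatives as iterated directional derivatives\<close>

lemma dir_deriv_real:
  fixes h :: "real \<Rightarrow> real"
  assumes "smooth_on UNIV h"
  shows "dir_deriv v h = (\<lambda>x. v * deriv h x)" "deriv h = dir_deriv 1 h"
proof -
  have d: "(h has_real_derivative dir_deriv 1 h x) (at x)" for x
    using smooth_on_has_real_derivative[OF assms] by simp
  show "deriv h = dir_deriv 1 h"
    using DERIV_imp_deriv[OF d] by blast
  then have "(h has_derivative (\<lambda>v. deriv h x * v)) (at x)" for x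
    using d[of x] by (simp add: has_field_derivative_def)
  then show "dir_deriv v h = (\<lambda>x. v * deriv h x)"
    using dir_deriv_unique by (metis mult.commute)
qed

lemma iter_deriv_real:
  fixes h :: "real \<Rightarrow> real"
  shows "smooth_on UNIV h \<Longrightarrow> iter_deriv vs h c = prod_list vs * (deriv ^^ length vs) h c"
proof (induction vs arbitrary: h)
  case (Cons v vs)
  have sm: "smooth_on UNIV (deriv h)"
    using smooth_on_dir_deriv[OF Cons.prems] by (simp add: dir_deriv_real(2)[OF Cons.prems])
  show ?case
    using Cons.IH[OF sm] iter_deriv_cmult[OF open_UNIV sm, of c vs v]
    by (simp add: dir_deriv_real(1)[OF Cons.prems] funpow_swap1)
qed simp

lemma vanishes_real:
  fixes h :: "real \<Rightarrow> real"
  shows "smooth_on UNIV h \<Longrightarrow> (\<And>j. j < k \<Longrightarrow> (deriv ^^ j) h c = 0) \<Longrightarrow> vanishes k c h"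
  unfolding vanishes_def by (simp add: iter_deriv_real)

definition strip :: "(real \<times> real) set" where
  "strip = UNIV \<times> {0<..<pi}"

lemma open_strip [simp]: "open strip"
  by (simp add: strip_def open_Times)

lemma mem_strip: "q \<in> strip \<longleftrightarrow> 0 < snd q \<and> snd q < pi"
  by (cases q) (auto simp: strip_def)

text \<open>\<open>mixed_deriv\<close> iterates \<open>deriv\<close> on slices, the angle first,
  hence the order of the list. Angle slices make sense only on the open interval, so that each
  \<open>deriv\<close> there is transferred on an open set; slices in s are whole lines.\<close>

lemma mixed_deriv_eq_iter_deriv:
  assumes h: "smooth_on strip h" and p: "p \<in> strip"
  shows "mixed_deriv a b h p = iter_deriv (replicate b (0, 1) @ replicate a (1, 0)) h p"
proof -
  have y: "(deriv ^^ b) (\<lambda>y. h (x, y)) y = iter_deriv (replicate b (0, 1)) h (x, y)"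
    if "0 < y" "y < pi" for x y
    using that
  proof (induction b arbitrary: y)
    case (Suc b)
    let ?H = "iter_deriv (replicate b (0, 1)) h"
    have "smooth_on strip ?H" by (rule smooth_on_iter_deriv[OF h])
    then have d: "(?H has_derivative (\<lambda>v. dir_deriv v ?H (x, y))) (at (x, y))"
      using Suc.prems by (intro smooth_on_has_derivative) (auto simp: mem_strip)
    moreover have "((\<lambda>y. (x, y)) has_derivative (\<lambda>t. (0, t))) (at y)"
      by (auto intro!: derivative_eq_intros)
    ultimately have "((\<lambda>y. ?H (x, y)) has_derivative (\<lambda>t. dir_deriv (0, t) ?H (x, y))) (at y)"
      by (rule has_derivative_compose[rotated])
    moreover have "(\<lambda>t. dir_deriv (0, t) ?H (x, y)) = (*) (dir_deriv (0, 1) ?H (x, y))"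
    proof
      fix t
      show "dir_deriv (0, t) ?H (x, y) = dir_deriv (0, 1) ?H (x, y) * t"
        using linear.scaleR[OF has_derivative_linear[OF d], of t "(0, 1)"] by (simp add: mult.commute)
    qed
    ultimately have "((\<lambda>y. ?H (x, y)) has_real_derivative dir_deriv (0, 1) ?H (x, y)) (at y)"
      by (simp add: has_field_derivative_def)
    then have "((deriv ^^ b) (\<lambda>y. h (x, y)) has_real_derivative dir_deriv (0, 1) ?H (x, y)) (at y)"
      by (rule has_field_derivative_transform_within_open[where S = "{0<..<pi}"])
        (use Suc in auto)
    then show ?case
      unfolding iter_deriv_replicate_Suc by (simp add: DERIV_imp_deriv)
  qed simp
  define H where "H = iter_deriv (replicate b (0, 1)) h"
  have H: "smooth_on strip H" unfolding H_def by (rule smooth_on_iter_deriv[OF h])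
  obtain x0 y0 where p0: "p = (x0, y0)" by (cases p)
  then have y0: "0 < y0" "y0 < pi" using p by (auto simp: mem_strip)
  have "(deriv ^^ a) (\<lambda>x. H (x, y0)) x = iter_deriv (replicate a (1, 0)) H (x, y0)" for x
  proof (induction a arbitrary: x)
    case (Suc a)
    let ?H = "iter_deriv (replicate a (1, 0)) H"
    have "smooth_on strip ?H" by (rule smooth_on_iter_deriv[OF H])
    then have d: "(?H has_derivative (\<lambda>v. dir_deriv v ?H (x, y0))) (at (x, y0))"
      using y0 by (intro smooth_on_has_derivative) (auto simp: mem_strip)
    moreover have "((\<lambda>x. (x, y0)) has_derivative (\<lambda>t. (t, 0))) (at x)"
      by (auto intro!: derivative_eq_intros)
    ultimately have "((\<lambda>x. ?H (x, y0)) has_derivative (\<lambda>t. dir_deriv (t, 0) ?H (x, y0))) (at x)"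
      by (rule has_derivative_compose[rotated])
    moreover have "(\<lambda>t. dir_deriv (t, 0) ?H (x, y0)) = (*) (dir_deriv (1, 0) ?H (x, y0))"
    proof
      fix t
      show "dir_deriv (t, 0) ?H (x, y0) = dir_deriv (1, 0) ?H (x, y0) * t"
        using linear.scaleR[OF has_derivative_linear[OF d], of t "(1, 0)"] by (simp add: mult.commute)
    qed
    ultimately have "((\<lambda>x. ?H (x, y0)) has_real_derivative dir_deriv (1, 0) ?H (x, y0)) (at x)"
      by (simp add: has_field_derivative_def)
    moreover have "(deriv ^^ a) (\<lambda>x. H (x, y0)) = (\<lambda>x. ?H (x, y0))"
      using Suc by blast
    ultimately show ?case
      unfolding iter_deriv_replicate_Suc by (simp add: DERIV_imp_deriv)
  qed simp
  moreover have "(\<lambda>x. (deriv ^^ b) (\<lambda>y. h (x, y)) y0) = (\<lambda>x. H (x, y0))"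
    using y[OF y0] by (simp add: H_def)
  ultimately show ?thesis
    by (simp add: mixed_deriv_def p0 iter_deriv_append H_def)
qed

section \<open>Convex billiard tables\<close>

lemma periodic_int:
  fixes f :: "real \<Rightarrow> 'a"
  assumes "\<And>s. f (s + 1) = f s"
  shows "f (s + of_int k) = f s"
proof (induction k rule: int_induct[where k = 0])
  case (step1 i)
  then show ?case using assms[of "s + of_int i"] by (simp add: add.assoc)
next
  case (step2 i)
  then show ?case using assms[of "s + of_int (i - 1)"] by (simp add: add.assoc)
qed simp

lemma periodic_frac:
  fixes f :: "real \<Rightarrow> 'a"
  assumes "\<And>s. f (s + 1) = f s"
  shows "f (frac s) = f s"
  using periodic_int[of f "s" "- \<lfloor>s\<rfloor>"] assms by (simp add: frac_def)

lemma periodic_bounded: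
  fixes f :: "real \<Rightarrow> real"
  assumes "\<And>s. f (s + 1) = f s" "continuous_on UNIV f"
  obtains B where "B > 0" "\<And>s. \<bar>f s\<bar> \<le> B"
proof -
  have "bounded (f ` {0..1})"
    by (intro compact_imp_bounded compact_continuous_image continuous_on_subset[OF assms(2)]) auto
  then obtain B where B: "B > 0" "\<And>x. x \<in> {0..1} \<Longrightarrow> \<bar>f x\<bar> \<le> B"
    by (auto simp: bounded_pos)
  have "\<bar>f s\<bar> \<le> B" for s
    using B(2)[of "frac s"] periodic_frac[of f, OF assms(1)] frac_ge_0[of s] frac_lt_1[of s] by simp
  with B(1) show ?thesis by (rule that)
qed

lemma deriv_periodic:
  fixes f :: "real \<Rightarrow> real"
  assumes "\<And>s. f (s + 1) = f s"
  shows "deriv f (s + 1) = deriv f s"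
proof -
  have "(\<lambda>x. f (x + 1)) = f" using assms by auto
  then have "(f has_field_derivative y) (at (s + 1)) \<longleftrightarrow> (f has_field_derivative y) (at s)" for y
    using DERIV_shift[of f y s 1] by simp
  then show ?thesis by (simp add: deriv_def)
qed

lemma has_vector_derivative_shift_arg:
  assumes "(g has_vector_derivative D) (at (s + c))"
  shows "((\<lambda>x. g (x + c)) has_vector_derivative D) (at s)"
proof -
  have "((\<lambda>x. x + c) has_vector_derivative 1) (at s)"
    by (auto intro!: derivative_eq_intros simp flip: has_real_derivative_iff_has_vector_derivative)
  from vector_diff_chain_at[OF this assms] show ?thesis by (simp add: o_def)
qed

text \<open>The derivatives are continuous and periodic, hence bounded, which makes the Taylor
  remainders uniform in s.\<close>

lemma periodic_smooth_taylor:
  fixes f :: "real \<Rightarrow> real"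
  assumes per: "\<And>s. f (s + 1) = f s" and f: "smooth_on UNIV f"
  obtains B where "B > 0"
    "\<And>s x. \<bar>f (s + x) - f s\<bar> \<le> B * \<bar>x\<bar>"
    "\<And>s x. \<bar>f (s + x) - f s - deriv f s * x - deriv (deriv f) s * x\<^sup>2 / 2\<bar> \<le> B * \<bar>x\<bar> ^ 3"
proof -
  have smd: "smooth_on UNIV ((deriv ^^ m) f)" for m
  proof (induction m)
    case (Suc m)
    show ?case
      using smooth_on_dir_deriv[OF Suc, of 1] by (simp add: dir_deriv_real(2)[OF Suc])
  qed (use f in simp)
  have perd: "(deriv ^^ m) f (s + 1) = (deriv ^^ m) f s" for m s
    by (induction m arbitrary: s) (auto intro: deriv_periodic per)
  have D: "((deriv ^^ m) f has_real_derivative (deriv ^^ Suc m) f s) (at s)" for m s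
    using smooth_on_has_real_derivative[OF smd, of s m] by (simp add: dir_deriv_real(2)[OF smd])
  obtain B1 where B1: "B1 > 0" "\<And>s. \<bar>(deriv ^^ 1) f s\<bar> \<le> B1"
    by (rule periodic_bounded[OF perd smooth_on_continuous_on[OF smd]]) blast
  obtain B3 where B3: "B3 > 0" "\<And>s. \<bar>(deriv ^^ 3) f s\<bar> \<le> B3"
    by (rule periodic_bounded[OF perd smooth_on_continuous_on[OF smd]]) blast
  have taylor: "\<exists>t. f (s + x) = (\<Sum>m<n. (deriv ^^ m) f s / fact m * x ^ m) + (deriv ^^ n) f (s + t) / fact n * x ^ n"
    for s x n
  proof -
    have "\<exists>t. \<bar>t\<bar> \<le> \<bar>x\<bar> \<and> f (s + x) =
        (\<Sum>m<n. (deriv ^^ m) f (s + 0) / fact m * x ^ m) + (deriv ^^ n) f (s + t) / fact n * x ^ n"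
    proof (rule Maclaurin_all_le[where diff = "\<lambda>m x. (deriv ^^ m) f (s + x)"])
      show "\<forall>m x. ((\<lambda>x. (deriv ^^ m) f (s + x)) has_real_derivative (deriv ^^ Suc m) f (s + x)) (at x)"
      proof (intro allI)
        fix m x
        show "((\<lambda>x. (deriv ^^ m) f (s + x)) has_real_derivative (deriv ^^ Suc m) f (s + x)) (at x)"
          using D[of m "x + s"] DERIV_shift[of "(deriv ^^ m) f" "(deriv ^^ Suc m) f (x + s)" x s]
          by (simp add: add.commute)
      qed
    qed simp
    then show ?thesis by auto
  qed
  show ?thesis
  proof (rule that[of "B1 + B3"])
    show "\<bar>f (s + x) - f s\<bar> \<le> (B1 + B3) * \<bar>x\<bar>" for s x
    proof -
      obtain t where "f (s + x) = f s + (deriv ^^ 1) f (s + t) * x"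
        using taylor[of s x 1] by auto
      then have "\<bar>f (s + x) - f s\<bar> = \<bar>(deriv ^^ 1) f (s + t)\<bar> * \<bar>x\<bar>"
        by (simp add: abs_mult)
      also have "\<dots> \<le> (B1 + B3) * \<bar>x\<bar>"
        using B1(2)[of "s + t"] B3(1) by (intro mult_right_mono) auto
      finally show ?thesis .
    qed
    show "\<bar>f (s + x) - f s - deriv f s * x - deriv (deriv f) s * x\<^sup>2 / 2\<bar> \<le> (B1 + B3) * \<bar>x\<bar> ^ 3" for s x
    proof -
      obtain t where "f (s + x) = f s + deriv f s * x + deriv (deriv f) s * x\<^sup>2 / 2 + (deriv ^^ 3) f (s + t) / 6 * x ^ 3"
        using taylor[of s x 3] by (auto simp: numeral_eq_Suc fact_numeral)
      then have "\<bar>f (s + x) - f s - deriv f s * x - deriv (deriv f) s * x\<^sup>2 / 2\<bar> = \<bar>(deriv ^^ 3) f (s + t) / 6\<bar> * \<bar>x\<bar> ^ 3"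
        by (simp add: abs_mult power_abs)
      also have "\<dots> \<le> (B1 + B3) * \<bar>x\<bar> ^ 3"
        using B3(2)[of "s + t"] B1(1) B3(1) by (intro mult_right_mono) auto
      finally show ?thesis .
    qed
  qed (use B1 B3 in simp)
qed

text \<open>A lift of the tangent direction to the real line, unique up to a multiple of 2 pi; it
  makes the reflection law additive.\<close>

definition tangent_angle :: "(real \<Rightarrow> complex) \<Rightarrow> real \<Rightarrow> real" where
  "tangent_angle \<gamma> = (SOME \<theta>. \<forall>s. (\<theta> has_real_derivative curvature \<gamma> s) (at s) \<and> tangent \<gamma> s = cis (\<theta> s))"

section \<open>Frenet frame, tangent angle and chords\<close>

locale billiard_table =
  fixes \<Omega> :: "complex set" and \<gamma> :: "real \<Rightarrow> complex"
  assumes arc: "arc_param \<Omega> \<gamma>"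
begin

abbreviation "T \<equiv> tangent \<gamma>"
abbreviation "\<kappa> \<equiv> curvature \<gamma>"
abbreviation "\<theta> \<equiv> tangent_angle \<gamma>"
abbreviation "f \<equiv> billiard_map \<gamma>"

lemma smooth_gamma: "smooth_on UNIV \<gamma>"
  and periodic: "\<gamma> (s + 1) = \<gamma> s"
  and inj_gamma: "inj_on \<gamma> {0..<1}"
  and range_gamma: "range \<gamma> = frontier \<Omega>"
  and norm_T: "norm (T s) = 1"
  and curvature_pos: "\<kappa> s > 0"
  and open_Omega: "open \<Omega>"
  and bounded_Omega: "bounded \<Omega>"
  and segment_Omega: "x \<in> closure \<Omega> \<Longrightarrow> y \<in> closure \<Omega> \<Longrightarrow> x \<noteq> y \<Longrightarrow> open_segment x y \<subseteq> \<Omega>"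
  using arc by (auto simp: arc_param_def strictly_convex_domain_def)

lemma T_cnj: "T s * cnj (T s) = 1"
  using norm_T[of s] by (simp add: complex_norm_square[symmetric])

lemma gamma_deriv: "(\<gamma> has_vector_derivative T s) (at s)"
proof -
  have "Ck_on (Suc 0) UNIV \<gamma>" using smooth_gamma unfolding smooth_on_def by blast
  then have "\<gamma> differentiable (at s)" by (rule Ck_on_Suc_differentiable) simp
  then show ?thesis
    unfolding tangent_def using vector_derivative_works by blast
qed

lemma Ck_T: "Ck_on k UNIV T"
proof -
  have "Ck_on (Suc k) UNIV \<gamma>" using smooth_gamma unfolding smooth_on_def by blast
  then have "Ck_on k UNIV (\<lambda>x. frechet_derivative \<gamma> (at x) 1)" by (rule Ck_on_Suc_deriv)
  moreover have "frechet_derivative \<gamma> (at x) 1 = T x" for x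
    using frechet_derivative_at[OF gamma_deriv[of x, unfolded has_vector_derivative_def]] by (metis scaleR_one)
  ultimately show ?thesis by simp
qed

text \<open>Frenet equation: differentiating \<open>T s * cnj (T s) = 1\<close> shows that the
  derivative of T is normal, and its normal component is the curvature by definition.\<close>

lemma T_deriv: "(T has_vector_derivative (\<kappa> s *\<^sub>R (\<i> * T s))) (at s)"
proof -
  define D where "D = vector_derivative T (at s)"
  have "T differentiable (at s)" by (rule Ck_on_Suc_differentiable[OF Ck_T]) simp
  then have D: "(T has_vector_derivative D) (at s)"
    unfolding D_def using vector_derivative_works by blast
  have "((\<lambda>x. T x * cnj (T x)) has_vector_derivative (T s * cnj D + D * cnj (T s))) (at s)"
    by (intro has_vector_derivative_mult D has_vector_derivative_cnj)
  then have "((\<lambda>x. 1) has_vector_derivative (T s * cnj D + D * cnj (T s))) (at s)"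
    by (simp add: T_cnj)
  then have "T s * cnj D + D * cnj (T s) = 0"
    using vector_derivative_unique_at has_vector_derivative_const by blast
  then have "Re (D * cnj (T s)) = 0"
    by (simp add: complex_eq_iff)
  moreover have "\<kappa> s = Im (D * cnj (T s))"
    by (simp add: curvature_def D_def inner_complex_def)
  ultimately have "D * cnj (T s) = \<i> * \<kappa> s"
    by (simp add: complex_eq_iff)
  then have "D * cnj (T s) * T s = \<i> * \<kappa> s * T s" by simp
  then have "D = \<i> * \<kappa> s * T s"
    using T_cnj[of s] by (simp add: mult.assoc mult.commute[of "cnj (T s)"])
  then show ?thesis using D by (simp add: scaleR_conv_of_real algebra_simps)
qed

text \<open>The curvature is the imaginary part of T' times the conjugate of T, a polynomial in the
  real coordinates of T and T'.\<close>

lemma smooth_curvature: "smooth_on UNIV \<kappa>"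
proof -
  have T': "frechet_derivative T (at x) 1 = \<kappa> x *\<^sub>R (\<i> * T x)" for x
    using frechet_derivative_at[OF T_deriv[of x, unfolded has_vector_derivative_def]] by (metis scaleR_one)
  have "Ck_on k UNIV (\<lambda>x. \<kappa> x *\<^sub>R (\<i> * T x))" for k
    using Ck_on_Suc_deriv[OF Ck_T, of k 1] by (simp add: T')
  note k = this
  have "smooth_on UNIV (\<lambda>x. Re (\<kappa> x *\<^sub>R (\<i> * T x)))" "smooth_on UNIV (\<lambda>x. Im (\<kappa> x *\<^sub>R (\<i> * T x)))"
    "smooth_on UNIV (\<lambda>x. Re (T x))" "smooth_on UNIV (\<lambda>x. Im (T x))"
    unfolding smooth_on_def
    by (rule allI, rule Ck_on_compose_bounded_linear[OF bounded_linear_Re open_UNIV k]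
        Ck_on_compose_bounded_linear[OF bounded_linear_Im open_UNIV k]
        Ck_on_compose_bounded_linear[OF bounded_linear_Re open_UNIV Ck_T]
        Ck_on_compose_bounded_linear[OF bounded_linear_Im open_UNIV Ck_T])+
  then have "smooth_on UNIV (\<lambda>x. Im (\<kappa> x *\<^sub>R (\<i> * T x)) * Re (T x) - Re (\<kappa> x *\<^sub>R (\<i> * T x)) * Im (T x))"
    by (intro smooth_intros open_UNIV)
  moreover have "Im (\<kappa> x *\<^sub>R (\<i> * T x)) * Re (T x) - Re (\<kappa> x *\<^sub>R (\<i> * T x)) * Im (T x) = \<kappa> x" for x
  proof -
    have "(Re (T x))\<^sup>2 + (Im (T x))\<^sup>2 = 1"
      using norm_T[of x] by (simp add: cmod_def)
    then have "\<kappa> x * ((Re (T x))\<^sup>2 + (Im (T x))\<^sup>2) = \<kappa> x" by simp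
    then show ?thesis by (simp add: algebra_simps power2_eq_square)
  qed
  ultimately show ?thesis by simp
qed

text \<open>For an antiderivative F of the curvature, \<open>T x * cis (- F x)\<close> has
  derivative 0, so it is a constant of modulus 1 and its argument can be added to F.\<close>

lemma tangent_angle: "(\<theta> has_real_derivative \<kappa> s) (at s)" "T s = cis (\<theta> s)"
proof -
  have "isCont \<kappa> x" for x
    using smooth_on_continuous_on[OF smooth_curvature] by (simp add: continuous_on_eq_continuous_at)
  then obtain F where F: "\<And>x. (F has_vector_derivative \<kappa> x) (at x)"
    using einterval_antiderivative[of "-\<infinity>" "\<infinity>" \<kappa>] by auto
  have F': "((\<lambda>x. cis (- F x)) has_vector_derivative (- \<kappa> x *\<^sub>R (\<i> * cis (- F x)))) (at x)" for x
  proof -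
    have "((\<lambda>x. \<i> * of_real (- F x)) has_vector_derivative \<i> * of_real (- \<kappa> x)) (at x)"
      using F by (intro has_vector_derivative_mult_right has_vector_derivative_of_real DERIV_minus)
        (simp add: has_real_derivative_iff_has_vector_derivative)
    from field_vector_diff_chain_at[OF this DERIV_exp]
    have "((\<lambda>x. exp (\<i> * of_real (- F x))) has_vector_derivative
        (\<i> * of_real (- \<kappa> x)) * exp (\<i> * of_real (- F x))) (at x)"
      by (simp add: o_def)
    then show ?thesis by (simp add: cis_conv_exp scaleR_conv_of_real algebra_simps)
  qed
  have "((\<lambda>x. T x * cis (- F x)) has_vector_derivative 0) (at x)" for x
    using has_vector_derivative_mult[OF T_deriv[of x] F'[of x]] by (simp add: algebra_simps)
  then obtain c where c: "\<And>x. T x * cis (- F x) = c"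
    using has_vector_derivative_zero_constant[of UNIV "\<lambda>x. T x * cis (- F x)"] by auto
  have "norm c = 1" using c[of 0] norm_T[of 0] by (metis norm_mult norm_cis mult_1)
  then obtain a where a: "c = cis a"
    using cis_Arg[of c] by (metis norm_zero zero_neq_one sgn_div_norm scaleR_one inverse_1)
  have "T x = cis (F x + a)" for x
  proof -
    have "T x = T x * cis (- F x) * cis (F x)" by (simp add: mult.assoc cis_mult)
    then show ?thesis using c[of x] a by (simp add: cis_mult add.commute)
  qed
  moreover have "((\<lambda>x. F x + a) has_real_derivative \<kappa> x) (at x)" for x
    using F[of x] by (auto intro!: derivative_eq_intros simp: has_real_derivative_iff_has_vector_derivative)
  ultimately have "\<exists>\<theta>. \<forall>s. (\<theta> has_real_derivative \<kappa> s) (at s) \<and> T s = cis (\<theta> s)"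
    by (intro exI[of _ "\<lambda>x. F x + a"]) simp
  then have "\<forall>s. (\<theta> has_real_derivative \<kappa> s) (at s) \<and> T s = cis (\<theta> s)"
    unfolding tangent_angle_def by (rule someI_ex)
  then show "(\<theta> has_real_derivative \<kappa> s) (at s)" "T s = cis (\<theta> s)" by auto
qed

lemma smooth_tangent_angle: "smooth_on UNIV \<theta>"
  using smooth_on_real_antiderivative[OF smooth_curvature tangent_angle(1)] .

lemma Re_gamma_deriv: "((\<lambda>s. Re (\<gamma> s)) has_real_derivative cos (\<theta> s)) (at s)"
  using bounded_linear.has_vector_derivative[OF bounded_linear_Re gamma_deriv[of s]]
  by (simp add: tangent_angle(2) has_real_derivative_iff_has_vector_derivative)

lemma Im_gamma_deriv: "((\<lambda>s. Im (\<gamma> s)) has_real_derivative sin (\<theta> s)) (at s)"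
  using bounded_linear.has_vector_derivative[OF bounded_linear_Im gamma_deriv[of s]]
  by (simp add: tangent_angle(2) has_real_derivative_iff_has_vector_derivative)

lemma smooth_Re_gamma: "smooth_on UNIV (\<lambda>s. Re (\<gamma> s))"
  and smooth_Im_gamma: "smooth_on UNIV (\<lambda>s. Im (\<gamma> s))"
  by (rule smooth_on_real_antiderivative[OF _ Re_gamma_deriv] smooth_on_real_antiderivative[OF _ Im_gamma_deriv];
      intro smooth_intros open_UNIV smooth_tangent_angle)+

lemma T_periodic: "T (s + 1) = T s"
proof -
  have "(\<lambda>x. \<gamma> (x + 1)) = \<gamma>" using periodic by auto
  then have "(\<gamma> has_vector_derivative T (s + 1)) (at s)"
    using has_vector_derivative_shift_arg[OF gamma_deriv[of "s + 1"]] by simp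
  then show ?thesis using gamma_deriv vector_derivative_unique_at by blast
qed

lemma curvature_periodic: "\<kappa> (s + 1) = \<kappa> s"
proof -
  have "(\<lambda>x. T (x + 1)) = T" using T_periodic by auto
  then have "(T has_vector_derivative (\<kappa> (s + 1) *\<^sub>R (\<i> * T (s + 1)))) (at s)"
    using has_vector_derivative_shift_arg[OF T_deriv[of "s + 1"]] by simp
  then have "\<kappa> (s + 1) *\<^sub>R (\<i> * T s) = \<kappa> s *\<^sub>R (\<i> * T s)"
    using T_deriv vector_derivative_unique_at T_periodic by metis
  moreover have "T s \<noteq> 0" using norm_T[of s] by auto
  ultimately show ?thesis by simp
qed

text \<open>The chord in the frame at s, with the tangent as positive real axis: its argument is the
  departure angle, and the inner side is the upper half-plane.\<close>

definition chord :: "real \<Rightarrow> real \<Rightarrow> complex" where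
  "chord s s' = (\<gamma> s' - \<gamma> s) * cnj (T s)"

lemma gamma_chord: "\<gamma> s' = \<gamma> s + chord s s' * T s"
  using T_cnj[of s] by (simp add: chord_def mult.assoc mult.commute[of "cnj (T s)"])

text \<open>Taylor expansion of both coordinates of the curve, rotated into the frame at s;
  periodicity makes the constant independent of s.\<close>

lemma chord_taylor:
  "\<exists>C>0. \<forall>s x. cmod (chord s (s + x) - of_real x - \<i> * of_real (\<kappa> s * x\<^sup>2 / 2)) \<le> C * \<bar>x\<bar> ^ 3"
proof -
  define X where "X = (\<lambda>s. Re (\<gamma> s))"
  define Y where "Y = (\<lambda>s. Im (\<gamma> s))"
  have per: "X (s + 1) = X s" "Y (s + 1) = Y s" for s by (simp_all add: X_def Y_def periodic)
  obtain BX where BX: "BX > 0" "\<And>s x. \<bar>X (s + x) - X s - deriv X s * x - deriv (deriv X) s * x\<^sup>2 / 2\<bar> \<le> BX * \<bar>x\<bar> ^ 3"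
    by (rule periodic_smooth_taylor[of X]) (use per smooth_Re_gamma in \<open>auto simp: X_def\<close>)
  obtain BY where BY: "BY > 0" "\<And>s x. \<bar>Y (s + x) - Y s - deriv Y s * x - deriv (deriv Y) s * x\<^sup>2 / 2\<bar> \<le> BY * \<bar>x\<bar> ^ 3"
    by (rule periodic_smooth_taylor[of Y]) (use per smooth_Im_gamma in \<open>auto simp: Y_def\<close>)
  have dX: "deriv X = (\<lambda>s. cos (\<theta> s))" and dY: "deriv Y = (\<lambda>s. sin (\<theta> s))"
    unfolding X_def Y_def by (auto intro!: DERIV_imp_deriv Re_gamma_deriv Im_gamma_deriv)
  have ddX: "deriv (deriv X) s = - \<kappa> s * sin (\<theta> s)" and ddY: "deriv (deriv Y) s = \<kappa> s * cos (\<theta> s)" for s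
    unfolding dX dY using tangent_angle(1)[of s] by (auto intro!: DERIV_imp_deriv derivative_eq_intros)
  have "cmod (chord s (s + x) - of_real x - \<i> * of_real (\<kappa> s * x\<^sup>2 / 2)) \<le> (BX + BY) * \<bar>x\<bar> ^ 3" for s x
  proof -
    define R where "R = \<gamma> (s + x) - \<gamma> s - of_real x * T s - \<i> * of_real (\<kappa> s * x\<^sup>2 / 2) * T s"
    have "chord s (s + x) - of_real x - \<i> * of_real (\<kappa> s * x\<^sup>2 / 2) = R * cnj (T s)"
      using T_cnj[of s] by (simp add: R_def chord_def algebra_simps)
    then have "cmod (chord s (s + x) - of_real x - \<i> * of_real (\<kappa> s * x\<^sup>2 / 2)) = cmod R"
      by (simp add: norm_mult norm_T)
    also have "\<dots> \<le> \<bar>Re R\<bar> + \<bar>Im R\<bar>" by (rule cmod_le)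
    also have "Re R = X (s + x) - X s - deriv X s * x - deriv (deriv X) s * x\<^sup>2 / 2"
      unfolding ddX unfolding dX by (simp add: R_def X_def tangent_angle(2) power2_eq_square mult.commute)
    also have "Im R = Y (s + x) - Y s - deriv Y s * x - deriv (deriv Y) s * x\<^sup>2 / 2"
      unfolding ddY unfolding dY by (simp add: R_def Y_def tangent_angle(2) power2_eq_square mult.commute)
    finally show ?thesis using BX(2)[of s x] BY(2)[of s x] by (simp add: algebra_simps)
  qed
  then show ?thesis using BX(1) BY(1) by (intro exI[of _ "BX + BY"]) simp
qed

section \<open>Consequences of strict convexity\<close>

lemma gamma_in_closure: "\<gamma> s \<in> closure \<Omega>"
  using range_gamma by (auto simp: frontier_def)

lemma gamma_notin: "\<gamma> s \<notin> \<Omega>"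
  using range_gamma open_Omega by (auto simp: frontier_def interior_open)

lemma gamma_eq_diff: "\<gamma> a = \<gamma> b \<Longrightarrow> \<exists>k::int. a - b = k"
proof -
  assume "\<gamma> a = \<gamma> b"
  then have "\<gamma> (frac a) = \<gamma> (frac b)" using periodic_frac[of \<gamma>, OF periodic] by simp
  then have "frac a = frac b"
    using inj_onD[OF inj_gamma, of "frac a" "frac b"] by (simp add: frac_ge_0 frac_lt_1)
  then have "a - b = of_int (\<lfloor>a\<rfloor> - \<lfloor>b\<rfloor>)" by (simp add: frac_def)
  then show ?thesis by blast
qed

lemma gamma_inj: "\<gamma> a = \<gamma> b \<Longrightarrow> \<bar>a - b\<bar> < 1 \<Longrightarrow> a = b"
proof -
  assume "\<gamma> a = \<gamma> b" "\<bar>a - b\<bar> < 1"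
  then obtain k :: int where k: "a - b = k" using gamma_eq_diff by blast
  then have "\<bar>real_of_int k\<bar> < 1" using \<open>\<bar>a - b\<bar> < 1\<close> by simp
  then have "k = 0" by linarith
  with k show ?thesis by simp
qed

text \<open>A ray pointing to the left of the tangent at \<open>\<gamma> s\<close> crosses the chord between two points of
  the curve just before and just after \<open>s\<close>.\<close>

lemma ray_enters:
  assumes d: "Im d > 0"
  shows "\<exists>t>0. \<gamma> s + of_real t * d * T s \<in> \<Omega>"
proof -
  obtain C where C: "C > 0" "\<And>s x. cmod (chord s (s + x) - of_real x - \<i> * of_real (\<kappa> s * x\<^sup>2 / 2)) \<le> C * \<bar>x\<bar> ^ 3"
    using chord_taylor by blast
  define M where "M = cmod d * (\<kappa> s / 2 + C)"
  have "cmod d > 0" using d by auto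
  then have M: "M > 0" using C(1) curvature_pos[of s] by (simp add: M_def)
  \<comment> \<open>The three bounds keep \<open>s + x\<close> and \<open>s - x\<close> distinct on
    the circle, put the two points on opposite sides of the line of the ray, and let the quadratic
    term exceed the Taylor error, so that both lie left of the tangent.\<close>
  define x where "x = min (1/4) (min (Im d / (2 * M)) (\<kappa> s / (4 * C)))"
  have x: "x > 0" "x \<le> 1/4" "x \<le> Im d / (2 * M)" "x \<le> \<kappa> s / (4 * C)"
    using d M C(1) curvature_pos[of s] by (auto simp: x_def)
  have xM: "x * M < Im d" using x(3) M d by (simp add: field_simps)
  have xC: "x * C < \<kappa> s / 2"
  proof -
    have "x * C \<le> \<kappa> s / 4" using x(4) C(1) by (simp add: field_simps)
    then show ?thesis using curvature_pos[of s] by linarith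
  qed
  define e where "e = (\<lambda>y. chord s (s + y) - of_real y - \<i> * of_real (\<kappa> s * y\<^sup>2 / 2))"
  have e: "cmod (e y) \<le> C * x ^ 3" if "\<bar>y\<bar> = x" for y
    using C(2)[of s y] that by (simp add: e_def)
  have ch: "chord s (s + y) = of_real y + \<i> * of_real (\<kappa> s * y\<^sup>2 / 2) + e y" for y by (simp add: e_def)
  have Im: "Im (chord s (s + y)) > 0" if y: "\<bar>y\<bar> = x" for y
  proof -
    have "y\<^sup>2 = x\<^sup>2" using y by (metis power2_abs)
    then have "Im (chord s (s + y)) = \<kappa> s * x\<^sup>2 / 2 + Im (e y)"
      by (simp add: ch power2_eq_square)
    moreover have "\<bar>Im (e y)\<bar> \<le> C * x ^ 3" using e[OF y] abs_Im_le_cmod order_trans by blast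
    moreover have "C * x ^ 3 < \<kappa> s * x\<^sup>2 / 2"
      using xC x(1) mult_strict_right_mono[of "x * C" "\<kappa> s / 2" "x\<^sup>2"]
      by (simp add: power2_eq_square power3_eq_cube algebra_simps)
    ultimately show ?thesis by linarith
  qed
  \<comment> \<open>\<open>g\<close> separates the sides of the line spanned by d; at the chord to
    \<open>s + y\<close> it is \<open>- y * Im d\<close> up to the error terms.\<close>
  define g where "g = (\<lambda>z. Im (z * cnj d))"
  have g: "\<bar>g (chord s (s + y)) + y * Im d\<bar> < x * Im d" if y: "\<bar>y\<bar> = x" for y
  proof -
    have "y\<^sup>2 = x\<^sup>2" using y by (metis power2_abs)
    have "g (chord s (s + y)) + y * Im d = Im ((\<i> * of_real (\<kappa> s * y\<^sup>2 / 2) + e y) * cnj d)"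
      by (simp add: g_def ch algebra_simps)
    also have "\<bar>\<dots>\<bar> \<le> cmod ((\<i> * of_real (\<kappa> s * y\<^sup>2 / 2) + e y) * cnj d)" by (rule abs_Im_le_cmod)
    also have "\<dots> \<le> (\<kappa> s / 2 * x\<^sup>2 + C * x ^ 3) * cmod d"
    proof -
      have "cmod (\<i> * of_real (\<kappa> s * y\<^sup>2 / 2)) = \<kappa> s / 2 * x\<^sup>2"
        using curvature_pos[of s] y by (simp add: norm_mult norm_power norm_divide)
      then show ?thesis
        using norm_triangle_ineq[of "\<i> * of_real (\<kappa> s * y\<^sup>2 / 2)" "e y"] e[OF y]
        by (simp add: norm_mult mult_right_mono)
    qed
    also have "\<dots> \<le> (\<kappa> s / 2 * x\<^sup>2 + C * x\<^sup>2) * cmod d"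
      using x(1,2) C(1) by (intro mult_right_mono add_left_mono mult_left_mono)
        (auto simp: power3_eq_cube power2_eq_square mult_left_le)
    also have "\<dots> = x * (x * M)" by (simp add: M_def power2_eq_square algebra_simps)
    also have "\<dots> < x * Im d" using xM x(1) by simp
    finally show ?thesis .
  qed
  have g1: "g (chord s (s + x)) < 0" and g2: "g (chord s (s + (- x))) > 0"
    using g[of x] g[of "- x"] x(1) by auto
  \<comment> \<open>The weight at which the segment between the two points meets the line, by affine
    interpolation of \<open>g\<close>.\<close>
  define l where "l = - g (chord s (s + x)) / (g (chord s (s + (- x))) - g (chord s (s + x)))"
  have l: "0 < l" "l < 1" using g1 g2 by (auto simp: l_def field_simps)
  define q where "q = (1 - l) *\<^sub>R chord s (s + x) + l *\<^sub>R chord s (s + (- x))"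
  have "\<gamma> (s + x) \<noteq> \<gamma> (s + (- x))" using gamma_inj[of "s + x" "s + (- x)"] x by auto
  then have "(1 - l) *\<^sub>R \<gamma> (s + x) + l *\<^sub>R \<gamma> (s + (- x)) \<in> open_segment (\<gamma> (s + x)) (\<gamma> (s + (- x)))"
    using l by (auto simp: in_segment)
  also have "\<dots> \<subseteq> \<Omega>"
    using segment_Omega[OF gamma_in_closure gamma_in_closure \<open>\<gamma> (s + x) \<noteq> \<gamma> (s + (- x))\<close>] .
  also have "(1 - l) *\<^sub>R \<gamma> (s + x) + l *\<^sub>R \<gamma> (s + (- x)) = \<gamma> s + q * T s"
    by (subst (1 2) gamma_chord[of _ s]) (simp add: q_def scaleR_conv_of_real algebra_simps)
  finally have q: "\<gamma> s + q * T s \<in> \<Omega>" .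
  have gq: "g q = 0"
  proof -
    have "g q = (1 - l) * g (chord s (s + x)) + l * g (chord s (s + (- x)))"
      by (simp add: q_def g_def algebra_simps)
    also have "\<dots> = g (chord s (s + x)) + l * (g (chord s (s + (- x))) - g (chord s (s + x)))"
      by (simp add: algebra_simps)
    also have "\<dots> = 0" using g1 g2 by (simp add: l_def)
    finally show ?thesis .
  qed
  have Imq: "Im q > 0"
    using Im[of x] Im[of "- x"] l x(1) by (simp add: q_def add_pos_pos)
  have "q = of_real (Im q / Im d) * d"
    using gq d by (simp add: g_def complex_eq_iff field_simps)
  then have "\<gamma> s + of_real (Im q / Im d) * d * T s \<in> \<Omega>" using q by simp
  then show ?thesis using Imq d by (intro exI[of _ "Im q / Im d"]) simp
qed

text \<open>If m lay right of the tangent, the ray from \<open>\<gamma> s\<close> away from m would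
  enter \<Omega>, and \<open>\<gamma> s\<close> would lie strictly between two points of \<Omega>,
  hence in \<Omega>.\<close>

lemma Omega_left:
  assumes m: "m \<in> \<Omega>"
  shows "Im ((m - \<gamma> s) * cnj (T s)) > 0"
proof -
  have nonneg: "\<not> Im ((m - \<gamma> s) * cnj (T s)) < 0" if m: "m \<in> \<Omega>" for m
  proof
    define z where "z = (m - \<gamma> s) * cnj (T s)"
    assume "Im ((m - \<gamma> s) * cnj (T s)) < 0"
    then obtain t where t: "t > 0" "\<gamma> s + of_real t * (- z) * T s \<in> \<Omega>"
      using ray_enters[of "- z" s] by (auto simp: z_def)
    have m_eq: "m = \<gamma> s + z * T s"
      using T_cnj[of s] by (simp add: z_def mult.assoc mult.commute[of "cnj (T s)"])
    define q where "q = \<gamma> s + of_real t * (- z) * T s"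
    have "m \<noteq> \<gamma> s" using m gamma_notin by auto
    have "q \<noteq> m"
    proof
      assume "q = m"
      then have "of_real (1 + t) * (z * T s) = 0" by (simp add: q_def m_eq algebra_simps)
      moreover have "complex_of_real (1 + t) \<noteq> 0" using t(1) by (metis add_pos_pos less_irrefl of_real_eq_0_iff zero_less_one)
      ultimately show False using m_eq \<open>m \<noteq> \<gamma> s\<close> by auto
    qed
    moreover have "\<gamma> s = (1 - t / (1 + t)) *\<^sub>R q + (t / (1 + t)) *\<^sub>R m"
    proof -
      have "(1 - t / (1 + t)) * t = t / (1 + t)" using t(1) by (simp add: field_simps)
      then have *: "of_real (1 - t / (1 + t)) * of_real t = (of_real (t / (1 + t)) :: complex)"
        by (metis of_real_mult)
      have "(1 - t / (1 + t)) *\<^sub>R q + (t / (1 + t)) *\<^sub>R m =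
          \<gamma> s + (of_real (t / (1 + t)) - of_real (1 - t / (1 + t)) * of_real t) * (z * T s)"
        unfolding q_def m_eq scaleR_conv_of_real by (simp add: algebra_simps)
      then show ?thesis unfolding * by simp
    qed
    then have "\<gamma> s \<in> open_segment q m"
      using t(1) \<open>q \<noteq> m\<close> by (auto simp: in_segment intro!: exI[of _ "t / (1 + t)"])
    ultimately have "\<gamma> s \<in> \<Omega>"
      using segment_Omega[of q m] t(2) m closure_subset q_def by blast
    then show False using gamma_notin by blast
  qed
  obtain r where r: "r > 0" "ball m r \<subseteq> \<Omega>" using m open_Omega open_contains_ball by metis
  \<comment> \<open>Strictness from openness: m can be pushed outward along the normal without
    leaving \<Omega>.\<close>
  define m' where "m' = m - of_real (r / 2) * \<i> * T s"
  have "dist m m' < r" using r(1) by (simp add: m'_def dist_norm norm_mult norm_T)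
  then have "m' \<in> \<Omega>" using r(2) by auto
  then have "Im ((m' - \<gamma> s) * cnj (T s)) \<ge> 0" using nonneg by force
  also have "(m' - \<gamma> s) * cnj (T s) = (m - \<gamma> s) * cnj (T s) - of_real (r / 2) * \<i>"
    using T_cnj[of s] by (simp add: m'_def algebra_simps)
  finally show ?thesis using r(1) by simp
qed

text \<open>The midpoint of the chord lies in \<Omega>, where \<open>Omega_left\<close> is
  strict.\<close>

lemma chord_left: "\<gamma> s' \<noteq> \<gamma> s \<Longrightarrow> Im (chord s s') > 0"
proof -
  assume ne: "\<gamma> s' \<noteq> \<gamma> s"
  have "midpoint (\<gamma> s) (\<gamma> s') \<in> open_segment (\<gamma> s) (\<gamma> s')" using ne by simp
  then have "midpoint (\<gamma> s) (\<gamma> s') \<in> \<Omega>"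
    using segment_Omega[OF gamma_in_closure gamma_in_closure, of s s'] ne by auto
  from Omega_left[OF this, of s] have "Im ((midpoint (\<gamma> s) (\<gamma> s') - \<gamma> s) * cnj (T s)) > 0" .
  moreover have "midpoint (\<gamma> s) (\<gamma> s') - \<gamma> s = (\<gamma> s' - \<gamma> s) / 2"
    by (simp add: midpoint_def scaleR_conv_of_real field_simps)
  ultimately show ?thesis by (simp add: chord_def)
qed

text \<open>In the complex plane the mirror image of \<open>u\<close> in the line spanned by the unit vector \<open>v\<close> is
  \<open>v\<^sup>2 * cnj u\<close>.\<close>

lemma reflect_eq:
  assumes "v * cnj v = 1"
  shows "cis a * v = (2 * (u \<bullet> v)) *\<^sub>R v - u \<longleftrightarrow> cis a = v * cnj u"
proof -
  have "2 * (u \<bullet> v) = Re (u * cnj v + cnj u * v)"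
    by (simp add: inner_complex_def)
  moreover have "Im (u * cnj v + cnj u * v) = 0" by simp
  ultimately have "of_real (2 * (u \<bullet> v)) = u * cnj v + cnj u * v"
    by (simp add: complex_eq_iff)
  then have "(2 * (u \<bullet> v)) *\<^sub>R v = u * (v * cnj v) + v * cnj u * v"
    by (simp add: scaleR_conv_of_real algebra_simps)
  then have "(2 * (u \<bullet> v)) *\<^sub>R v - u = v * cnj u * v" using assms by simp
  moreover have "v \<noteq> 0" using assms by auto
  ultimately show ?thesis by simp
qed

section \<open>Existence and uniqueness of the next bounce\<close>

definition step :: "real \<Rightarrow> real \<Rightarrow> real \<Rightarrow> real \<Rightarrow> bool" where
  "step s a s' a' \<longleftrightarrow> s < s' \<and> s' < s + 1 \<and> 0 < a' \<and> a' < pi \<and>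
     (\<exists>t>0. \<gamma> s' - \<gamma> s = of_real t * cis (\<theta> s + a)) \<and> cis a' = cis (\<theta> s' - \<theta> s - a)"

text \<open>The open chord lies in \<Omega> and so misses the curve; the mirror law is turned by
  \<open>reflect_eq\<close> into an equation between angles modulo 2 pi.\<close>

lemma billiard_step_iff: "billiard_step \<gamma> (s, a) (s', a') \<longleftrightarrow> step s a s' a'"
proof -
  have "open_segment (\<gamma> s) (\<gamma> s') \<inter> range \<gamma> = {}" if "s < s'" "s' < s + 1"
  proof -
    have "\<gamma> s \<noteq> \<gamma> s'" using gamma_inj[of s s'] that by auto
    then have "open_segment (\<gamma> s) (\<gamma> s') \<subseteq> \<Omega>"
      using segment_Omega gamma_in_closure by blast
    then show ?thesis using gamma_notin by auto
  qed
  moreover have "cis a' * T s' = (2 * ((cis a * T s) \<bullet> T s')) *\<^sub>R T s' - cis a * T s \<longleftrightarrow> cis a' = cis (\<theta> s' - \<theta> s - a)"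
    unfolding reflect_eq[OF T_cnj] by (simp add: tangent_angle(2) cis_mult cis_cnj algebra_simps)
  moreover have "(\<gamma> s' = \<gamma> s + t *\<^sub>R (cis a * T s)) \<longleftrightarrow> \<gamma> s' - \<gamma> s = of_real t * cis (\<theta> s + a)" for t
    by (auto simp: tangent_angle(2) cis_mult scaleR_conv_of_real algebra_simps)
  ultimately show ?thesis
    unfolding billiard_step_def step_def Let_def by auto
qed

text \<open>The ray enters \<Omega> and, the domain being bounded, leaves it at a boundary point.
  There the reversed chord points inward by \<open>chord_left\<close>, so the reflected direction
  lies above the tangent and its argument is an admissible angle.\<close>

lemma step_ex:
  assumes a: "0 < a" "a < pi"
  shows "\<exists>s' a'. step s a s' a'"
proof -
  define u where "u = cis (\<theta> s + a)"
  have u: "u = cis a * T s" by (simp add: u_def tangent_angle(2) cis_mult add.commute)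
  have "Im (cis a) > 0" using a by (simp add: sin_gt_zero)
  then obtain t where t: "t > 0" "\<gamma> s + of_real t * u \<in> \<Omega>"
    using ray_enters[of "cis a" s] unfolding u by (auto simp: mult.assoc)
  then have "\<gamma> s + of_real t * u \<in> interior \<Omega>" using open_Omega by (simp add: interior_open)
  moreover have "u \<noteq> 0" by (simp add: u_def)
  ultimately obtain d where d: "0 < d" "(\<gamma> s + of_real t * u) + d *\<^sub>R u \<in> frontier \<Omega>"
    using ray_to_frontier[OF bounded_Omega] by blast
  then obtain s1 where s1: "\<gamma> s1 = (\<gamma> s + of_real t * u) + d *\<^sub>R u"
    using range_gamma by (metis imageE)
  \<comment> \<open>The lift of the hit point to \<open>{s..<s + 1}\<close>; the value s itself is
    excluded below because the chord is not 0.\<close>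
  define s' where "s' = s + frac (s1 - s)"
  have "s' = s1 + of_int (- \<lfloor>s1 - s\<rfloor>)" by (simp add: s'_def frac_def)
  then have "\<gamma> s' = \<gamma> s1" using periodic_int[of \<gamma> s1 "- \<lfloor>s1 - s\<rfloor>", OF periodic] by (simp only:)
  then have chord: "\<gamma> s' - \<gamma> s = of_real (t + d) * u"
    using s1 by (simp add: scaleR_conv_of_real algebra_simps)
  moreover have "t + d \<noteq> 0" using t d by simp
  ultimately have ne: "\<gamma> s' \<noteq> \<gamma> s" using \<open>u \<noteq> 0\<close> by (metis eq_iff_diff_eq_0 mult_eq_0_iff of_real_eq_0_iff)
  then have "s' \<noteq> s" by auto
  then have s': "s < s'" "s' < s + 1"
    using frac_ge_0[of "s1 - s"] frac_lt_1[of "s1 - s"] by (auto simp: s'_def)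
  define z where "z = cis (\<theta> s' - \<theta> s - a)"
  have "Im (chord s' s) > 0" using chord_left ne by metis
  also have "chord s' s = - of_real (t + d) * cnj z"
    using chord by (simp add: chord_def z_def u_def tangent_angle(2) cis_cnj cis_mult algebra_simps)
  finally have "(t + d) * Im z > 0" by (simp add: algebra_simps)
  then have "Im z > 0" using t d by (simp add: zero_less_mult_iff)
  then have "0 < Arg z" "Arg z < pi"
    using Arg_lt_pi by auto
  moreover have "cis (Arg z) = z"
    using cis_Arg[of z] by (simp add: z_def sgn_div_norm)
  ultimately have "step s a s' (Arg z)"
    unfolding step_def using s' chord t d by (auto simp: u_def z_def intro!: exI[of _ "t + d"])
  then show ?thesis by blast
qed

lemma cis_inj_0_pi: "cis a = cis b \<Longrightarrow> 0 < a \<Longrightarrow> a < pi \<Longrightarrow> 0 < b \<Longrightarrow> b < pi \<Longrightarrow> a = b"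
  using cos_inj_pi[of a b] by (simp add: complex_eq_iff)

text \<open>Of two hits on one ray the nearer would lie on the open chord to the farther one, which
  is contained in \<Omega>.\<close>

lemma step_unique_s:
  assumes "s < s1" "s1 < s + 1" "\<gamma> s1 - \<gamma> s = of_real t1 * u" "t1 > 0"
    and "s < s2" "s2 < s + 1" "\<gamma> s2 - \<gamma> s = of_real t2 * u" "t2 > 0" and u: "u \<noteq> 0"
  shows "s1 = s2"
proof -
  have *: "\<not> t1 < t2" if "\<gamma> s1 - \<gamma> s = of_real t1 * u" "t1 > 0" "\<gamma> s2 - \<gamma> s = of_real t2 * u" for s1 s2 t1 t2
  proof
    assume l: "t1 < t2"
    then have ne: "\<gamma> s \<noteq> \<gamma> s2" using that u by auto
    have "\<gamma> s1 = (1 - t1 / t2) *\<^sub>R \<gamma> s + (t1 / t2) *\<^sub>R \<gamma> s2"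
    proof -
      have e: "\<gamma> s1 = \<gamma> s + of_real t1 * u" "\<gamma> s2 = \<gamma> s + of_real t2 * u"
        using that by (simp_all add: algebra_simps)
      have "of_real (t1 / t2) * of_real t2 = (of_real t1 :: complex)"
        using that l by (subst of_real_mult[symmetric]) simp
      moreover have "t2 \<noteq> 0" using that l by linarith
      ultimately show ?thesis unfolding e scaleR_conv_of_real by (simp add: algebra_simps)
    qed
    then have "\<gamma> s1 \<in> open_segment (\<gamma> s) (\<gamma> s2)"
      using ne l that by (auto simp: in_segment intro!: exI[of _ "t1 / t2"])
    then show False
      using segment_Omega[OF gamma_in_closure gamma_in_closure ne] gamma_notin by blast
  qed
  have "t1 = t2" using *[of s1 t1 s2 t2] *[of s2 t2 s1 t1] assms by linarith
  then have "\<gamma> s1 = \<gamma> s2" using assms(3,7) by (metis diff_add_cancel)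
  then show ?thesis using gamma_inj assms by auto
qed

lemma step_unique: "step s a s1 a1 \<Longrightarrow> step s a s2 a2 \<Longrightarrow> s1 = s2 \<and> a1 = a2"
  unfolding step_def using step_unique_s[of s s1 _ "cis (\<theta> s + a)" s2] cis_inj_0_pi
  by (metis cis_neq_zero)

lemma billiard_map_iff:
  assumes "0 < a" "a < pi"
  shows "f (s, a) = (s', a') \<longleftrightarrow> step s a s' a'"
proof -
  obtain s1 a1 where st: "step s a s1 a1" using step_ex[OF assms] by blast
  have "f (s, a) = (THE q. billiard_step \<gamma> (s, a) q)"
    using assms by (simp add: billiard_map_def)
  also have "\<dots> = (s1, a1)"
  proof (rule the_equality)
    show "billiard_step \<gamma> (s, a) (s1, a1)" using st by (simp add: billiard_step_iff)
    show "q = (s1, a1)" if "billiard_step \<gamma> (s, a) q" for q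
      using that st step_unique by (cases q) (auto simp: billiard_step_iff)
  qed
  finally show ?thesis using st step_unique by auto
qed

lemma billiard_map_step:
  assumes "p \<in> strip"
  shows "step (fst p) (snd p) (fst (f p)) (snd (f p))"
  using billiard_map_iff[of "snd p" "fst p" "fst (f p)" "snd (f p)"] assms by (simp add: mem_strip)

lemma billiard_map_strip: "p \<in> strip \<Longrightarrow> f p \<in> strip"
  using billiard_map_step[of p] by (simp add: step_def mem_strip)

subsection \<open>Smoothness of the billiard map\<close>

definition len :: "real \<times> real \<Rightarrow> real" where
  "len p = cmod (\<gamma> (fst (f p)) - \<gamma> (fst p))"

lemma len_chord:
  assumes "p \<in> strip"
  shows "\<gamma> (fst (f p)) - \<gamma> (fst p) = of_real (len p) * cis (\<theta> (fst p) + snd p)" "len p > 0"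
    "chord (fst p) (fst (f p)) = of_real (len p) * cis (snd p)"
proof -
  obtain t where t: "t > 0" "\<gamma> (fst (f p)) - \<gamma> (fst p) = of_real t * cis (\<theta> (fst p) + snd p)"
    using billiard_map_step[OF assms] by (auto simp: step_def)
  then have "len p = t" by (simp add: len_def norm_mult)
  with t show *: "\<gamma> (fst (f p)) - \<gamma> (fst p) = of_real (len p) * cis (\<theta> (fst p) + snd p)" "len p > 0"
    by auto
  show "chord (fst p) (fst (f p)) = of_real (len p) * cis (snd p)"
    unfolding chord_def *(1) by (simp add: tangent_angle(2) cis_cnj cis_mult mult.assoc)
qed

text \<open>In the coordinates (departure point, arrival point) the inverse of the billiard map is explicit.
  Invariance of domain makes the billiard map itself continuous, hence differentiable.\<close>

definition departure_map :: "real \<times> real \<Rightarrow> real \<times> real" where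
  "departure_map x = (fst x, Im (Ln (chord (fst x) (snd x))))"

definition arc_pairs :: "(real \<times> real) set" where
  "arc_pairs = {x. fst x < snd x \<and> snd x < fst x + 1}"

lemma open_arc_pairs: "open arc_pairs"
proof -
  have "open {x :: real \<times> real. fst x < snd x}" "open {x :: real \<times> real. snd x < fst x + 1}"
    by (intro open_Collect_less continuous_intros)+
  then show ?thesis
    by (auto simp: arc_pairs_def Collect_conj_eq)
qed

lemma chord_Im_pos: "x \<in> arc_pairs \<Longrightarrow> Im (chord (fst x) (snd x)) > 0"
  using gamma_inj[of "fst x" "snd x"] by (intro chord_left) (auto simp: arc_pairs_def)

lemma departure_map_strip: "x \<in> arc_pairs \<Longrightarrow> departure_map x \<in> strip"
  using Im_Ln_pos_lt_imp[OF chord_Im_pos] by (simp add: departure_map_def mem_strip)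

lemma arrival_arc_pairs: "p \<in> strip \<Longrightarrow> (fst p, fst (f p)) \<in> arc_pairs"
  using billiard_map_step[of p] by (auto simp: step_def arc_pairs_def)

lemma departure_map_arrival:
  assumes "p \<in> strip"
  shows "departure_map (fst p, fst (f p)) = p"
proof -
  have a: "0 < snd p" "snd p < pi" using assms by (auto simp: mem_strip)
  have "chord (fst p) (fst (f p)) = exp (of_real (ln (len p)) + \<i> * of_real (snd p))"
    using len_chord[OF assms] by (simp add: exp_add exp_of_real cis_conv_exp)
  also have "Ln \<dots> = of_real (ln (len p)) + \<i> * of_real (snd p)"
    using a by (intro Ln_exp) auto
  finally show ?thesis by (simp add: departure_map_def)
qed

text \<open>\<open>snd x\<close> and the arrival point lie on the same ray from
  \<open>fst x\<close>, so uniqueness of the hit identifies them.\<close>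

lemma arrival_departure_map:
  assumes "x \<in> arc_pairs"
  shows "(fst (departure_map x), fst (f (departure_map x))) = x"
proof -
  define a where "a = Im (Ln (chord (fst x) (snd x)))"
  define p where "p = (fst x, a)"
  have dm: "departure_map x = p" by (simp add: departure_map_def p_def a_def)
  have p: "p \<in> strip" using departure_map_strip[OF assms] dm by simp
  have nz: "chord (fst x) (snd x) \<noteq> 0" using chord_Im_pos[OF assms] by auto
  then have "chord (fst x) (snd x) = of_real (cmod (chord (fst x) (snd x))) * cis a"
    by (simp add: a_def flip: Arg_eq_Im_Ln) (metis rcis_cmod_Arg rcis_def)
  then have "\<gamma> (snd x) - \<gamma> (fst x) = of_real (cmod (chord (fst x) (snd x))) * cis (\<theta> (fst x) + a)"
    using gamma_chord[of "snd x" "fst x"] by (metis add_diff_cancel_left' cis_mult mult.assoc mult.commute tangent_angle(2))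
  moreover have "\<gamma> (fst (f p)) - \<gamma> (fst x) = of_real (len p) * cis (\<theta> (fst x) + a)"
    using len_chord(1)[OF p] by (simp add: p_def)
  moreover have "fst x < snd x" "snd x < fst x + 1" "fst x < fst (f p)" "fst (f p) < fst x + 1"
    using arrival_arc_pairs[OF p] assms by (auto simp: arc_pairs_def p_def)
  ultimately have "snd x = fst (f p)"
    using step_unique_s[of "fst x" "snd x" "cmod (chord (fst x) (snd x))" "cis (\<theta> (fst x) + a)" "fst (f p)" "len p"]
      len_chord(2)[OF p] nz by simp
  then show ?thesis unfolding dm by (simp add: p_def prod_eq_iff)
qed

lemma chord_has_derivative:
  "((\<lambda>x. chord (fst x) (snd x)) has_derivative
     (\<lambda>v. of_real (snd v) * (T (snd x) * cnj (T (fst x))) - of_real (fst v)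
       - \<i> * of_real (\<kappa> (fst x) * fst v) * chord (fst x) (snd x))) (at x)"
proof -
  have g: "((\<lambda>x. \<gamma> (snd x)) has_derivative (\<lambda>v. snd v *\<^sub>R T (snd x))) (at x)"
    using has_derivative_compose[OF has_derivative_snd[OF has_derivative_ident[of "at x"]] gamma_deriv[unfolded has_vector_derivative_def]]
    by simp
  have g0: "((\<lambda>x. \<gamma> (fst x)) has_derivative (\<lambda>v. fst v *\<^sub>R T (fst x))) (at x)"
    using has_derivative_compose[OF has_derivative_fst[OF has_derivative_ident[of "at x"]] gamma_deriv[unfolded has_vector_derivative_def]]
    by simp
  have "((\<lambda>x. T (fst x)) has_derivative (\<lambda>v. fst v *\<^sub>R (\<kappa> (fst x) *\<^sub>R (\<i> * T (fst x))))) (at x)"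
    using has_derivative_compose[OF has_derivative_fst[OF has_derivative_ident[of "at x"]] T_deriv[unfolded has_vector_derivative_def]]
    by simp
  then have t: "((\<lambda>x. cnj (T (fst x))) has_derivative (\<lambda>v. cnj (fst v *\<^sub>R (\<kappa> (fst x) *\<^sub>R (\<i> * T (fst x)))))) (at x)"
    by (rule has_derivative_cnj)
  show ?thesis
    unfolding chord_def
    by (rule has_derivative_eq_rhs[OF has_derivative_mult[OF has_derivative_diff[OF g g0] t]])
      (use T_cnj[of "fst x"] in \<open>auto simp: fun_eq_iff scaleR_conv_of_real algebra_simps\<close>)
qed

lemma departure_map_has_derivative:
  assumes "x \<in> arc_pairs"
  shows "(departure_map has_derivative (\<lambda>v. (fst v,
      Im ((of_real (snd v) * (T (snd x) * cnj (T (fst x))) - of_real (fst v)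
       - \<i> * of_real (\<kappa> (fst x) * fst v) * chord (fst x) (snd x)) / chord (fst x) (snd x))))) (at x)"
proof -
  have "chord (fst x) (snd x) \<notin> \<real>\<^sub>\<le>\<^sub>0" using chord_Im_pos[OF assms] by (auto simp: complex_nonpos_Reals_iff)
  then have "(Ln has_derivative (*) (inverse (chord (fst x) (snd x)))) (at (chord (fst x) (snd x)))"
    using has_field_derivative_Ln by (simp add: has_field_derivative_def)
  from has_derivative_compose[OF chord_has_derivative this]
  have "((\<lambda>x. Ln (chord (fst x) (snd x))) has_derivative
      (\<lambda>v. (of_real (snd v) * (T (snd x) * cnj (T (fst x))) - of_real (fst v)
       - \<i> * of_real (\<kappa> (fst x) * fst v) * chord (fst x) (snd x)) / chord (fst x) (snd x))) (at x)"
    by (simp add: divide_inverse mult.commute)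
  then show ?thesis
    unfolding departure_map_def
    by (intro has_derivative_Pair has_derivative_fst has_derivative_ident has_derivative_Im)
qed

lemma continuous_on_arrival: "continuous_on strip (\<lambda>p. (fst p, fst (f p)))"
proof -
  have "continuous_on arc_pairs departure_map"
    using departure_map_has_derivative has_derivative_continuous
    by (intro continuous_at_imp_continuous_on) blast
  then have "continuous_on (departure_map ` arc_pairs) (\<lambda>p. (fst p, fst (f p)))"
    by (intro continuous_on_inverse_open[OF open_arc_pairs]) (use arrival_departure_map in auto)
  moreover have "departure_map ` arc_pairs = strip"
    using departure_map_strip arrival_arc_pairs departure_map_arrival by (auto simp: image_iff) metis
  ultimately show ?thesis by simp
qed

text \<open>The arrival row of the classical derivative of the billiard map, with \<open>v\<close>
  the pair of increments of arc length and angle.\<close>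

definition jacobi :: "real \<times> real \<Rightarrow> real \<times> real \<Rightarrow> real" where
  "jacobi p v = ((\<kappa> (fst p) * len p - sin (snd p)) * fst v + len p * snd v) / sin (snd (f p))"

lemma sin_pos: "p \<in> strip \<Longrightarrow> sin (snd p) > 0"
  by (simp add: mem_strip sin_gt_zero)

text \<open>Inverts the derivative of \<open>departure_map\<close>, which is triangular with
  diagonal entries 1 and sin \<phi>' / L, the latter positive.\<close>

lemma fst_billiard_map_has_derivative:
  assumes p: "p \<in> strip"
  shows "((\<lambda>p. fst (f p)) has_derivative jacobi p) (at p)"
proof -
  define s a s' a' where "s = fst p" and "a = snd p" and "s' = fst (f p)" and "a' = snd (f p)"
  define L where "L = len p"
  have L: "L > 0" "chord s s' = of_real L * cis a" using len_chord[OF p] by (auto simp: L_def s_def a_def s'_def)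
  have sa': "sin a' > 0" using sin_pos[OF billiard_map_strip[OF p]] by (simp add: a'_def)
  have ca: "cis a' = cis (\<theta> s' - \<theta> s - a)"
    using billiard_map_step[OF p] by (simp add: step_def a'_def s'_def s_def a_def)
  have D: "Im ((of_real v2 * (T s' * cnj (T s)) - of_real v1
       - \<i> * of_real (\<kappa> s * v1) * chord s s') / chord s s') = (sin a / L - \<kappa> s) * v1 + (sin a' / L) * v2" for v1 v2
  proof -
    \<comment> \<open>Reflection law: the tangents at the two ends differ by the sum of the angles
      that the chord makes with them.\<close>
    have 1: "T s' * cnj (T s) = cis a' * cis a"
      by (simp add: ca tangent_angle(2) cis_cnj cis_mult)
    have 2: "cis a' * cis a / (of_real L * cis a) = cis a' / of_real L" by simp
    have 3: "1 / (of_real L * cis a) = cis (- a) / of_real L"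
      by (simp add: cis_inverse[symmetric] divide_inverse del: cis_inverse) 
    have "(of_real v2 * (T s' * cnj (T s)) - of_real v1
       - \<i> * of_real (\<kappa> s * v1) * chord s s') / chord s s' =
       of_real v2 * (cis a' * cis a / (of_real L * cis a)) - of_real v1 * (1 / (of_real L * cis a)) - \<i> * of_real (\<kappa> s * v1)"
      using L(1) unfolding 1 L(2) by (simp add: diff_divide_distrib)
    also have "Im \<dots> = (sin a / L - \<kappa> s) * v1 + (sin a' / L) * v2"
      unfolding 2 3 by (simp add: algebra_simps)
    finally show ?thesis .
  qed
  have dd: "(departure_map has_derivative (\<lambda>v. (fst v, (sin a / L - \<kappa> s) * fst v + (sin a' / L) * snd v))) (at (s, s'))"
  proof -
    have "(s, s') \<in> arc_pairs" using arrival_arc_pairs[OF p] by (simp add: s_def s'_def)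
    from departure_map_has_derivative[OF this] show ?thesis unfolding fst_conv snd_conv D .
  qed
  have "((\<lambda>p. (fst p, fst (f p))) has_derivative (\<lambda>v. (fst v, ((\<kappa> s * L - sin a) * fst v + L * snd v) / sin a'))) (at p)"
  proof (rule has_derivative_inverse_basic[where f = departure_map and T = strip])
    show "(departure_map has_derivative (\<lambda>v. (fst v, (sin a / L - \<kappa> s) * fst v + (sin a' / L) * snd v))) (at (fst p, fst (f p)))"
      using dd by (simp add: s_def s'_def)
    show "bounded_linear (\<lambda>v. (fst v, ((\<kappa> s * L - sin a) * fst v + L * snd v) / sin a'))"
      unfolding divide_inverse
      by (intro bounded_linear_Pair bounded_linear_fst bounded_linear_mult_const bounded_linear_add
        bounded_linear_const_mult bounded_linear_snd)
    show "(\<lambda>v. (fst v, ((\<kappa> s * L - sin a) * fst v + L * snd v) / sin a')) \<circ>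
        (\<lambda>v. (fst v, (sin a / L - \<kappa> s) * fst v + (sin a' / L) * snd v)) = id"
      using L(1) sa' by (auto simp: fun_eq_iff field_simps)
    show "continuous (at p) (\<lambda>p. (fst p, fst (f p)))"
      using continuous_on_arrival p by (simp add: continuous_on_eq_continuous_at)
  qed (use p departure_map_arrival in auto)
  from has_derivative_snd[OF this] show ?thesis
    by (simp add: jacobi_def[abs_def] s_def a_def L_def a'_def)
qed

text \<open>The reflection law holds modulo 2 pi. The defect divided by 2 pi is an integer that
  varies continuously on the connected strip; continuity of the new angle comes from writing it as
  an arccos.\<close>

lemma snd_billiard_map_const:
  "\<exists>c. \<forall>p\<in>strip. snd (f p) = \<theta> (fst (f p)) - \<theta> (fst p) - snd p + c"
proof -
  define h where "h = (\<lambda>p. \<theta> (fst (f p)) - \<theta> (fst p) - snd p)"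
  have "continuous_on strip (\<lambda>p. fst (f p))"
    using continuous_on_snd[OF continuous_on_arrival] by simp
  note c1 = continuous_on_compose2[OF smooth_on_continuous_on[OF smooth_tangent_angle] this subset_UNIV]
    continuous_on_compose2[OF smooth_on_continuous_on[OF smooth_tangent_angle] continuous_on_fst[OF continuous_on_id] subset_UNIV]
  have h: "continuous_on strip h"
    unfolding h_def by (intro continuous_on_diff c1 continuous_on_snd continuous_on_id)
  have st: "cis (snd (f p)) = cis (h p)" "0 < snd (f p)" "snd (f p) < pi" if "p \<in> strip" for p
    using billiard_map_step[OF that] by (auto simp: step_def h_def)
  have "snd (f p) = arccos (cos (h p))" if "p \<in> strip" for p
    using st[OF that] by (metis arccos_cos cis.simps(1) less_eq_real_def)
  moreover have "continuous_on strip (\<lambda>p. arccos (cos (h p)))"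
    by (intro continuous_on_arccos continuous_intros h) auto
  ultimately have csnd: "continuous_on strip (\<lambda>p. snd (f p))"
    by (simp cong: continuous_on_cong)
  have c: "continuous_on strip (\<lambda>p. (snd (f p) - h p) / (2 * pi))"
    by (intro continuous_on_divide continuous_on_diff continuous_on_const h csnd) auto
  have ints: "(snd (f p) - h p) / (2 * pi) \<in> \<int>" if "p \<in> strip" for p
  proof -
    have "sin (snd (f p)) = sin (h p) \<and> cos (snd (f p)) = cos (h p)"
      using st(1)[OF that] by (simp add: complex_eq_iff)
    then obtain n where "snd (f p) = h p + 2 * pi * real_of_int n"
      using sin_cos_eq_iff by (auto simp: Ints_def)
    then show ?thesis by simp
  qed
  have "(\<lambda>p. (snd (f p) - h p) / (2 * pi)) constant_on strip"
  proof (rule continuous_discrete_range_constant[OF _ c])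
    show "connected strip" unfolding strip_def by (intro connected_Times) auto
    show "\<exists>e>0. \<forall>y. y \<in> strip \<and> (snd (f y) - h y) / (2 * pi) \<noteq> (snd (f x) - h x) / (2 * pi) \<longrightarrow>
        e \<le> norm ((snd (f y) - h y) / (2 * pi) - (snd (f x) - h x) / (2 * pi))" if "x \<in> strip" for x
    proof (intro exI[of _ 1] conjI allI impI)
      fix y assume y: "y \<in> strip \<and> (snd (f y) - h y) / (2 * pi) \<noteq> (snd (f x) - h x) / (2 * pi)"
      have "(snd (f y) - h y) / (2 * pi) - (snd (f x) - h x) / (2 * pi) \<in> \<int>"
        using ints y that by (intro Ints_diff) auto
      moreover have "(snd (f y) - h y) / (2 * pi) - (snd (f x) - h x) / (2 * pi) \<noteq> 0" using y by simp
      ultimately show "1 \<le> norm ((snd (f y) - h y) / (2 * pi) - (snd (f x) - h x) / (2 * pi))"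
        using Ints_nonzero_abs_ge1 by (metis real_norm_def)
    qed simp
  qed
  then obtain c where "\<And>p. p \<in> strip \<Longrightarrow> (snd (f p) - h p) / (2 * pi) = c"
    by (auto simp: constant_on_def)
  then have "\<forall>p\<in>strip. snd (f p) = h p + 2 * pi * c" by (simp add: field_simps)
  then show ?thesis unfolding h_def by blast
qed

lemma billiard_map_has_derivative:
  assumes p: "p \<in> strip"
  shows "(f has_derivative
    (\<lambda>v. (jacobi p v, \<kappa> (fst (f p)) * jacobi p v - \<kappa> (fst p) * fst v - snd v))) (at p)"
proof -
  obtain c where c: "\<And>p. p \<in> strip \<Longrightarrow> snd (f p) = \<theta> (fst (f p)) - \<theta> (fst p) - snd p + c"
    using snd_billiard_map_const by blast
  note D = fst_billiard_map_has_derivative[OF p]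
  have th: "(\<theta> has_derivative (*) (\<kappa> x)) (at x)" for x
    using tangent_angle(1)[of x] by (simp add: has_field_derivative_def)
  have "((\<lambda>p. \<theta> (fst (f p)) - \<theta> (fst p) - snd p + c) has_derivative
      (\<lambda>v. \<kappa> (fst (f p)) * jacobi p v - \<kappa> (fst p) * fst v - snd v)) (at p)"
    by (rule has_derivative_eq_rhs[OF has_derivative_add[OF has_derivative_diff[OF has_derivative_diff[OF
        has_derivative_compose[OF D th] has_derivative_compose[OF has_derivative_fst[OF has_derivative_ident] th]]
        has_derivative_snd[OF has_derivative_ident]] has_derivative_const]]) simp
  then have "((\<lambda>p. snd (f p)) has_derivative
      (\<lambda>v. \<kappa> (fst (f p)) * jacobi p v - \<kappa> (fst p) * fst v - snd v)) (at p)"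
    by (rule has_derivative_transform_within_open[OF _ open_strip p]) (simp add: c)
  from has_derivative_Pair[OF D this] show ?thesis by simp
qed

text \<open>Bootstrapping: the derivative of the arrival point is a smooth expression in the arrival point
  itself.\<close>

lemma smooth_arrival:
  assumes "open W" and P: "smooth_on W P" and A: "smooth_on W A" and W: "\<And>x. x \<in> W \<Longrightarrow> (P x, A x) \<in> strip"
  shows "smooth_on W (\<lambda>x. fst (f (P x, A x)))" "smooth_on W (\<lambda>x. snd (f (P x, A x)))"
proof -
  obtain c where c: "\<And>p. p \<in> strip \<Longrightarrow> snd (f p) = \<theta> (fst (f p)) - \<theta> (fst p) - snd p + c"
    using snd_billiard_map_const by blast
  define Q where "Q = (\<lambda>x. fst (f (P x, A x)))"
  \<comment> \<open>Here and below differences are sums with a factor - 1, so that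
    \<open>Ck_on_add\<close>, \<open>Ck_on_mult\<close> and compositions decompose every
    expression.\<close>
  define B where "B = (\<lambda>x. \<theta> (Q x) + (- 1 * \<theta> (P x) + (- 1 * A x + c)))"
  define X where "X = (\<lambda>s. Re (\<gamma> s))"
  define Y where "Y = (\<lambda>s. Im (\<gamma> s))"
  \<comment> \<open>The length as the projection of the chord on the direction of the ray: a smooth
    expression without a square root.\<close>
  define l where "l = (\<lambda>x. (X (Q x) + - 1 * X (P x)) * cos (\<theta> (P x) + A x) + (Y (Q x) + - 1 * Y (P x)) * sin (\<theta> (P x) + A x))"
  have B: "snd (f (P x, A x)) = B x" if "x \<in> W" for x
    using c[OF W[OF that]] by (simp add: B_def Q_def)
  have l: "len (P x, A x) = l x" if "x \<in> W" for x
  proof -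
    define b where "b = \<theta> (P x) + A x"
    have e: "\<gamma> (Q x) - \<gamma> (P x) = of_real (len (P x, A x)) * cis b"
      using len_chord(1)[OF W[OF that]] by (simp add: Q_def b_def)
    have "X (Q x) - X (P x) = len (P x, A x) * cos b" "Y (Q x) - Y (P x) = len (P x, A x) * sin b"
      using arg_cong[OF e, of Re] arg_cong[OF e, of Im] by (simp_all add: X_def Y_def)
    then have "l x = len (P x, A x) * cos b * cos b + len (P x, A x) * sin b * sin b"
      unfolding l_def b_def[symmetric] by simp
    also have "\<dots> = len (P x, A x) * ((cos b)\<^sup>2 + (sin b)\<^sup>2)"
      by (simp only: power2_eq_square distrib_left mult.assoc)
    finally show ?thesis by simp
  qed
  define Q' where "Q' = (\<lambda>x v. ((\<kappa> (P x) * l x + - 1 * sin (A x)) * dir_deriv v P x + l x * dir_deriv v A x) * inverse (sin (B x)))"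
  have D: "(Q has_derivative Q' x) (at x)" if "x \<in> W" for x
  proof -
    have "((\<lambda>x. (P x, A x)) has_derivative (\<lambda>v. (dir_deriv v P x, dir_deriv v A x))) (at x)"
      using that by (intro has_derivative_Pair smooth_on_has_derivative[OF P] smooth_on_has_derivative[OF A])
    from has_derivative_compose[OF this fst_billiard_map_has_derivative[OF W[OF that]]]
    show ?thesis
      by (simp add: Q_def jacobi_def l[OF that] B[OF that] Q'_def divide_inverse)
  qed
  have comp: "Ck_on k W (\<lambda>x. q (g x))" if "smooth_on UNIV q" "Ck_on k W g" for q :: "real \<Rightarrow> real" and g k
    by (rule Ck_on_compose_real[OF \<open>open W\<close> _ that(2)]) (use that(1) in \<open>simp add: smooth_on_def\<close>)
  have XY: "smooth_on UNIV X" "smooth_on UNIV Y"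
    unfolding X_def Y_def by (rule smooth_Re_gamma smooth_Im_gamma)+
  have kP: "Ck_on k W P" and kA: "Ck_on k W A" and kdP: "Ck_on k W (dir_deriv v P)" and kdA: "Ck_on k W (dir_deriv v A)" for k v
    using P A smooth_on_dir_deriv[OF P] smooth_on_dir_deriv[OF A] by (auto simp: smooth_on_def)
  have "Ck_on k W Q" for k
  proof (induction k)
    case 0
    then show ?case
      by (auto intro!: continuous_at_imp_continuous_on has_derivative_continuous[OF D])
  next
    case (Suc k)
    show ?case
    proof (rule Ck_on_SucI[OF \<open>open W\<close> D])
      note ci = Ck_on_add[OF \<open>open W\<close>] Ck_on_mult[OF \<open>open W\<close>] Ck_on_const kP kA Suc kdP kdA
        comp[OF smooth_on_sin_real] comp[OF smooth_on_cos_real] comp[OF XY(1)] comp[OF XY(2)] comp[OF smooth_tangent_angle] comp[OF smooth_curvature]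
      have Bk: "Ck_on k W B" unfolding B_def by (intro ci)
      have "Ck_on k W l" unfolding l_def by (intro ci)
      moreover have "Ck_on k W (\<lambda>x. inverse (sin (B x)))"
      proof (rule Ck_on_inverse[OF \<open>open W\<close> _ comp[OF smooth_on_sin_real Bk]])
        show "sin (B x) \<noteq> 0" if "x \<in> W" for x
          using sin_pos[OF billiard_map_strip[OF W[OF that]]] by (simp add: B[OF that])
      qed
      ultimately show "Ck_on k W (\<lambda>x. Q' x v)" for v
        unfolding Q'_def by (intro ci)
    qed
  qed
  then have Q: "smooth_on W Q" by (simp add: smooth_on_def)
  then show "smooth_on W (\<lambda>x. fst (f (P x, A x)))" by (simp add: Q_def)
  have "smooth_on W B"
    unfolding B_def
    by (intro smooth_on_add smooth_on_mult smooth_on_const \<open>open W\<close> A smooth_on_compose[OF \<open>open W\<close> smooth_tangent_angle] P Q)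
  then show "smooth_on W (\<lambda>x. snd (f (P x, A x)))"
    using smooth_on_cong[OF \<open>open W\<close> B] by simp
qed

lemma iterate_strip: "p \<in> strip \<Longrightarrow> (f ^^ i) p \<in> strip"
  by (induction i) (auto intro: billiard_map_strip)

text \<open>The i-th iterate serves as the parametrised start of \<open>smooth_arrival\<close>; this
  takes the place of a chain rule for maps of the plane.\<close>

lemma smooth_iterate:
  "smooth_on strip (\<lambda>p. fst ((f ^^ i) p))" "smooth_on strip (\<lambda>p. snd ((f ^^ i) p))"
proof (induction i)
  case 0
  show "smooth_on strip (\<lambda>p. fst ((f ^^ 0) p))" "smooth_on strip (\<lambda>p. snd ((f ^^ 0) p))"
    using smooth_on_fst smooth_on_snd by auto
next
  case (Suc i)
  show "smooth_on strip (\<lambda>p. fst ((f ^^ Suc i) p))" "smooth_on strip (\<lambda>p. snd ((f ^^ Suc i) p))"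
    using smooth_arrival[OF open_strip Suc] iterate_strip by simp_all
qed

text \<open>The cross product of chord and ray direction vanishes. The length is eliminated, and
  what remains is an implicit equation for the arrival point that two tables can be compared
  on.\<close>

lemma chord_equation:
  assumes "p \<in> strip"
  shows "(Im (\<gamma> (fst (f p))) - Im (\<gamma> (fst p))) * cos (\<theta> (fst p) + snd p) -
    (Re (\<gamma> (fst (f p))) - Re (\<gamma> (fst p))) * sin (\<theta> (fst p) + snd p) = 0"
  using arg_cong[OF len_chord(1)[OF assms], of Re] arg_cong[OF len_chord(1)[OF assms], of Im] by simp

end

section \<open>Orbits near the boundary\<close>

text \<open>The orbit of (1, 0) under N matrices with rows (a, b) and (e, g) that are \<eta>-close
  to shears, with b merely bounded. A shear fixes (1, 0), so the orbit should stay near it.\<close>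

definition near_shear_orbit ::
  "nat \<Rightarrow> real \<Rightarrow> real \<Rightarrow> (nat \<Rightarrow> real) \<Rightarrow> (nat \<Rightarrow> real) \<Rightarrow> (nat \<Rightarrow> real) \<Rightarrow> (nat \<Rightarrow> real) \<Rightarrow>
    (nat \<Rightarrow> real) \<Rightarrow> (nat \<Rightarrow> real) \<Rightarrow> bool" where
  "near_shear_orbit N \<eta> B a b e g x y \<longleftrightarrow> x 0 = 1 \<and> y 0 = 0 \<and>
    (\<forall>i<N. x (Suc i) = a i * x i + b i * y i \<and> y (Suc i) = e i * x i + g i * y i \<and>
      \<bar>a i - 1\<bar> \<le> \<eta> \<and> \<bar>b i\<bar> \<le> B \<and> \<bar>e i\<bar> \<le> \<eta> \<and> \<bar>g i - 1\<bar> \<le> \<eta>)"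

lemma near_shear_orbit_bound:
  assumes "B > 0"
  shows "\<exists>c>0. \<forall>\<eta> a b e g x y. 0 < \<eta> \<longrightarrow> \<eta> \<le> 1 \<longrightarrow> near_shear_orbit N \<eta> B a b e g x y \<longrightarrow>
    \<bar>x N - 1\<bar> \<le> c * \<eta> \<and> \<bar>y N\<bar> \<le> c * \<eta>"
proof (induction N)
  case 0
  show ?case by (rule exI[of _ 1]) (auto simp: near_shear_orbit_def)
next
  case (Suc N)
  then obtain c where c: "c > 0" and IH: "\<And>\<eta> a b e g x y. 0 < \<eta> \<Longrightarrow> \<eta> \<le> 1 \<Longrightarrow>
    near_shear_orbit N \<eta> B a b e g x y \<Longrightarrow> \<bar>x N - 1\<bar> \<le> c * \<eta> \<and> \<bar>y N\<bar> \<le> c * \<eta>" by blast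
  show ?case
  \<comment> \<open>One more step multiplies \<eta> by 1 + (2 + B) c in the first coordinate and by
    1 + 3 c in the second; this is a common upper bound.\<close>
  proof (intro exI[of _ "1 + (3 + B) * c"] conjI allI impI)
    fix \<eta> :: real and x y a b e g :: "nat \<Rightarrow> real"
    assume \<eta>: "0 < \<eta>" "\<eta> \<le> 1" and orb: "near_shear_orbit (Suc N) \<eta> B a b e g x y"
    then have r: "x (Suc N) = a N * x N + b N * y N" "y (Suc N) = e N * x N + g N * y N"
      "\<bar>a N - 1\<bar> \<le> \<eta>" "\<bar>b N\<bar> \<le> B" "\<bar>e N\<bar> \<le> \<eta>" "\<bar>g N - 1\<bar> \<le> \<eta>"
      by (auto simp: near_shear_orbit_def)
    have "near_shear_orbit N \<eta> B a b e g x y" using orb by (simp add: near_shear_orbit_def)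
    then have xy: "\<bar>x N - 1\<bar> \<le> c * \<eta>" "\<bar>y N\<bar> \<le> c * \<eta>" using IH \<eta> by blast+
    have "c * \<eta> \<le> c" using c \<eta> by simp
    then have xN: "\<bar>x N\<bar> \<le> 1 + c" using xy(1) by linarith
    have "x (Suc N) - 1 = (a N - 1) * x N + (x N - 1) + b N * y N"
      using r by (simp add: algebra_simps)
    also have "\<bar>\<dots>\<bar> \<le> \<bar>a N - 1\<bar> * \<bar>x N\<bar> + \<bar>x N - 1\<bar> + \<bar>b N\<bar> * \<bar>y N\<bar>"
      by (metis (no_types, opaque_lifting) abs_mult abs_triangle_ineq add_mono_thms_linordered_semiring(3) order_trans)
    also have "\<dots> \<le> \<eta> * (1 + c) + c * \<eta> + B * (c * \<eta>)"
      using r(3,4) xy xN \<eta> c by (intro add_mono mult_mono) auto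
    also have "\<dots> \<le> (1 + (3 + B) * c) * \<eta>" using c \<eta> assms by (simp add: algebra_simps)
    finally show "\<bar>x (Suc N) - 1\<bar> \<le> (1 + (3 + B) * c) * \<eta>" .
    have "\<bar>g N\<bar> \<le> 2" using r(6) \<eta> by linarith
    have "\<bar>y (Suc N)\<bar> \<le> \<bar>e N\<bar> * \<bar>x N\<bar> + \<bar>g N\<bar> * \<bar>y N\<bar>"
      unfolding r(2) by (metis abs_mult abs_triangle_ineq)
    also have "\<dots> \<le> \<eta> * (1 + c) + 2 * (c * \<eta>)"
      using r(5) xy xN \<eta> c \<open>\<bar>g N\<bar> \<le> 2\<close> by (intro add_mono mult_mono) auto
    also have "\<dots> \<le> (1 + (3 + B) * c) * \<eta>" using c \<eta> assms by (simp add: algebra_simps)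
    finally show "\<bar>y (Suc N)\<bar> \<le> (1 + (3 + B) * c) * \<eta>" .
  qed (use c assms in \<open>simp add: add_pos_pos\<close>)
qed

section \<open>Chords and derivatives as the angle tends to 0\<close>

context billiard_table
begin

text \<open>The chord seen from its arrival point, so that \<open>chord_taylor\<close> can be
  applied there too, with a negative increment, to estimate sin \<phi>'.\<close>

lemma chord_backward:
  assumes "p \<in> strip"
  shows "chord (fst (f p)) (fst p) = - (of_real (len p) * cis (- snd (f p)))"
proof -
  define s a s' a' where "s = fst p" and "a = snd p" and "s' = fst (f p)" and "a' = snd (f p)"
  have "cis a' = cis (\<theta> s' - \<theta> s - a)"
    using billiard_map_step[OF assms] by (simp add: step_def a'_def s'_def s_def a_def)
  then have "cnj (cis a') = cnj (cis (\<theta> s' - \<theta> s - a))" by simp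
  then have c: "cis (- a') = cis (\<theta> s + a - \<theta> s')" by (simp add: cis_cnj algebra_simps)
  have "chord s' s = - ((\<gamma> s' - \<gamma> s) * cnj (T s'))" by (simp add: chord_def algebra_simps)
  also have "\<gamma> s' - \<gamma> s = of_real (len p) * cis (\<theta> s + a)"
    using len_chord(1)[OF assms] by (simp add: s_def s'_def a_def)
  finally show ?thesis
    unfolding s_def[symmetric] s'_def[symmetric] a'_def[symmetric] c
    by (simp add: tangent_angle(2) cis_cnj cis_mult mult.assoc)
qed

text \<open>The positive lower bound comes from bounding the inverse of the curvature, again
  continuous and periodic.\<close>

lemma curvature_bounds:
  obtains K m C where "K > 0" "m > 0" "C > 0" "\<And>s. \<kappa> s \<le> K" "\<And>s. m \<le> \<kappa> s"
    "\<And>s x. \<bar>\<kappa> (s + x) - \<kappa> s\<bar> \<le> C * \<bar>x\<bar>"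
proof -
  obtain K where K: "K > 0" "\<And>s. \<bar>\<kappa> s\<bar> \<le> K"
    by (rule periodic_bounded[OF curvature_periodic smooth_on_continuous_on[OF smooth_curvature]]) blast
  obtain C where C: "C > 0" "\<And>s x. \<bar>\<kappa> (s + x) - \<kappa> s\<bar> \<le> C * \<bar>x\<bar>"
    by (rule periodic_smooth_taylor[OF curvature_periodic smooth_curvature]) blast
  have "continuous_on UNIV (\<lambda>s. inverse (\<kappa> s))"
    using curvature_pos by (intro continuous_on_inverse smooth_on_continuous_on[OF smooth_curvature]) (metis less_irrefl)
  then obtain M where M: "M > 0" "\<And>s. \<bar>inverse (\<kappa> s)\<bar> \<le> M"
    by (rule periodic_bounded[rotated]) (auto simp: curvature_periodic)
  have "inverse M \<le> \<kappa> s" for s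
    using M(2)[of s] M(1) curvature_pos[of s] by (simp add: field_simps)
  then show ?thesis using that[of K "inverse M" C] K C M(1) by (auto intro: order_trans[OF abs_ge_self])
qed

text \<open>Distance of the derivative from a shear in terms of the arc h. The last two bounds
  concern the second row, whose entries are \<open>\<kappa>' a - \<kappa>\<close> and
  \<open>\<kappa>' b - 1\<close>; hence the 2.\<close>

definition step_estimates :: "real \<Rightarrow> real \<times> real \<Rightarrow> bool" where
  "step_estimates M p \<longleftrightarrow> (let
     h = fst (f p) - fst p;
     a = (\<kappa> (fst p) * len p - sin (snd p)) / sin (snd (f p));
     b = len p / sin (snd (f p))
   in \<bar>a - 1\<bar> \<le> M * h \<and> \<bar>b\<bar> \<le> M \<and> \<bar>\<kappa> (fst (f p)) * a - \<kappa> (fst p)\<bar> \<le> M * h \<and>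
     \<bar>\<kappa> (fst (f p)) * b - 2\<bar> \<le> M * h)"

text \<open>With h the arc and L the chord length, L = h + O(h^2), and L sin \<phi> is \<kappa> h^2
  / 2 + O(h^3) at either end. So a tends to (\<kappa> - \<kappa>/2) / (\<kappa>/2) = 1 and b is
  close to 2/\<kappa>.\<close>

lemma short_chord_estimates:
  "\<exists>M>0. \<exists>h0>0. \<forall>p\<in>strip. fst (f p) - fst p < h0 \<longrightarrow> step_estimates M p"
proof -
  obtain K m C2 where K: "K > 0" "\<And>s. \<kappa> s \<le> K" and m: "m > 0" "\<And>s. m \<le> \<kappa> s"
    and C2: "C2 > 0" "\<And>s x. \<bar>\<kappa> (s + x) - \<kappa> s\<bar> \<le> C2 * \<bar>x\<bar>"
    using curvature_bounds by metis
  obtain C where C: "C > 0" "\<And>s x. cmod (chord s (s + x) - of_real x - \<i> * of_real (\<kappa> s * x\<^sup>2 / 2)) \<le> C * \<bar>x\<bar> ^ 3"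
    using chord_taylor by blast
  \<comment> \<open>In absolute value, \<open>C3\<close> bounds (L - h) / h^2, \<open>D1\<close>
    bounds (l^2 - 1) / h for l = L / h, and \<open>D2\<close> bounds the numerators of A - 1 and
    \<kappa>' B - 2 divided by h.\<close>
  define C3 where "C3 = K / 2 + C"
  define D1 where "D1 = C3 * (2 + C3)"
  define D2 where "D2 = K * D1 + 2 * C + C2"
  have pos: "C3 > 0" "D1 > 0" "D2 > 0" using K C C2 by (auto simp: C3_def D1_def D2_def add_pos_pos)
  \<comment> \<open>Below \<open>h0\<close> the error C h is at most m / 4, which leaves the
    denominator \<open>p1\<close> at least m / 4; hence the factor 4 / m in the constants.\<close>
  define h0 where "h0 = min 1 (m / (4 * C))"
  define M1 where "M1 = D2 * (4 / m)"
  have M1: "M1 > 0" using pos m by (simp add: M1_def)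
  define M where "M = M1 + (1 + C3)\<^sup>2 * (4 / m) + (K * M1 + C2)"
  have M: "M > 0" "M1 \<le> M" "(1 + C3)\<^sup>2 * (4 / m) \<le> M" "K * M1 + C2 \<le> M"
    using M1 pos m K C2 by (auto simp: M_def intro!: add_pos_pos add_nonneg_nonneg)
  have main: "step_estimates M p" if p: "p \<in> strip" and hs: "fst (f p) - fst p < h0" for p
  proof -
    define s a s' a' where "s = fst p" and "a = snd p" and "s' = fst (f p)" and "a' = snd (f p)"
    define h where "h = s' - s"
    define L where "L = len p"
    have h: "h > 0" "h \<le> 1" "h \<le> m / (4 * C)"
      using hs arrival_arc_pairs[OF p] by (auto simp: h_def s_def s'_def h0_def arc_pairs_def)
    have sin1: "sin a' > 0" using sin_pos[OF billiard_map_strip[OF p]] by (simp add: a'_def)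
    have L: "L > 0" "chord s s' = of_real L * cis a" "chord s' s = - (of_real L * cis (- a'))"
      using len_chord[OF p] chord_backward[OF p] by (auto simp: L_def s_def a_def s'_def a'_def)
    have e0: "cmod (chord s s' - of_real h - \<i> * of_real (\<kappa> s * h\<^sup>2 / 2)) \<le> C * h ^ 3"
      using C(2)[of s h] h(1) by (simp add: h_def)
    have e1: "cmod (chord s' s - of_real (- h) - \<i> * of_real (\<kappa> s' * h\<^sup>2 / 2)) \<le> C * h ^ 3"
    proof -
      have "s' + (- h) = s" by (simp add: h_def)
      then show ?thesis using C(2)[of s' "- h"] h(1) by (simp only: power2_minus abs_minus abs_of_pos)
    qed
    have i0: "\<bar>L * sin a - \<kappa> s * h\<^sup>2 / 2\<bar> \<le> C * h ^ 3"
      using order_trans[OF abs_Im_le_cmod e0] by (simp add: L(2))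
    have i1: "\<bar>L * sin a' - \<kappa> s' * h\<^sup>2 / 2\<bar> \<le> C * h ^ 3"
      using order_trans[OF abs_Im_le_cmod e1] by (simp add: L(3))
    have Lh: "\<bar>L - h\<bar> \<le> C3 * h\<^sup>2"
    proof -
      have "\<bar>L - h\<bar> = \<bar>cmod (chord s s') - cmod (of_real h)\<bar>"
        using L h by (simp add: norm_mult)
      also have "\<dots> \<le> cmod (chord s s' - of_real h)" by (rule norm_triangle_ineq3)
      also have "\<dots> \<le> cmod (chord s s' - of_real h - \<i> * of_real (\<kappa> s * h\<^sup>2 / 2)) + cmod (\<i> * of_real (\<kappa> s * h\<^sup>2 / 2))"
        using norm_triangle_ineq[of "chord s s' - of_real h - \<i> * of_real (\<kappa> s * h\<^sup>2 / 2)" "\<i> * of_real (\<kappa> s * h\<^sup>2 / 2)"] by simp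
      also have "cmod (\<i> * of_real (\<kappa> s * h\<^sup>2 / 2)) = \<kappa> s * h\<^sup>2 / 2"
        using curvature_pos[of s] unfolding norm_mult norm_of_real by simp
      finally have "\<bar>L - h\<bar> \<le> C * h ^ 3 + \<kappa> s * h\<^sup>2 / 2" using e0 by linarith
      moreover have "\<kappa> s * h\<^sup>2 / 2 \<le> K * h\<^sup>2 / 2" using K(2)[of s] by (simp add: mult_right_mono)
      moreover have "C * h ^ 3 \<le> C * h\<^sup>2"
        using h C(1) by (simp add: power2_eq_square power3_eq_cube mult_left_le)
      ultimately show ?thesis unfolding C3_def by (simp add: algebra_simps)
    qed
    define l where "l = L / h"
    define p0 where "p0 = L * sin a / h\<^sup>2"
    define p1 where "p1 = L * sin a' / h\<^sup>2"
    have l: "\<bar>l - 1\<bar> \<le> C3 * h" "l > 0"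
    proof -
      have "\<bar>l - 1\<bar> = \<bar>L - h\<bar> / h" using h by (simp add: l_def field_simps)
      also have "\<dots> \<le> C3 * h\<^sup>2 / h" using Lh h by (intro divide_right_mono) auto
      finally show "\<bar>l - 1\<bar> \<le> C3 * h" using h by (simp add: power2_eq_square)
      show "l > 0" using L h by (simp add: l_def)
    qed
    have scale: "\<bar>z / h\<^sup>2 - k / 2\<bar> \<le> C * h" if "\<bar>z - k * h\<^sup>2 / 2\<bar> \<le> C * h ^ 3" for z k
    proof -
      have "\<bar>z / h\<^sup>2 - k / 2\<bar> = \<bar>(z - k * h\<^sup>2 / 2) / h\<^sup>2\<bar>" using h by (simp add: field_simps)
      also have "\<dots> = \<bar>z - k * h\<^sup>2 / 2\<bar> / h\<^sup>2" by simp
      also have "\<dots> \<le> C * h ^ 3 / h\<^sup>2" using that by (intro divide_right_mono) auto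
      finally show ?thesis using h by (simp add: power2_eq_square power3_eq_cube)
    qed
    have p0: "\<bar>p0 - \<kappa> s / 2\<bar> \<le> C * h" and p1: "\<bar>p1 - \<kappa> s' / 2\<bar> \<le> C * h"
      unfolding p0_def p1_def by (rule scale[OF i0] scale[OF i1])+
    have kk: "\<bar>\<kappa> s' - \<kappa> s\<bar> \<le> C2 * h" using C2(2)[of s h] h by (simp add: h_def)
    have Ch: "C * h \<le> m / 4" using h(3) C(1) by (simp add: field_simps)
    have p1m: "p1 \<ge> m / 4" using p1 Ch m(2)[of s'] by linarith
    then have p1pos: "p1 > 0" using m(1) by linarith
    have lle: "l \<le> 1 + C3"
    proof -
      have "C3 * h \<le> C3" using pos(1) h by simp
      then show ?thesis using l(1) by linarith
    qed
    have l2: "\<bar>l\<^sup>2 - 1\<bar> \<le> D1 * h"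
    proof -
      have "\<bar>l\<^sup>2 - 1\<bar> = \<bar>l - 1\<bar> * \<bar>l + 1\<bar>"
        by (simp add: power2_eq_square algebra_simps flip: abs_mult)
      also have "\<dots> \<le> (C3 * h) * (2 + C3)"
        using l lle pos(1) h by (intro mult_mono) auto
      finally show ?thesis by (simp add: D1_def algebra_simps)
    qed
    have kl: "\<bar>\<kappa> x * l\<^sup>2 - \<kappa> x\<bar> \<le> K * D1 * h" for x
    proof -
      have "\<bar>\<kappa> x * l\<^sup>2 - \<kappa> x\<bar> = \<kappa> x * \<bar>l\<^sup>2 - 1\<bar>"
        using abs_mult[of "\<kappa> x" "l\<^sup>2 - 1"] curvature_pos[of x] by (simp add: right_diff_distrib)
      also have "\<dots> \<le> K * (D1 * h)"
        using K l2 curvature_pos[of x] by (intro mult_mono) auto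
      finally show ?thesis by simp
    qed
    have inv: "1 / p1 \<le> 4 / m" using p1m m(1) p1pos by (simp add: field_simps)
    define A where "A = (\<kappa> s * L - sin a) / sin a'"
    define B where "B = L / sin a'"
    \<comment> \<open>Numerator and denominator are multiplied by L / h^2, which makes all
      quantities of order 1.\<close>
    have A: "A = (\<kappa> s * l\<^sup>2 - p0) / p1" and B: "B = l\<^sup>2 / p1"
      using L(1) h(1) sin1 by (simp_all add: A_def B_def l_def p0_def p1_def field_simps power2_eq_square)
    have quot: "\<bar>z / p1\<bar> \<le> M1 * h" if "\<bar>z\<bar> \<le> D2 * h" for z
    proof -
      have "\<bar>z / p1\<bar> = \<bar>z\<bar> * (1 / p1)" using p1pos by simp
      also have "\<dots> \<le> D2 * h * (4 / m)" using that inv p1pos h pos by (intro mult_mono) auto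
      finally show ?thesis by (simp add: M1_def algebra_simps)
    qed
    have A1: "\<bar>A - 1\<bar> \<le> M1 * h"
    proof -
      have "\<bar>\<kappa> s * l\<^sup>2 - p0 - p1\<bar> \<le> K * D1 * h + C * h + C * h + C2 * h"
        using kl[of s] p0 p1 kk by (smt (verit) field_sum_of_halves)
      then have "\<bar>(\<kappa> s * l\<^sup>2 - p0 - p1) / p1\<bar> \<le> M1 * h"
        by (intro quot) (simp add: D2_def algebra_simps)
      moreover have "A - 1 = (\<kappa> s * l\<^sup>2 - p0 - p1) / p1" using p1pos by (simp add: A field_simps)
      ultimately show ?thesis by simp
    qed
    have B1: "\<bar>B\<bar> \<le> M"
    proof -
      have "\<bar>B\<bar> = l\<^sup>2 * (1 / p1)" using p1pos by (simp add: B)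
      also have "\<dots> \<le> (1 + C3)\<^sup>2 * (4 / m)"
        using lle l(2) inv p1pos m(1) by (intro mult_mono power_mono) auto
      finally show ?thesis using M by linarith
    qed
    have E1: "\<bar>\<kappa> s' * A - \<kappa> s\<bar> \<le> M * h"
    proof -
      have "\<kappa> s' * A - \<kappa> s = \<kappa> s' * (A - 1) + (\<kappa> s' - \<kappa> s)" by (simp add: algebra_simps)
      also have "\<bar>\<dots>\<bar> \<le> \<kappa> s' * \<bar>A - 1\<bar> + \<bar>\<kappa> s' - \<kappa> s\<bar>"
        using abs_triangle_ineq[of "\<kappa> s' * (A - 1)" "\<kappa> s' - \<kappa> s"] curvature_pos[of s'] by (simp add: abs_mult)
      also have "\<dots> \<le> K * (M1 * h) + C2 * h"
        using K A1 kk curvature_pos[of s'] by (intro add_mono mult_mono) auto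
      also have "\<dots> = (K * M1 + C2) * h" by (simp add: algebra_simps)
      also have "\<dots> \<le> M * h" using M(4) h by (intro mult_right_mono) auto
      finally show ?thesis .
    qed
    have M1h: "M1 * h \<le> M * h" using M(2) h by (intro mult_right_mono) auto
    have G1: "\<bar>\<kappa> s' * B - 2\<bar> \<le> M * h"
    proof -
      have "\<bar>\<kappa> s' * l\<^sup>2 - 2 * p1\<bar> \<le> K * D1 * h + C * h + C * h"
        using kl[of s'] p1 by (smt (verit) field_sum_of_halves)
      moreover have "C2 * h \<ge> 0" using C2 h by simp
      ultimately have "\<bar>(\<kappa> s' * l\<^sup>2 - 2 * p1) / p1\<bar> \<le> M1 * h"
        by (intro quot) (simp add: D2_def algebra_simps)
      moreover have "\<kappa> s' * B - 2 = (\<kappa> s' * l\<^sup>2 - 2 * p1) / p1" using p1pos by (simp add: B field_simps)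
      ultimately show ?thesis using M1h by simp
    qed
    have "\<bar>A - 1\<bar> \<le> M * h" using A1 M1h by linarith
    then show ?thesis
      using B1 E1 G1 unfolding step_estimates_def Let_def A_def B_def h_def L_def s_def s'_def a_def a'_def by blast
  qed
  have "h0 > 0" using m C by (simp add: h0_def)
  with M(1) main show ?thesis by blast
qed

lemma chord_periodic: "chord (s + of_int k) (s' + of_int k) = chord s s'"
  using periodic_int[of \<gamma>, OF periodic] periodic_int[of T, OF T_periodic] by (simp add: chord_def)

lemma chord_periodic_snd: "chord s (s' + of_int k) = chord s s'"
  using periodic_int[of \<gamma>, OF periodic] by (simp add: chord_def)

text \<open>Arcs h from \<eta> to 1 - 1/C form with the start points a compact set, on which L sin
  \<phi> has a positive minimum, against at most 2 R \<phi>. Arcs closer to a full turn leave at an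
  angle near pi and are excluded by \<phi> < pi/2.\<close>

lemma small_angle_short_chord:
  assumes "\<eta> > 0"
  shows "\<exists>\<delta>>0. \<forall>p\<in>strip. snd p < \<delta> \<longrightarrow> fst (f p) - fst p < \<eta>"
proof -
  obtain C where C: "C > 0" "\<And>s x. cmod (chord s (s + x) - of_real x - \<i> * of_real (\<kappa> s * x\<^sup>2 / 2)) \<le> C * \<bar>x\<bar> ^ 3"
    using chord_taylor by blast
  have "bounded (range \<gamma>)"
    unfolding range_gamma using compact_imp_bounded[OF compact_frontier_bounded[OF bounded_Omega]] .
  then obtain R where R: "R > 0" "\<And>s. cmod (\<gamma> s) \<le> R" by (auto simp: bounded_pos)
  define J where "J = {0..1::real} \<times> {\<eta>..1 - 1 / C}"
  have "compact J" unfolding J_def by (intro compact_Times compact_Icc)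
  have cont: "continuous_on J (\<lambda>x. Im (chord (fst x) (fst x + snd x)))"
  proof -
    have g: "continuous_on UNIV \<gamma>"
      by (intro continuous_at_imp_continuous_on ballI) (rule has_vector_derivative_continuous[OF gamma_deriv])
    have t: "continuous_on UNIV T"
      by (intro continuous_at_imp_continuous_on ballI) (rule has_vector_derivative_continuous[OF T_deriv])
    show ?thesis unfolding chord_def
      by (intro continuous_intros continuous_on_compose2[OF g] continuous_on_compose2[OF t]) auto
  qed
  have pos: "Im (chord (fst x) (fst x + snd x)) > 0" if "x \<in> J" for x
  proof -
    have "1 / C > 0" using C by simp
    moreover have "snd x \<le> 1 - 1 / C" "\<eta> \<le> snd x" using that by (auto simp: J_def)
    ultimately have "(fst x, fst x + snd x) \<in> arc_pairs"
      using assms unfolding arc_pairs_def mem_Collect_eq fst_conv snd_conv by linarith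
    from chord_Im_pos[OF this] show ?thesis by simp
  qed
  obtain m where m: "m > 0" "\<And>x. x \<in> J \<Longrightarrow> m \<le> Im (chord (fst x) (fst x + snd x))"
  proof (cases "J = {}")
    case True
    then show ?thesis using that[of 1] by simp
  next
    case False
    then obtain x where "x \<in> J" "\<And>y. y \<in> J \<Longrightarrow> Im (chord (fst x) (fst x + snd x)) \<le> Im (chord (fst y) (fst y + snd y))"
      using continuous_attains_inf[OF \<open>compact J\<close> _ cont] by blast
    then show ?thesis using that pos by blast
  qed
  define \<delta> where "\<delta> = min (pi / 2) (m / (2 * R))"
  have "fst (f p) - fst p < \<eta>" if p: "p \<in> strip" and a: "snd p < \<delta>" for p
  proof (rule ccontr)
    assume "\<not> fst (f p) - fst p < \<eta>"
    define s h where "s = fst p" and "h = fst (f p) - fst p"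
    have h: "\<eta> \<le> h" "0 < h" "h < 1"
      using \<open>\<not> fst (f p) - fst p < \<eta>\<close> arrival_arc_pairs[OF p] by (auto simp: h_def arc_pairs_def)
    have ch: "chord s (s + h) = of_real (len p) * cis (snd p)"
      using len_chord(3)[OF p] by (simp add: s_def h_def)
    have ap: "0 < snd p" "snd p < pi / 2" using p a by (auto simp: mem_strip \<delta>_def)
    have "Re (chord s (s + h)) > 0"
      using len_chord(2)[OF p] ap cos_gt_zero[of "snd p"] by (simp add: ch)
    \<comment> \<open>Almost a full turn forward is a short step backward, whose real part is about
      h - 1 < 0.\<close>
    moreover have "chord s (s + h) = chord s (s + (h - 1))"
      using chord_periodic_snd[of s "s + (h - 1)" 1] by (simp add: algebra_simps)
    ultimately have "Re (chord s (s + (h - 1))) > 0" by simp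
    moreover have "\<bar>Re (chord s (s + (h - 1))) - (h - 1)\<bar> \<le> C * \<bar>h - 1\<bar> ^ 3"
      using order_trans[OF abs_Re_le_cmod C(2)[of s "h - 1"]] by simp
    ultimately have "1 - h < C * (1 - h) ^ 3" using h by (simp add: abs_if split: if_splits)
    also have "\<dots> \<le> C * (1 - h)\<^sup>2"
      using h C(1) by (intro mult_left_mono) (auto simp: power2_eq_square power3_eq_cube mult_left_le)
    finally have "1 - h < C * (1 - h) * (1 - h)" by (simp add: power2_eq_square)
    then have "1 < C * (1 - h)" using h by simp
    then have "1 / C < 1 - h" using C(1) by (simp add: field_simps)
    then have "(frac s, h) \<in> J"
      using h frac_ge_0[of s] frac_lt_1[of s] by (auto simp: J_def)
    then have "m \<le> Im (chord (frac s) (frac s + h))" using m(2) by force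
    also have "chord (frac s) (frac s + h) = chord s (s + h)"
      using chord_periodic[of s "- \<lfloor>s\<rfloor>" "s + h"] by (simp add: frac_def algebra_simps)
    also have "Im (chord s (s + h)) = len p * sin (snd p)" by (simp add: ch)
    also have "\<dots> \<le> 2 * R * snd p"
    proof (intro mult_mono)
      show "len p \<le> 2 * R" unfolding len_def
        using norm_triangle_ineq4[of "\<gamma> (fst (f p))" "\<gamma> (fst p)"] R(2)[of "fst (f p)"] R(2)[of "fst p"] by linarith
      show "sin (snd p) \<le> snd p" using sin_x_le_x ap by simp
    qed (use R(1) sin_pos[OF p] in auto)
    finally have "m / (2 * R) \<le> snd p" using R(1) by (simp add: field_simps)
    then show False using a by (simp add: \<delta>_def)
  qed
  moreover have "\<delta> > 0" using m R by (simp add: \<delta>_def)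
  ultimately show ?thesis by blast
qed

lemma near_boundary_derivative_pos:
  "\<exists>\<delta>>0. \<forall>p\<in>strip. \<forall>x y. (\<forall>i<N. snd ((f ^^ i) p) < \<delta>) \<longrightarrow> x 0 = 1 \<longrightarrow> y 0 = 0 \<longrightarrow>
    (\<forall>i<N. x (Suc i) = jacobi ((f ^^ i) p) (x i, y i) \<and>
      y (Suc i) = \<kappa> (fst ((f ^^ Suc i) p)) * x (Suc i) - \<kappa> (fst ((f ^^ i) p)) * x i - y i) \<longrightarrow> x N > 0"
proof -
  obtain M h0 where M: "M > 0" and h0: "h0 > 0"
    and est: "\<And>p. p \<in> strip \<Longrightarrow> fst (f p) - fst p < h0 \<Longrightarrow> step_estimates M p"
    using short_chord_estimates by blast
  obtain c where c: "c > 0" and shear: "\<And>\<eta> a b e g x y. 0 < \<eta> \<Longrightarrow> \<eta> \<le> 1 \<Longrightarrow>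
    near_shear_orbit N \<eta> M a b e g x y \<Longrightarrow> \<bar>x N - 1\<bar> \<le> c * \<eta> \<and> \<bar>y N\<bar> \<le> c * \<eta>"
    using near_shear_orbit_bound[OF M, of N] by blast
  \<comment> \<open>Makes \<open>c * \<eta>\<close> at most 1/2, so the first coordinate cannot
    reach 0.\<close>
  define \<eta> where "\<eta> = min 1 (1 / (2 * c))"
  have \<eta>: "0 < \<eta>" "\<eta> \<le> 1" "c * \<eta> < 1"
  proof -
    show "0 < \<eta>" "\<eta> \<le> 1" using c by (auto simp: \<eta>_def)
    have "c * \<eta> \<le> c * (1 / (2 * c))" using c by (intro mult_left_mono) (auto simp: \<eta>_def)
    then show "c * \<eta> < 1" using c by simp
  qed
  obtain \<delta> where \<delta>: "\<delta> > 0" "\<And>p. p \<in> strip \<Longrightarrow> snd p < \<delta> \<Longrightarrow> fst (f p) - fst p < min h0 (\<eta> / M)"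
    using small_angle_short_chord[of "min h0 (\<eta> / M)"] h0 M \<eta> by auto
  have "x N > 0" if p: "p \<in> strip" and sm: "\<forall>i<N. snd ((f ^^ i) p) < \<delta>" and x0: "x 0 = 1" "y 0 = 0"
    and rec: "\<forall>i<N. x (Suc i) = jacobi ((f ^^ i) p) (x i, y i) \<and>
      y (Suc i) = \<kappa> (fst ((f ^^ Suc i) p)) * x (Suc i) - \<kappa> (fst ((f ^^ i) p)) * x i - y i" for p x y
  proof -
    define a where "a = (\<lambda>i. let q = (f ^^ i) p in (\<kappa> (fst q) * len q - sin (snd q)) / sin (snd (f q)))"
    define b where "b = (\<lambda>i. let q = (f ^^ i) p in len q / sin (snd (f q)))"
    define e where "e = (\<lambda>i. \<kappa> (fst ((f ^^ Suc i) p)) * a i - \<kappa> (fst ((f ^^ i) p)))"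
    define g where "g = (\<lambda>i. \<kappa> (fst ((f ^^ Suc i) p)) * b i - 1)"
    have "\<bar>x N - 1\<bar> \<le> c * \<eta> \<and> \<bar>y N\<bar> \<le> c * \<eta>"
    proof (rule shear[OF \<eta>(1,2)], unfold near_shear_orbit_def, intro conjI[OF x0(1)] conjI[OF x0(2)] allI impI)
      fix i assume i: "i < N"
      define q where "q = (f ^^ i) p"
      have q: "q \<in> strip" "snd q < \<delta>" using iterate_strip[OF p] sm i by (auto simp: q_def)
      define h where "h = fst (f q) - fst q"
      have h: "h < h0" "h < \<eta> / M" using \<delta>(2)[OF q] by (auto simp: h_def)
      have Mh: "M * h \<le> \<eta>" using h(2) M by (simp add: field_simps)
      have ab: "a i = (\<kappa> (fst q) * len q - sin (snd q)) / sin (snd (f q))" "b i = len q / sin (snd (f q))"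
        by (simp_all add: a_def b_def q_def Let_def)
      have eg: "e i = \<kappa> (fst (f q)) * a i - \<kappa> (fst q)" "g i = \<kappa> (fst (f q)) * b i - 1"
        by (simp_all add: e_def g_def q_def)
      have x: "x (Suc i) = a i * x i + b i * y i"
        using rec i by (simp add: ab jacobi_def add_divide_distrib flip: q_def)
      have y: "y (Suc i) = \<kappa> (fst (f q)) * x (Suc i) - \<kappa> (fst q) * x i - y i"
        using rec i by (simp flip: q_def)
      have y': "y (Suc i) = e i * x i + g i * y i"
        unfolding y x eg by (simp add: algebra_simps)
      have "\<bar>a i - 1\<bar> \<le> M * h" "\<bar>b i\<bar> \<le> M" "\<bar>e i\<bar> \<le> M * h" "\<bar>\<kappa> (fst (f q)) * b i - 2\<bar> \<le> M * h"
        using est[OF q(1)] h(1) unfolding h_def eg ab step_estimates_def Let_def by auto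
      moreover from this have "\<bar>g i - 1\<bar> \<le> M * h" unfolding eg by simp
      ultimately show "x (Suc i) = a i * x i + b i * y i \<and> y (Suc i) = e i * x i + g i * y i \<and>
          \<bar>a i - 1\<bar> \<le> \<eta> \<and> \<bar>b i\<bar> \<le> M \<and> \<bar>e i\<bar> \<le> \<eta> \<and> \<bar>g i - 1\<bar> \<le> \<eta>"
        using x y' Mh by linarith
    qed
    then show ?thesis using \<eta>(3) by linarith
  qed
  then show ?thesis using \<delta>(1) by blast
qed

end

section \<open>The linearised billiard map along an orbit\<close>

text \<open>The derivative of the billiard map along an orbit with angles \<open>\<phi> i\<close>: \<open>K i\<close> is the curvature
  at the \<open>i\<close>-th point, \<open>S i = sin (\<phi> i)\<close>, and \<open>L i\<close> the length of the \<open>i\<close>-th chord.\<close>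

definition orbit_jac ::
  "(nat \<Rightarrow> real) \<Rightarrow> (nat \<Rightarrow> real) \<Rightarrow> (nat \<Rightarrow> real) \<Rightarrow> nat \<Rightarrow> real \<times> real \<Rightarrow> real \<times> real" where
  "orbit_jac K S L i v =
     (let x = ((K i * L i - S i) * fst v + L i * snd v) / S (Suc i)
      in (x, K (Suc i) * x - K i * fst v - snd v))"

text \<open>The product of m such derivatives from index i on. It sees only three sequences, so two
  tables with the same polygon differ in K alone.\<close>

primrec orbit_prop ::
  "(nat \<Rightarrow> real) \<Rightarrow> (nat \<Rightarrow> real) \<Rightarrow> (nat \<Rightarrow> real) \<Rightarrow> nat \<Rightarrow> nat \<Rightarrow> real \<times> real \<Rightarrow> real \<times> real" where
  "orbit_prop K S L i 0 v = v"
| "orbit_prop K S L i (Suc m) v = orbit_jac K S L (i + m) (orbit_prop K S L i m v)"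

lemma orbit_jac_fst: "fst (orbit_jac K S L i v) = ((K i * L i - S i) * fst v + L i * snd v) / S (Suc i)"
  and orbit_jac_snd: "snd (orbit_jac K S L i v) = K (Suc i) * fst (orbit_jac K S L i v) - K i * fst v - snd v"
  by (simp_all add: orbit_jac_def Let_def)

lemma orbit_jac_add: "orbit_jac K S L i (u + v) = orbit_jac K S L i u + orbit_jac K S L i v"
proof -
  have "fst (orbit_jac K S L i (u + v)) = fst (orbit_jac K S L i u) + fst (orbit_jac K S L i v)"
    by (simp add: orbit_jac_fst add_divide_distrib[symmetric]) (simp add: algebra_simps)
  then show ?thesis by (simp add: prod_eq_iff orbit_jac_snd algebra_simps)
qed

lemma orbit_jac_scaleR: "orbit_jac K S L i (c *\<^sub>R v) = c *\<^sub>R orbit_jac K S L i v"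
proof -
  have "fst (orbit_jac K S L i (c *\<^sub>R v)) = c * fst (orbit_jac K S L i v)"
    by (simp add: orbit_jac_fst algebra_simps)
  then show ?thesis by (simp add: prod_eq_iff orbit_jac_snd algebra_simps)
qed

lemma orbit_jac_sum: "orbit_jac K S L i (\<Sum>j\<in>I. z j) = (\<Sum>j\<in>I. orbit_jac K S L i (z j))"
proof (induction I rule: infinite_finite_induct)
  case (insert j I)
  then show ?case by (simp add: orbit_jac_add)
qed (use orbit_jac_scaleR[of K S L i 0 0] in \<open>simp_all add: zero_prod_def\<close>)

lemma orbit_prop_add: "orbit_prop K S L i (j + k) v = orbit_prop K S L (i + j) k (orbit_prop K S L i j v)"
  by (induction k) (simp_all add: add.assoc)

lemma orbit_prop_cong:
  assumes "\<And>j. i \<le> j \<Longrightarrow> j < i + m \<Longrightarrow> L j = L' j"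
  shows "orbit_prop K S L i m v = orbit_prop K S L' i m v"
  using assms by (induction m) (simp_all add: orbit_jac_def)

lemma orbit_prop_cong_curvature:
  assumes "\<And>j. i \<le> j \<Longrightarrow> j \<le> i + m \<Longrightarrow> K j = K' j"
  shows "orbit_prop K S L i m v = orbit_prop K' S L i m v"
  using assms by (induction m) (simp_all add: orbit_jac_def)

lemma isCont_orbit_prop:
  fixes K :: "'a::t2_space \<Rightarrow> nat \<Rightarrow> real"
  assumes K: "\<And>j. isCont (\<lambda>\<epsilon>. K \<epsilon> j) a"
  shows "isCont (\<lambda>\<epsilon>. fst (orbit_prop (K \<epsilon>) S L i m v)) a \<and> isCont (\<lambda>\<epsilon>. snd (orbit_prop (K \<epsilon>) S L i m v)) a"
proof (induction m)
  case (Suc m)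
  have "isCont (\<lambda>\<epsilon>. fst (orbit_prop (K \<epsilon>) S L i (Suc m) v)) a"
    unfolding orbit_prop.simps orbit_jac_fst divide_inverse
    by (intro continuous_mult continuous_add continuous_diff continuous_const K) (use Suc in auto)
  moreover from this have "isCont (\<lambda>\<epsilon>. snd (orbit_prop (K \<epsilon>) S L i (Suc m) v)) a"
    unfolding orbit_prop.simps orbit_jac_snd
    by (intro continuous_mult continuous_diff K) (use Suc in auto)
  ultimately show ?case by simp
qed simp

section \<open>Area form and transport of sources\<close>

definition wronskian :: "real \<times> real \<Rightarrow> real \<times> real \<Rightarrow> real" where
  "wronskian u v = fst u * snd v - snd u * fst v"

text \<open>Invariance of the measure sin \<phi> ds d\<phi>: the determinant of one step is
  \<open>S i / S (Suc i)\<close>.\<close>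

lemma wronskian_orbit_jac:
  assumes "S (Suc i) \<noteq> 0"
  shows "wronskian (orbit_jac K S L i u) (orbit_jac K S L i v) = S i / S (Suc i) * wronskian u v"
proof -
  obtain u1 u2 v1 v2 where uv: "u = (u1, u2)" "v = (v1, v2)" by (cases u, cases v)
  define \<alpha> where "\<alpha> = K i * L i - S i"
  \<comment> \<open>The term with \<open>K (Suc i)\<close> in the second component is a multiple of
    the first component and drops out.\<close>
  have "wronskian (orbit_jac K S L i u) (orbit_jac K S L i v) =
      fst (orbit_jac K S L i u) * (- K i * v1 - v2) - (- K i * u1 - u2) * fst (orbit_jac K S L i v)"
    unfolding wronskian_def orbit_jac_snd by (simp add: uv algebra_simps)
  also have "\<dots> = ((\<alpha> * u1 + L i * u2) / S (Suc i)) * (- K i * v1 - v2) - (- K i * u1 - u2) * ((\<alpha> * v1 + L i * v2) / S (Suc i))"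
    by (simp only: orbit_jac_fst uv \<alpha>_def fst_conv snd_conv)
  also have "\<dots> = ((\<alpha> * u1 + L i * u2) * (- K i * v1 - v2) - (- K i * u1 - u2) * (\<alpha> * v1 + L i * v2)) / S (Suc i)"
    by (simp add: diff_divide_distrib)
  also have "(\<alpha> * u1 + L i * u2) * (- K i * v1 - v2) - (- K i * u1 - u2) * (\<alpha> * v1 + L i * v2) =
      S i * (u1 * v2 - u2 * v1)"
    by (simp add: \<alpha>_def algebra_simps)
  finally show ?thesis by (simp add: wronskian_def uv)
qed

lemma wronskian_orbit_prop:
  assumes "\<And>j. i \<le> j \<Longrightarrow> j \<le> i + m \<Longrightarrow> S j \<noteq> 0"
  shows "wronskian (orbit_prop K S L i m u) (orbit_prop K S L i m v) = S i / S (i + m) * wronskian u v"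
  using assms
proof (induction m)
  case (Suc m)
  have "wronskian (orbit_prop K S L i (Suc m) u) (orbit_prop K S L i (Suc m) v) =
      S (i + m) / S (Suc (i + m)) * (S i / S (i + m) * wronskian u v)"
    using Suc by (simp add: wronskian_orbit_jac)
  also have "\<dots> = S i / S (i + Suc m) * wronskian u v"
    using Suc.prems[of "i + m"] by simp
  finally show ?case .
qed simp

text \<open>Variation of constants: the impulse \<open>(0, g i)\<close> enters at time i and is
  transported from there.\<close>

lemma orbit_prop_source:
  assumes z0: "z 0 = 0"
    and rec: "\<And>i. i < N \<Longrightarrow> z (Suc i) = orbit_jac K S L i (z i) + (0, g (Suc i))"
  shows "m \<le> N \<Longrightarrow> z m = (\<Sum>i\<in>{1..m}. g i *\<^sub>R orbit_prop K S L i (m - i) (0, 1))"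
proof (induction m)
  case 0
  then show ?case using z0 by simp
next
  case (Suc m)
  have "z (Suc m) = orbit_jac K S L m (z m) + (0, g (Suc m))" using rec Suc.prems by simp
  also have "orbit_jac K S L m (z m) = (\<Sum>i\<in>{1..m}. g i *\<^sub>R orbit_jac K S L m (orbit_prop K S L i (m - i) (0, 1)))"
    using Suc by (simp add: orbit_jac_sum orbit_jac_scaleR)
  also have "\<dots> = (\<Sum>i\<in>{1..m}. g i *\<^sub>R orbit_prop K S L i (Suc m - i) (0, 1))"
    by (intro sum.cong refl) (auto simp: Suc_diff_le)
  also have "(0, g (Suc m)) = g (Suc m) *\<^sub>R orbit_prop K S L (Suc m) (Suc m - Suc m) (0, 1)"
    by simp
  finally show ?case by simp
qed

text \<open>Divided by \<open>c i ^ n\<close>, a linear relation between the rows says that a polynomial of degree at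
  most \<open>n + 1\<close> vanishes at the \<open>n + 2\<close> distinct points \<open>a i / c i\<close>. Its value at \<open>A / B\<close> isolates
  the coefficient of the last row.\<close>

lemma det_jet_matrix_nonzero:
  fixes ix :: "'m::finite \<Rightarrow> nat" and a b c d :: "nat \<Rightarrow> real"
  assumes ix: "bij_betw ix UNIV {1..n + 2}"
    and nz: "\<And>i. i \<in> {1..n + 2} \<Longrightarrow> b i \<noteq> 0" "\<And>i. i \<in> {1..n + 2} \<Longrightarrow> c i \<noteq> 0"
    and rel: "\<And>i. i \<in> {1..n + 2} \<Longrightarrow> d i * (B * a i - A * c i) = b i * (D * a i - C * c i)"
    and dist: "\<And>i j. i \<in> {1..n + 2} \<Longrightarrow> j \<in> {1..n + 2} \<Longrightarrow> i < j \<Longrightarrow> a i * c j \<noteq> a j * c i"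
    and ABCD: "A \<noteq> 0" "B \<noteq> 0" "A * D - B * C \<noteq> 0"
  shows "det (\<chi> r q. 2 * (if ix r \<le> n + 1 then b (ix q) * (c (ix q) ^ (ix r - 1) * a (ix q) ^ (n + 1 - ix r))
      else d (ix q) * a (ix q) ^ n) :: real ^ 'm ^ 'm) \<noteq> 0"
    (is "det ?M \<noteq> 0")
proof -
  have ker: "x = 0" if x: "transpose ?M *v x = 0" for x
  proof -
    define \<mu> where "\<mu> = (\<lambda>j. x $ (inv_into UNIV ix j))"
    have \<mu>: "x $ r = \<mu> (ix r)" for r
      using ix by (simp add: \<mu>_def bij_betw_def)
    define \<nu> where "\<nu> = \<mu> (n + 2)"
    define P where "P = (\<Sum>k\<le>n. monom (\<mu> (k + 1)) (n - k))"
    \<comment> \<open>The relation at a column reads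
      \<open>d i * t ^ n * \<nu> + b i * poly P t = 0\<close>. Multiplied by B t - A, and with
      \<open>rel\<close> eliminating \<open>d i\<close>, it becomes \<open>b i\<close> times the
      value of \<open>Q\<close>.\<close>
    define Q where "Q = P * [:- A, B:] + smult \<nu> (monom 1 n * [:- C, D:])"
    have root: "poly Q (a i / c i) = 0" if i: "i \<in> {1..n + 2}" for i
    proof -
      define t where "t = a i / c i"
      have a: "a i = t * c i" using nz(2)[OF i] by (simp add: t_def)
      obtain q where q: "i = ix q" using i ix by (metis bij_betw_imp_surj_on imageE)
      have "0 = (transpose ?M *v x) $ q" using x by simp
      also have "\<dots> = (\<Sum>r\<in>UNIV. 2 * (if ix r \<le> n + 1 then b i * (c i ^ (ix r - 1) * a i ^ (n + 1 - ix r))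
          else d i * a i ^ n) * \<mu> (ix r))"
        by (simp add: matrix_vector_mult_def transpose_def q \<mu> cong: if_cong)
      also have "\<dots> = (\<Sum>j\<in>{1..n + 2}. 2 * (if j \<le> n + 1 then b i * (c i ^ (j - 1) * a i ^ (n + 1 - j))
          else d i * a i ^ n) * \<mu> j)"
        by (rule sum.reindex_bij_betw[OF ix])
      also have "{1..n + 2} = insert (n + 2) {1..n + 1}" by auto
      also have "(\<Sum>j\<in>insert (n + 2) {1..n + 1}. 2 * (if j \<le> n + 1 then b i * (c i ^ (j - 1) * a i ^ (n + 1 - j))
          else d i * a i ^ n) * \<mu> j) = 2 * (d i * a i ^ n * \<nu>) +
          (\<Sum>j\<in>{1..n + 1}. 2 * (b i * (c i ^ (j - 1) * a i ^ (n + 1 - j))) * \<mu> j)"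
        by (simp add: \<nu>_def)
      also have "(\<Sum>j\<in>{1..n + 1}. 2 * (b i * (c i ^ (j - 1) * a i ^ (n + 1 - j))) * \<mu> j) =
          (\<Sum>k\<le>n. 2 * (b i * (c i ^ k * a i ^ (n - k))) * \<mu> (k + 1))"
        by (rule sum.reindex_bij_witness[of _ "\<lambda>k. k + 1" "\<lambda>j. j - 1"]) auto
      also have "\<dots> = (\<Sum>k\<le>n. 2 * b i * c i ^ n * (\<mu> (k + 1) * t ^ (n - k)))"
      proof (intro sum.cong refl)
        fix k assume "k \<in> {..n}"
        then have "c i ^ k * a i ^ (n - k) = c i ^ n * t ^ (n - k)"
          using power_add[of "c i" k "n - k"] by (simp add: a power_mult_distrib)
        then show "2 * (b i * (c i ^ k * a i ^ (n - k))) * \<mu> (k + 1) = 2 * b i * c i ^ n * (\<mu> (k + 1) * t ^ (n - k))"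
          by simp
      qed
      also have "\<dots> = 2 * b i * c i ^ n * poly P t"
        by (simp add: P_def poly_sum poly_monom sum_distrib_left)
      also have "2 * (d i * a i ^ n * \<nu>) + 2 * b i * c i ^ n * poly P t =
          2 * c i ^ n * (d i * t ^ n * \<nu> + b i * poly P t)"
        unfolding a power_mult_distrib by (simp add: distrib_left)
      finally have 0: "d i * t ^ n * \<nu> + b i * poly P t = 0" using nz(2)[OF i] by simp
      have "c i * (d i * (B * t - A)) = c i * (b i * (D * t - C))"
        using rel[OF i] by (simp add: a algebra_simps)
      then have r: "d i * (B * t - A) = b i * (D * t - C)" using nz(2)[OF i] by simp
      have "b i * poly Q t = b i * poly P t * (B * t - A) + \<nu> * t ^ n * (b i * (D * t - C))"
        by (simp add: Q_def poly_monom algebra_simps)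
      also have "\<dots> = (d i * t ^ n * \<nu> + b i * poly P t) * (B * t - A)"
        unfolding r[symmetric] by (simp add: algebra_simps)
      finally show ?thesis using 0 nz(1)[OF i] by (simp add: t_def)
    qed
    have "Q = 0"
    proof (rule ccontr)
      assume Q: "Q \<noteq> 0"
      have P: "degree P \<le> n"
        unfolding P_def by (intro degree_sum_le) (auto intro: order_trans[OF degree_monom_le])
      have "degree (P * [:- A, B:]) \<le> n + 1"
        using degree_mult_le[of P "[:- A, B:]"] P by (simp split: if_splits)
      moreover have "degree (smult \<nu> (monom 1 n * [:- C, D:])) \<le> n + 1"
        using order_trans[OF degree_smult_le degree_mult_le[of "monom 1 n" "[:- C, D:]"]]
          degree_monom_le[of "1::real" n] by (force split: if_splits)
      ultimately have "degree Q \<le> n + 1" unfolding Q_def by (rule degree_add_le)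
      moreover have "card {t. poly Q t = 0} \<le> degree Q" by (rule card_poly_roots_bound[OF Q])
      moreover have "card ((\<lambda>i. a i / c i) ` {1..n + 2}) \<le> card {t. poly Q t = 0}"
        using root by (intro card_mono poly_roots_finite[OF Q]) auto
      moreover have "inj_on (\<lambda>i. a i / c i) {1..n + 2}"
      proof (rule linorder_inj_onI)
        fix i j assume ij: "i < j" "i \<in> {1..n + 2}" "j \<in> {1..n + 2}"
        then show "a i / c i \<noteq> a j / c j"
          using dist[OF ij(2,3,1)] nz(2) by (simp add: frac_eq_eq)
      qed auto
      then have "card ((\<lambda>i. a i / c i) ` {1..n + 2}) = n + 2" by (simp add: card_image)
      ultimately show False by linarith
    qed
    have "poly Q (A / B) = \<nu> * (A / B) ^ n * ((A * D - B * C) / B)"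
    proof -
      have "A / B * B - A = 0" "D * (A / B) - C = (A * D - B * C) / B"
        using ABCD by (simp_all add: field_simps)
      moreover have "poly Q (A / B) = poly P (A / B) * (A / B * B - A) + \<nu> * (A / B) ^ n * (D * (A / B) - C)"
        by (simp add: Q_def poly_monom algebra_simps)
      ultimately show ?thesis by simp
    qed
    then have "\<nu> = 0" using \<open>Q = 0\<close> ABCD by simp
    then have "P * [:- A, B:] = 0" using \<open>Q = 0\<close> by (simp add: Q_def)
    then have "P = 0 \<or> [:- A, B:] = 0" by (simp only: mult_eq_0_iff)
    then have "P = 0" using ABCD by simp
    have "\<mu> (k + 1) = 0" if "k \<le> n" for k
    proof -
      have "coeff P (n - k) = (\<Sum>j\<le>n. if n - j = n - k then \<mu> (j + 1) else 0)"
        by (simp add: P_def coeff_sum cong: if_cong)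
      also have "\<dots> = (\<Sum>j\<le>n. if j = k then \<mu> (j + 1) else 0)"
        using that by (intro sum.cong) auto
      also have "\<dots> = \<mu> (k + 1)" using that by simp
      finally show ?thesis using \<open>P = 0\<close> by simp
    qed
    moreover have "\<exists>k\<le>n. ix r = k + 1" if "ix r \<noteq> n + 2" for r
    proof -
      have "ix r \<in> {1..n + 2}" using ix by (auto simp: bij_betw_def)
      then show ?thesis using that by (intro exI[of _ "ix r - 1"]) auto
    qed
    ultimately have "\<mu> (ix r) = 0" for r
      using \<open>\<nu> = 0\<close> unfolding \<nu>_def by (cases "ix r = n + 2") force+
    then show ?thesis by (simp add: vec_eq_iff \<mu>)
  qed
  define M where "M = ?M"
  have "\<exists>B. B ** transpose M = mat 1"
    unfolding matrix_left_invertible_ker by (intro allI impI, rule ker) (simp only: M_def)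
  then have "invertible (transpose M)" unfolding invertible_left_inverse .
  then have "det M \<noteq> 0" unfolding invertible_det_nz det_transpose .
  then show ?thesis unfolding M_def .
qed

context billiard_table
begin

lemma orbit_iterate_has_derivative:
  assumes orbit: "orbit_segment \<gamma> N s \<phi>" and \<phi>0: "0 < \<phi> 0" "\<phi> 0 < pi" and im: "i + m \<le> N"
  shows "(s i, \<phi> i) \<in> strip" "(f ^^ m) (s i, \<phi> i) = (s (i + m), \<phi> (i + m))"
    "((f ^^ m) has_derivative orbit_prop (\<lambda>i. \<kappa> (s i)) (\<lambda>i. sin (\<phi> i)) (\<lambda>i. cmod (\<gamma> (s (Suc i)) - \<gamma> (s i))) i m)
      (at (s i, \<phi> i))"
proof -
  have it: "(s j, \<phi> j) = (f ^^ j) (s 0, \<phi> 0)" if "j \<le> N" for j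
    using orbit that unfolding orbit_segment_def by blast
  have strip: "(s j, \<phi> j) \<in> strip" if "j \<le> N" for j
    unfolding it[OF that] by (rule iterate_strip) (use \<phi>0 in \<open>simp add: mem_strip\<close>)
  show "(s i, \<phi> i) \<in> strip" using strip im by simp
  have it': "(f ^^ k) (s i, \<phi> i) = (s (i + k), \<phi> (i + k))" if "i + k \<le> N" for k
  proof -
    have "i \<le> N" using that by simp
    have "(f ^^ k) (s i, \<phi> i) = (f ^^ (k + i)) (s 0, \<phi> 0)"
      unfolding it[OF \<open>i \<le> N\<close>] funpow_add o_apply ..
    also have "\<dots> = (s (i + k), \<phi> (i + k))" using it[OF that] by (simp only: add.commute)
    finally show ?thesis .
  qed
  show "(f ^^ m) (s i, \<phi> i) = (s (i + m), \<phi> (i + m))" using it' im by simp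
  let ?J = "orbit_prop (\<lambda>i. \<kappa> (s i)) (\<lambda>i. sin (\<phi> i)) (\<lambda>i. cmod (\<gamma> (s (Suc i)) - \<gamma> (s i)))"
  show "((f ^^ m) has_derivative ?J i m) (at (s i, \<phi> i))"
    using im
  proof (induction m)
    case 0
    have "?J i 0 = (\<lambda>v. v)" by auto
    then show ?case by (simp add: id_def)
  next
    case (Suc m)
    define j where "j = i + m"
    have j: "Suc j \<le> N" using Suc.prems by (simp add: j_def)
    have fj: "f (s j, \<phi> j) = (s (Suc j), \<phi> (Suc j))"
    proof -
      have "f (s j, \<phi> j) = f ((f ^^ j) (s 0, \<phi> 0))" using it[of j] j by (simp only: Suc_leD)
      also have "\<dots> = (s (Suc j), \<phi> (Suc j))" using it[OF j] by (simp only: funpow.simps o_apply)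
      finally show ?thesis .
    qed
    have "(f has_derivative orbit_jac (\<lambda>i. \<kappa> (s i)) (\<lambda>i. sin (\<phi> i)) (\<lambda>i. cmod (\<gamma> (s (Suc i)) - \<gamma> (s i))) j)
        (at (s j, \<phi> j))"
      by (rule has_derivative_eq_rhs[OF billiard_map_has_derivative[OF strip]])
        (use j in \<open>auto simp: fun_eq_iff orbit_jac_def jacobi_def len_def fj Let_def\<close>)
    then have "(f has_derivative orbit_jac (\<lambda>i. \<kappa> (s i)) (\<lambda>i. sin (\<phi> i)) (\<lambda>i. cmod (\<gamma> (s (Suc i)) - \<gamma> (s i))) j)
        (at ((f ^^ m) (s i, \<phi> i)))"
      using it'[of m] Suc.prems by (simp add: j_def)
    from has_derivative_compose[OF Suc.IH this] Suc.prems
    show ?case by (simp add: j_def o_def)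
  qed
qed

end

section \<open>Jets of a perturbed billiard map\<close>

lemma vanishes_zero: "vanishes k p (\<lambda>x. 0)"
proof (induction k)
  case (Suc k)
  have "dir_deriv v (\<lambda>x. 0) = (\<lambda>x. 0)" for v :: 'a
    by (simp add: dir_deriv_def fun_eq_iff)
  then show ?case using Suc by (simp add: vanishes_Suc)
qed simp

lemma vanishes_one: "h p = 0 \<Longrightarrow> vanishes 1 p h"
  by (simp add: vanishes_def)

lemma dir_deriv_eqI: "(h has_real_derivative D) (at x) \<Longrightarrow> dir_deriv 1 h x = D"
  using dir_deriv_unique[of h "(*) D" x 1] by (simp add: has_field_derivative_def)

section \<open>Leading terms when both the functions and their arguments are perturbed\<close>

context smooth_point
begin

text \<open>Inserting \<open>q0 (F1 x)\<close> separates the change of the outer function, governed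
  by \<open>iter_deriv_compose\<close>, from that of its argument, governed by
  \<open>iter_deriv_compose_diff\<close>.\<close>

lemma perturbed_compose:
  fixes q1 q0 :: "real \<Rightarrow> real"
  assumes q: "smooth_on UNIV q1" "smooth_on UNIV q0" and F: "smooth_on S F1" "smooth_on S F0"
    and p: "F1 p = c" "F0 p = c"
    and vq: "vanishes k c (\<lambda>y. q1 y - q0 y)" and vF: "vanishes k p (\<lambda>x. F1 x - F0 x)"
  shows "smooth_on S (\<lambda>x. q1 (F1 x) - q0 (F0 x))"
    "vanishes k p (\<lambda>x. q1 (F1 x) - q0 (F0 x))"
    "length vs = k \<Longrightarrow> vs \<noteq> [] \<Longrightarrow> iter_deriv vs (\<lambda>x. q1 (F1 x) - q0 (F0 x)) p =
      iter_deriv (replicate k 1) (\<lambda>y. q1 y - q0 y) c * prod_list (map (\<lambda>v. dir_deriv v F1 p) vs) +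
      dir_deriv 1 q0 c * iter_deriv vs (\<lambda>x. F1 x - F0 x) p"
proof -
  note dq = smooth_on_diff[OF open_UNIV q]
  have sm1: "smooth_on S (\<lambda>x. q1 (F1 x) - q0 (F1 x))"
    by (rule smooth_on_compose[OF open_S dq F(1)])
  have sm2: "smooth_on S (\<lambda>x. q0 (F1 x) - q0 (F0 x))"
    by (rule smooth_compose_diff[OF q(2) F])
  have eq: "(\<lambda>x. q1 (F1 x) - q0 (F0 x)) = (\<lambda>x. (q1 (F1 x) - q0 (F1 x)) + (q0 (F1 x) - q0 (F0 x)))"
    by simp
  show "smooth_on S (\<lambda>x. q1 (F1 x) - q0 (F0 x))"
    unfolding eq by (rule smooth_on_add[OF open_S sm1 sm2])
  have v1: "vanishes k p (\<lambda>x. q1 (F1 x) - q0 (F1 x))"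
    by (rule vanishes_compose[OF F(1) dq]) (use vq p in simp)
  have v2: "vanishes k p (\<lambda>x. q0 (F1 x) - q0 (F0 x))"
    by (rule vanishes_compose_diff[OF F q(2) vF])
  show "vanishes k p (\<lambda>x. q1 (F1 x) - q0 (F0 x))"
    unfolding eq by (rule vanishes_add[OF sm1 sm2 v1 v2])
  show "iter_deriv vs (\<lambda>x. q1 (F1 x) - q0 (F0 x)) p =
      iter_deriv (replicate k 1) (\<lambda>y. q1 y - q0 y) c * prod_list (map (\<lambda>v. dir_deriv v F1 p) vs) +
      dir_deriv 1 q0 c * iter_deriv vs (\<lambda>x. F1 x - F0 x) p" if vs: "length vs = k" "vs \<noteq> []"
  proof -
    have "iter_deriv vs (\<lambda>x. q1 (F1 x) - q0 (F1 x)) p =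
        iter_deriv (replicate k 1) (\<lambda>y. q1 y - q0 y) c * prod_list (map (\<lambda>v. dir_deriv v F1 p) vs)"
      using iter_deriv_compose[OF F(1) dq, of vs] vq p vs by simp
    moreover have "iter_deriv vs (\<lambda>x. q0 (F1 x) - q0 (F0 x)) p = dir_deriv 1 q0 c * iter_deriv vs (\<lambda>x. F1 x - F0 x) p"
      using iter_deriv_compose_diff[OF q(2) F, of vs] vF p vs by simp
    ultimately show ?thesis
      unfolding eq iter_deriv_add[OF open_S sm1 sm2 p_in] by simp
  qed
qed

lemma iter_deriv_mult_diff:
  assumes sm: "smooth_on S a1" "smooth_on S a0" "smooth_on S c1" "smooth_on S c0"
    and v: "vanishes (length vs) p (\<lambda>x. a1 x - a0 x)" "vanishes (length vs) p (\<lambda>x. c1 x - c0 x)"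
    and eq: "c1 p = c0 p"
  shows "iter_deriv vs (\<lambda>x. a1 x * c1 x - a0 x * c0 x) p =
    iter_deriv vs (\<lambda>x. a1 x - a0 x) p * c0 p + iter_deriv vs (\<lambda>x. c1 x - c0 x) p * a0 p"
proof -
  note da = smooth_on_diff[OF open_S sm(1,2)] and dc = smooth_on_diff[OF open_S sm(3,4)]
  have "(\<lambda>x. a1 x * c1 x - a0 x * c0 x) = (\<lambda>x. (a1 x - a0 x) * c1 x + (c1 x - c0 x) * a0 x)"
    by (auto simp: algebra_simps)
  then show ?thesis
    by (simp add: iter_deriv_add[OF open_S smooth_on_mult[OF open_S da sm(3)] smooth_on_mult[OF open_S dc sm(2)] p_in]
        iter_deriv_lead_mult[OF da sm(3) v(1)] iter_deriv_lead_mult[OF dc sm(2) v(2)] eq)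
qed

text \<open>Implicit differentiation of the difference of two chord equations, with Q the arrival
  point, P the departure point and B the direction. Only terms with all derivatives on one
  difference survive.\<close>

lemma implicit_chord_lead:
  fixes X1 Y1 X0 Y0 :: "real \<Rightarrow> real"
  assumes sm: "smooth_on UNIV X1" "smooth_on UNIV X0" "smooth_on UNIV Y1" "smooth_on UNIV Y0"
    "smooth_on S Q1" "smooth_on S Q0" "smooth_on S P1" "smooth_on S P0" "smooth_on S B1" "smooth_on S B0"
    and base: "Q1 p = q" "Q0 p = q" "P1 p = r" "P0 p = r"
    and vs: "length vs = k" "vs \<noteq> []"
    and v: "vanishes k p (\<lambda>x. Q1 x - Q0 x)" "vanishes k p (\<lambda>x. P1 x - P0 x)" "vanishes k p (\<lambda>x. B1 x - B0 x)"
    and vq: "vanishes (Suc k) q (\<lambda>y. X1 y - X0 y)" "vanishes (Suc k) q (\<lambda>y. Y1 y - Y0 y)"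
    and vr: "vanishes (Suc k) r (\<lambda>y. X1 y - X0 y)" "vanishes (Suc k) r (\<lambda>y. Y1 y - Y0 y)"
    and eq1: "\<And>x. x \<in> S \<Longrightarrow> (Y1 (Q1 x) - Y1 (P1 x)) * cos (B1 x) - (X1 (Q1 x) - X1 (P1 x)) * sin (B1 x) = 0"
    and eq0: "\<And>x. x \<in> S \<Longrightarrow> (Y0 (Q0 x) - Y0 (P0 x)) * cos (B0 x) - (X0 (Q0 x) - X0 (P0 x)) * sin (B0 x) = 0"
  shows "(dir_deriv 1 Y0 q * cos (B0 p) - dir_deriv 1 X0 q * sin (B0 p)) * iter_deriv vs (\<lambda>x. Q1 x - Q0 x) p =
    (dir_deriv 1 Y0 r * cos (B0 p) - dir_deriv 1 X0 r * sin (B0 p)) * iter_deriv vs (\<lambda>x. P1 x - P0 x) p +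
    ((Y0 q - Y0 r) * sin (B0 p) + (X0 q - X0 r) * cos (B0 p)) * iter_deriv vs (\<lambda>x. B1 x - B0 x) p"
proof -
  have k: "k \<ge> 1" using vs by (cases vs) auto
  have Bp: "B1 p = B0 p" using vanishes_at[OF v(3) k] by simp
  \<comment> \<open>The curves agree to one order more than k at q and r, so changing the outer
    function contributes nothing at order k.\<close>
  have z: "iter_deriv (replicate k 1) h c = 0" if "vanishes (Suc k) c h" for c :: real and h
    using that by (simp add: vanishes_def)
  have comp: "smooth_on S (\<lambda>x. g1 (F1 x) - g0 (F0 x))" "vanishes k p (\<lambda>x. g1 (F1 x) - g0 (F0 x))"
    "iter_deriv vs (\<lambda>x. g1 (F1 x) - g0 (F0 x)) p = dir_deriv 1 g0 c * iter_deriv vs (\<lambda>x. F1 x - F0 x) p"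
    if "smooth_on UNIV g1" "smooth_on UNIV g0" "smooth_on S F1" "smooth_on S F0" "F1 p = c" "F0 p = c"
      "vanishes (Suc k) c (\<lambda>y. g1 y - g0 y)" "vanishes k p (\<lambda>x. F1 x - F0 x)"
    for g1 g0 :: "real \<Rightarrow> real" and F1 F0 c
    using perturbed_compose(1,2)[OF that(1-6) vanishes_mono[OF that(7)] that(8)]
      perturbed_compose(3)[OF that(1-6) vanishes_mono[OF that(7)] that(8), of vs] z[OF that(7)] vs by auto
  note sm_comp = smooth_on_compose[OF open_S]
  have side: "iter_deriv vs (\<lambda>x. (g1 (Q1 x) - g1 (P1 x)) * t (B1 x) - (g0 (Q0 x) - g0 (P0 x)) * t (B0 x)) p =
      (dir_deriv 1 g0 q * iter_deriv vs (\<lambda>x. Q1 x - Q0 x) p - dir_deriv 1 g0 r * iter_deriv vs (\<lambda>x. P1 x - P0 x) p) * t (B0 p) +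
      dir_deriv 1 t (B0 p) * iter_deriv vs (\<lambda>x. B1 x - B0 x) p * (g0 q - g0 r)"
    if g: "smooth_on UNIV g1" "smooth_on UNIV g0" "vanishes (Suc k) q (\<lambda>y. g1 y - g0 y)"
        "vanishes (Suc k) r (\<lambda>y. g1 y - g0 y)" and t: "smooth_on UNIV t" for g1 g0 t :: "real \<Rightarrow> real"
  proof -
    note cQ = comp[OF g(1,2) sm(5,6) base(1,2) g(3) v(1)] and cP = comp[OF g(1,2) sm(7,8) base(3,4) g(4) v(2)]
    have eq: "(\<lambda>x. (g1 (Q1 x) - g1 (P1 x)) - (g0 (Q0 x) - g0 (P0 x))) =
        (\<lambda>x. (g1 (Q1 x) - g0 (Q0 x)) - (g1 (P1 x) - g0 (P0 x)))" by auto
    have vt: "vanishes k p (\<lambda>x. t (B1 x) - t (B0 x))"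
      by (rule vanishes_compose_diff[OF sm(9,10) t v(3)])
    have "vanishes k p (\<lambda>x. (g1 (Q1 x) - g1 (P1 x)) - (g0 (Q0 x) - g0 (P0 x)))"
      unfolding eq by (rule vanishes_diff[OF cQ(1) cP(1) cQ(2) cP(2)])
    then show ?thesis
      using iter_deriv_mult_diff[OF smooth_on_diff[OF open_S sm_comp[OF g(1) sm(5)] sm_comp[OF g(1) sm(7)]]
          smooth_on_diff[OF open_S sm_comp[OF g(2) sm(6)] sm_comp[OF g(2) sm(8)]]
          sm_comp[OF t sm(9)] sm_comp[OF t sm(10)], of vs] vt vs v(3)
        iter_deriv_diff[OF open_S cQ(1) cP(1) p_in, of vs] iter_deriv_compose_diff[OF t sm(9,10), of vs]
      by (simp add: eq cQ(3) cP(3) Bp base)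
  qed
  note sX = side[OF sm(1,2) vq(1) vr(1) smooth_on_sin_real] and sY = side[OF sm(3,4) vq(2) vr(2) smooth_on_cos_real]
  have smG: "smooth_on S (\<lambda>x. (g1 (Q1 x) - g1 (P1 x)) * t (B1 x) - (g0 (Q0 x) - g0 (P0 x)) * t (B0 x))"
    if "smooth_on UNIV g1" "smooth_on UNIV g0" "smooth_on UNIV t" for g1 g0 t :: "real \<Rightarrow> real"
    by (intro smooth_on_diff smooth_on_mult open_S sm_comp[OF that(1)] sm_comp[OF that(2)] sm_comp[OF that(3)] sm)
  note smX = smG[OF sm(1,2) smooth_on_sin_real] and smY = smG[OF sm(3,4) smooth_on_cos_real]
  have dcos: "dir_deriv 1 cos x = - sin x" and dsin: "dir_deriv 1 sin x = cos x" for x :: real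
    by (rule dir_deriv_eqI, rule DERIV_cos DERIV_sin)+
  have "iter_deriv vs (\<lambda>x. ((Y1 (Q1 x) - Y1 (P1 x)) * cos (B1 x) - (Y0 (Q0 x) - Y0 (P0 x)) * cos (B0 x)) -
      ((X1 (Q1 x) - X1 (P1 x)) * sin (B1 x) - (X0 (Q0 x) - X0 (P0 x)) * sin (B0 x))) p = iter_deriv vs (\<lambda>x. 0) p"
    by (rule iter_deriv_cong[OF open_S smooth_on_diff[OF open_S smY smX] _ p_in])
      (use eq1 eq0 in \<open>force simp: algebra_simps\<close>)
  also have "\<dots> = 0" using vanishes_zero[of "Suc k" p] vs by (simp add: vanishes_def)
  finally show ?thesis
    unfolding iter_deriv_diff[OF open_S smY smX p_in] sX sY dcos dsin by (simp add: algebra_simps)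
qed

end

text \<open>Index 0 is the unperturbed table and 1 a single member of the family, so no \<epsilon>
  occurs. The flatness conditions include the end vertices, where \<open>e\<close> is later 0;
  \<open>j + 2 \<le> n\<close> avoids truncated subtraction.\<close>

locale billiard_pair = t0: billiard_table \<Omega>0 \<gamma>0 + t1: billiard_table \<Omega>1 \<gamma>1
  for \<Omega>0 \<gamma>0 \<Omega>1 \<gamma>1 +
  fixes n N :: nat and s \<phi> e :: "nat \<Rightarrow> real"
  assumes n: "n \<ge> 1" and N: "N \<ge> 1"
    and orbit0: "orbit_segment \<gamma>0 N s \<phi>" and orbit1: "orbit_segment \<gamma>1 N s \<phi>"
    and phi0: "0 < \<phi> 0" "\<phi> 0 < pi"
    and vertex: "\<And>i. i \<le> N \<Longrightarrow> \<gamma>1 (s i) = \<gamma>0 (s i)"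
    and low: "\<And>i j. i \<le> N \<Longrightarrow> j + 2 \<le> n \<Longrightarrow> (deriv ^^ j) (\<lambda>x. curvature \<gamma>1 x - curvature \<gamma>0 x) (s i) = 0"
    and top: "\<And>i. i \<le> N \<Longrightarrow> (deriv ^^ (n - 1)) (\<lambda>x. curvature \<gamma>1 x - curvature \<gamma>0 x) (s i) = e i"
begin

abbreviation "p0 \<equiv> (s 0, \<phi> 0)"
abbreviation "\<theta>0 \<equiv> tangent_angle \<gamma>0"
abbreviation "\<theta>1 \<equiv> tangent_angle \<gamma>1"
abbreviation "P0 i p \<equiv> fst ((billiard_map \<gamma>0 ^^ i) p)"
abbreviation "P1 i p \<equiv> fst ((billiard_map \<gamma>1 ^^ i) p)"
abbreviation "A0 i p \<equiv> snd ((billiard_map \<gamma>0 ^^ i) p)"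
abbreviation "A1 i p \<equiv> snd ((billiard_map \<gamma>1 ^^ i) p)"

text \<open>Tangent angles are only fixed modulo \<open>2 * pi\<close>, and \<open>w i\<close> is the multiple of \<open>2 * pi\<close> by which the
  two choices differ at \<open>s i\<close>.\<close>

definition w :: "nat \<Rightarrow> real" where
  "w i = \<theta>1 (s i) - \<theta>0 (s i)"

lemma p0_strip: "p0 \<in> strip"
  using phi0 by (simp add: mem_strip)

sublocale sp: smooth_point strip p0
  by unfold_locales (use p0_strip in auto)

lemma at_p0:
  assumes "i \<le> N"
  shows "(billiard_map \<gamma>0 ^^ i) p0 = (s i, \<phi> i)" "(billiard_map \<gamma>1 ^^ i) p0 = (s i, \<phi> i)"
    "(s i, \<phi> i) \<in> strip"
  using t0.orbit_iterate_has_derivative(1,2)[OF orbit0 phi0, of 0 i] t1.orbit_iterate_has_derivative(2)[OF orbit1 phi0, of 0 i]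
    t0.orbit_iterate_has_derivative(1)[OF orbit0 phi0, of i 0] assms by simp_all

lemma map_orbit:
  assumes "i < N"
  shows "billiard_map \<gamma>0 (s i, \<phi> i) = (s (Suc i), \<phi> (Suc i))" "billiard_map \<gamma>1 (s i, \<phi> i) = (s (Suc i), \<phi> (Suc i))"
  using t0.orbit_iterate_has_derivative(2)[OF orbit0 phi0, of i 1] t1.orbit_iterate_has_derivative(2)[OF orbit1 phi0, of i 1] assms
  by simp_all

text \<open>Fixed vertices fix the chords, hence the departure directions and, the angles being
  equal, the tangents. The last vertex has no outgoing chord; there the reflection law of the
  incoming one decides.\<close>

lemma cis_w:
  assumes "i \<le> N"
  shows "cis (w i) = 1"
proof -
  have lt: "cis (\<theta>1 (s i)) = cis (\<theta>0 (s i))" if i: "i < N" for i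
  proof -
    have st: "(s i, \<phi> i) \<in> strip" using at_p0 i by simp
    have l: "t0.len (s i, \<phi> i) = t1.len (s i, \<phi> i)"
      using i by (simp add: t0.len_def t1.len_def map_orbit vertex)
    have 0: "\<gamma>0 (s (Suc i)) - \<gamma>0 (s i) = of_real (t1.len (s i, \<phi> i)) * cis (\<theta>0 (s i) + \<phi> i)"
      using t0.len_chord(1)[OF st] i l by (simp add: map_orbit)
    have 1: "\<gamma>0 (s (Suc i)) - \<gamma>0 (s i) = of_real (t1.len (s i, \<phi> i)) * cis (\<theta>1 (s i) + \<phi> i)"
      using t1.len_chord(1)[OF st] i by (simp add: map_orbit vertex)
    have "of_real (t1.len (s i, \<phi> i)) * cis (\<theta>1 (s i) + \<phi> i) = of_real (t1.len (s i, \<phi> i)) * cis (\<theta>0 (s i) + \<phi> i)"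
      by (rule trans[OF 1[symmetric] 0])
    then have "cis (\<theta>1 (s i) + \<phi> i) = cis (\<theta>0 (s i) + \<phi> i)"
      using t1.len_chord(2)[OF st] by simp
    then show ?thesis by (simp flip: cis_mult)
  qed
  have "cis (\<theta>1 (s i)) = cis (\<theta>0 (s i))"
  proof (cases "i < N")
    case False
    define j where "j = N - 1"
    have j: "j < N" "i = Suc j" using False assms N by (auto simp: j_def)
    have st: "(s j, \<phi> j) \<in> strip" using at_p0 j by simp
    have "cis (\<theta>1 (s i) - \<theta>1 (s j) - \<phi> j) = cis (\<theta>0 (s i) - \<theta>0 (s j) - \<phi> j)"
      using t0.billiard_map_step[OF st] t1.billiard_map_step[OF st] j
      by (simp add: t0.step_def t1.step_def map_orbit)
    then have "cis (\<theta>1 (s i)) * (cis (- \<theta>1 (s j)) * cis (- \<phi> j)) = cis (\<theta>0 (s i)) * (cis (- \<theta>0 (s j)) * cis (- \<phi> j))"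
      by (simp add: cis_mult algebra_simps)
    moreover have "cis (- \<theta>1 (s j)) = cis (- \<theta>0 (s j))"
      using arg_cong[OF lt[OF j(1)], of cnj] by (simp add: cis_cnj)
    ultimately show ?thesis by simp
  qed (rule lt)
  moreover have "cis (w i) = cis (\<theta>1 (s i)) / cis (\<theta>0 (s i))" by (simp add: w_def cis_divide)
  ultimately show ?thesis by simp
qed

lemma shift_w:
  assumes "i \<le> N"
  shows "cos (x - w i) = cos x" "sin (x - w i) = sin x"
  using arg_cong[OF cis_w[OF assms], of Re] arg_cong[OF cis_w[OF assms], of Im] by (simp_all add: cos_diff sin_diff)

text \<open>The antiderivative of the curvature difference that is 0 at \<open>s i\<close>.\<close>

definition \<psi> :: "nat \<Rightarrow> real \<Rightarrow> real" where
  "\<psi> i x = \<theta>1 x - w i - \<theta>0 x"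

lemma smooth_theta: "smooth_on UNIV (\<lambda>x. \<theta>1 x - w i)" "smooth_on UNIV \<theta>0" "smooth_on UNIV (\<psi> i)"
  unfolding \<psi>_def
  by (intro smooth_on_diff open_UNIV t1.smooth_tangent_angle t0.smooth_tangent_angle smooth_on_const)+

lemma deriv_psi: "deriv (\<psi> i) = (\<lambda>x. curvature \<gamma>1 x - curvature \<gamma>0 x)"
proof
  fix x
  have "(\<psi> i has_real_derivative (curvature \<gamma>1 x - curvature \<gamma>0 x)) (at x)"
    unfolding \<psi>_def using t1.tangent_angle(1)[of x] t0.tangent_angle(1)[of x]
    by (auto intro!: derivative_eq_intros)
  then show "deriv (\<psi> i) x = curvature \<gamma>1 x - curvature \<gamma>0 x" by (rule DERIV_imp_deriv)
qed

lemma vanishes_psi: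
  assumes "i \<le> N"
  shows "vanishes n (s i) (\<psi> i)"
proof (rule vanishes_real[OF smooth_theta(3)])
  show "(deriv ^^ j) (\<psi> i) (s i) = 0" if "j < n" for j
  proof (cases j)
    case 0
    then show ?thesis by (simp add: \<psi>_def w_def)
  next
    case (Suc k)
    then show ?thesis using low[OF assms, of k] that
      by (simp add: funpow_swap1 deriv_psi)
  qed
qed

lemma iter_deriv_psi:
  assumes "i \<le> N"
  shows "iter_deriv (replicate n 1) (\<psi> i) (s i) = e i"
proof -
  obtain k where k: "n = Suc k" using n by (cases n) auto
  have "iter_deriv (replicate n 1) (\<psi> i) (s i) = (deriv ^^ n) (\<psi> i) (s i)"
    by (subst iter_deriv_real[OF smooth_theta(3)]) (simp add: prod_list_replicate)
  also have "\<dots> = e i" using top[OF assms] by (simp add: k funpow_swap1 deriv_psi)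
  finally show ?thesis .
qed

text \<open>The velocity is the cosine or sine of the tangent angle, so the position, equal at the
  vertex itself, gains one order over the angle.\<close>

lemma vanishes_position:
  assumes "i \<le> N"
  shows "vanishes (Suc n) (s i) (\<lambda>x. Re (\<gamma>1 x) - Re (\<gamma>0 x))"
    "vanishes (Suc n) (s i) (\<lambda>x. Im (\<gamma>1 x) - Im (\<gamma>0 x))"
proof -
  interpret q: smooth_point UNIV "s i" by unfold_locales auto
  have psi: "vanishes n (s i) (\<lambda>x. (\<theta>1 x - w i) - \<theta>0 x)"
    using vanishes_psi[OF assms] by (simp add: \<psi>_def[abs_def])
  have main: "vanishes (Suc n) (s i) (\<lambda>x. h1 x - h0 x)"
    if h: "\<And>x. (h1 has_real_derivative g (\<theta>1 x - w i)) (at x)" "\<And>x. (h0 has_real_derivative g (\<theta>0 x)) (at x)"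
      and g: "smooth_on UNIV g" and eq: "h1 (s i) = h0 (s i)" for h1 h0 g :: "real \<Rightarrow> real"
  proof -
    have d: "dir_deriv v (\<lambda>x. h1 x - h0 x) = (\<lambda>x. (g (\<theta>1 x - w i) - g (\<theta>0 x)) * v)" for v
    proof
      fix x
      have "((\<lambda>x. h1 x - h0 x) has_derivative (*) (g (\<theta>1 x - w i) - g (\<theta>0 x))) (at x)"
        using DERIV_diff[OF h] by (simp add: has_field_derivative_def)
      from dir_deriv_unique[OF this] show "dir_deriv v (\<lambda>x. h1 x - h0 x) x = (g (\<theta>1 x - w i) - g (\<theta>0 x)) * v" .
    qed
    have "vanishes (n + 0) (s i) (\<lambda>x. (g (\<theta>1 x - w i) - g (\<theta>0 x)) * v)" for v
      by (rule q.vanishes_mult[OF q.smooth_compose_diff[OF g smooth_theta(1,2)] smooth_on_const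
            q.vanishes_compose_diff[OF smooth_theta(1,2) g psi] vanishes_0])
    then show ?thesis using eq by (simp add: vanishes_Suc d)
  qed
  show "vanishes (Suc n) (s i) (\<lambda>x. Re (\<gamma>1 x) - Re (\<gamma>0 x))"
    by (rule main[where g = cos])
      (use t1.Re_gamma_deriv t0.Re_gamma_deriv shift_w[OF assms] smooth_on_cos_real vertex[OF assms] in simp_all)
  show "vanishes (Suc n) (s i) (\<lambda>x. Im (\<gamma>1 x) - Im (\<gamma>0 x))"
    by (rule main[where g = sin])
      (use t1.Im_gamma_deriv t0.Im_gamma_deriv shift_w[OF assms] smooth_on_sin_real vertex[OF assms] in simp_all)
qed

definition dP :: "nat \<Rightarrow> real \<times> real \<Rightarrow> real" where "dP i p = P1 i p - P0 i p"
definition dA :: "nat \<Rightarrow> real \<times> real \<Rightarrow> real" where "dA i p = A1 i p - A0 i p"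
text \<open>Compares tangent angles at the two moving bounce points; the shift \<open>w i\<close>
  makes the difference 0 at \<open>p0\<close>.\<close>

definition dC :: "nat \<Rightarrow> real \<times> real \<Rightarrow> real" where "dC i p = (\<theta>1 (P1 i p) - w i) - \<theta>0 (P0 i p)"

lemmas smooth_P1 = t1.smooth_iterate(1) and smooth_A1 = t1.smooth_iterate(2)
  and smooth_P0 = t0.smooth_iterate(1) and smooth_A0 = t0.smooth_iterate(2)

lemma smooth_d: "smooth_on strip (dP i)" "smooth_on strip (dA i)" "smooth_on strip (dC i)"
  unfolding dP_def dA_def dC_def
  by (intro smooth_on_diff open_strip smooth_P1 smooth_P0 smooth_A1 smooth_A0
      smooth_on_compose[OF open_strip smooth_theta(1)] smooth_on_compose[OF open_strip smooth_theta(2)])+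

text \<open>This is where \<open>e\<close> enters: the perturbed angle function contributes its n-th
  derivative times first derivatives of the bounce point, and the displacement of the bounce point
  contributes through the unperturbed curvature.\<close>

lemma dC_lead:
  assumes i: "i \<le> N" and k: "k \<le> n" and v: "vanishes k p0 (dP i)"
  shows "vanishes k p0 (dC i)"
    "k = n \<Longrightarrow> length vs = n \<Longrightarrow> iter_deriv vs (dC i) p0 =
      e i * prod_list (map (\<lambda>v. dir_deriv v (P1 i) p0) vs) + curvature \<gamma>0 (s i) * iter_deriv vs (dP i) p0"
proof -
  have psi: "vanishes k (s i) (\<lambda>x. (\<theta>1 x - w i) - \<theta>0 x)"
    using vanishes_mono[OF vanishes_psi[OF i] k] by (simp add: \<psi>_def[abs_def])
  have vP: "vanishes k p0 (\<lambda>x. P1 i x - P0 i x)" using v by (simp add: dP_def[abs_def])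
  have at: "P1 i p0 = s i" "P0 i p0 = s i" using at_p0[OF i] by simp_all
  note pc = sp.perturbed_compose[OF smooth_theta(1,2) smooth_P1 smooth_P0 at psi vP]
  show "vanishes k p0 (dC i)" using pc(2) by (simp add: dC_def[abs_def])
  show "iter_deriv vs (dC i) p0 =
      e i * prod_list (map (\<lambda>v. dir_deriv v (P1 i) p0) vs) + curvature \<gamma>0 (s i) * iter_deriv vs (dP i) p0"
    if kn: "k = n" "length vs = n"
  proof -
    have "vs \<noteq> []" using kn n by auto
    then show ?thesis
      using pc(3)[of vs] kn iter_deriv_psi[OF i] dir_deriv_eqI[OF t0.tangent_angle(1)]
      by (simp add: dC_def[abs_def] dP_def[abs_def] \<psi>_def[abs_def])
  qed
qed

text \<open>The reflection laws of both tables are additive up to constants; these and the shifts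
  \<open>w\<close> cancel, since all the differences involved vanish at \<open>p0\<close>.\<close>

lemma dA_Suc:
  assumes i: "i < N" and p: "p \<in> strip"
  shows "dA (Suc i) p = dC (Suc i) p - dC i p - dA i p"
proof -
  obtain c0 where c0: "\<And>p. p \<in> strip \<Longrightarrow> snd (billiard_map \<gamma>0 p) = \<theta>0 (fst (billiard_map \<gamma>0 p)) - \<theta>0 (fst p) - snd p + c0"
    using t0.snd_billiard_map_const by blast
  obtain c1 where c1: "\<And>p. p \<in> strip \<Longrightarrow> snd (billiard_map \<gamma>1 p) = \<theta>1 (fst (billiard_map \<gamma>1 p)) - \<theta>1 (fst p) - snd p + c1"
    using t1.snd_billiard_map_const by blast
  have e: "dA (Suc i) p = dC (Suc i) p - dC i p - dA i p + (w (Suc i) - w i + c1 - c0)" if p: "p \<in> strip" for p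
    using c0[OF t0.iterate_strip[OF p], of i] c1[OF t1.iterate_strip[OF p], of i]
    by (simp add: dA_def dC_def)
  have "w (Suc i) - w i + c1 - c0 = 0"
  proof -
    have "dA (Suc i) p0 = 0" "dC (Suc i) p0 = 0" "dC i p0 = 0" "dA i p0 = 0"
      using at_p0[of i] at_p0[of "Suc i"] i by (simp_all add: dA_def dC_def w_def del: funpow.simps)
    then show ?thesis using e[OF p0_strip] by simp
  qed
  then show ?thesis using e[OF p] by simp
qed

text \<open>The coefficients in \<open>implicit_chord_lead\<close> are the cross products of the ray
  with the tangents at its ends, sin \<phi>' and - sin \<phi>, and the length of the chord along the
  ray.\<close>

lemma dP_Suc_lead:
  assumes i: "i < N" and k: "1 \<le> k" "k \<le> n" and vs: "length vs = k"
    and v: "vanishes k p0 (dP (Suc i))" "vanishes k p0 (dP i)" "vanishes k p0 (dA i)"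
  shows "sin (\<phi> (Suc i)) * iter_deriv vs (dP (Suc i)) p0 =
    - sin (\<phi> i) * iter_deriv vs (dP i) p0 +
    cmod (\<gamma>0 (s (Suc i)) - \<gamma>0 (s i)) * (iter_deriv vs (dC i) p0 + iter_deriv vs (dA i) p0)"
proof -
  have i': "i \<le> N" "Suc i \<le> N" using i by auto
  define b where "b = \<theta>0 (s i) + \<phi> i"
  define L where "L = cmod (\<gamma>0 (s (Suc i)) - \<gamma>0 (s i))"
  have st: "(s i, \<phi> i) \<in> strip" using at_p0[OF i'(1)] by simp
  have len: "t0.len (s i, \<phi> i) = L" using i by (simp add: t0.len_def map_orbit L_def)
  have ch: "\<gamma>0 (s (Suc i)) - \<gamma>0 (s i) = of_real L * cis b"
    using t0.len_chord(1)[OF st] i by (simp add: map_orbit b_def len)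
  have "cis (\<phi> (Suc i)) = cis (\<theta>0 (s (Suc i)) - b)"
    using t0.billiard_map_step[OF st] i by (simp add: t0.step_def map_orbit b_def algebra_simps)
  from arg_cong[OF this, of Im] have sin1: "sin (\<phi> (Suc i)) = sin (\<theta>0 (s (Suc i)) - b)" by simp
  have at: "P1 (Suc i) p0 = s (Suc i)" "P0 (Suc i) p0 = s (Suc i)" "P1 i p0 = s i" "P0 i p0 = s i"
    using at_p0[OF i'(1)] at_p0[OF i'(2)] by (simp_all del: funpow.simps)
  have B0: "\<theta>0 (P0 i p0) + A0 i p0 = b" using at_p0[OF i'(1)] by (simp add: b_def)
  have smB: "smooth_on strip (\<lambda>p. (\<theta>1 (P1 i p) - w i) + A1 i p)" "smooth_on strip (\<lambda>p. \<theta>0 (P0 i p) + A0 i p)"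
    by (intro smooth_on_add open_strip smooth_A1 smooth_A0 smooth_on_compose[OF open_strip smooth_theta(1)]
        smooth_on_compose[OF open_strip smooth_theta(2)] smooth_P1 smooth_P0)+
  have dB: "(\<lambda>p. ((\<theta>1 (P1 i p) - w i) + A1 i p) - (\<theta>0 (P0 i p) + A0 i p)) = (\<lambda>p. dC i p + dA i p)"
    by (auto simp: dC_def dA_def)
  have vB: "vanishes k p0 (\<lambda>p. ((\<theta>1 (P1 i p) - w i) + A1 i p) - (\<theta>0 (P0 i p) + A0 i p))"
    unfolding dB by (rule sp.vanishes_add[OF smooth_d(3,2) dC_lead(1)[OF i'(1) k(2) v(2)] v(3)])
  have eq1: "(Im (\<gamma>1 (P1 (Suc i) x)) - Im (\<gamma>1 (P1 i x))) * cos ((\<theta>1 (P1 i x) - w i) + A1 i x) -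
      (Re (\<gamma>1 (P1 (Suc i) x)) - Re (\<gamma>1 (P1 i x))) * sin ((\<theta>1 (P1 i x) - w i) + A1 i x) = 0" if "x \<in> strip" for x
  proof -
    have "cos ((\<theta>1 (P1 i x) - w i) + A1 i x) = cos (\<theta>1 (P1 i x) + A1 i x)"
      "sin ((\<theta>1 (P1 i x) - w i) + A1 i x) = sin (\<theta>1 (P1 i x) + A1 i x)"
      using shift_w[OF i'(1), of "\<theta>1 (P1 i x) + A1 i x"] by (simp_all add: algebra_simps)
    then show ?thesis
      using t1.chord_equation[OF t1.iterate_strip[OF that, of i]] by simp
  qed
  have eq0: "(Im (\<gamma>0 (P0 (Suc i) x)) - Im (\<gamma>0 (P0 i x))) * cos (\<theta>0 (P0 i x) + A0 i x) -
      (Re (\<gamma>0 (P0 (Suc i) x)) - Re (\<gamma>0 (P0 i x))) * sin (\<theta>0 (P0 i x) + A0 i x) = 0" if "x \<in> strip" for x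
    using t0.chord_equation[OF t0.iterate_strip[OF that, of i]] by simp
  have "(dir_deriv 1 (\<lambda>x. Im (\<gamma>0 x)) (s (Suc i)) * cos b - dir_deriv 1 (\<lambda>x. Re (\<gamma>0 x)) (s (Suc i)) * sin b) *
      iter_deriv vs (dP (Suc i)) p0 =
    (dir_deriv 1 (\<lambda>x. Im (\<gamma>0 x)) (s i) * cos b - dir_deriv 1 (\<lambda>x. Re (\<gamma>0 x)) (s i) * sin b) *
      iter_deriv vs (dP i) p0 +
    ((Im (\<gamma>0 (s (Suc i))) - Im (\<gamma>0 (s i))) * sin b + (Re (\<gamma>0 (s (Suc i))) - Re (\<gamma>0 (s i))) * cos b) *
      iter_deriv vs (\<lambda>p. dC i p + dA i p) p0"
    unfolding B0[symmetric] dB[symmetric] dP_def[abs_def]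
    by (rule sp.implicit_chord_lead[OF t1.smooth_Re_gamma t0.smooth_Re_gamma t1.smooth_Im_gamma t0.smooth_Im_gamma
          smooth_P1 smooth_P0 smooth_P1 smooth_P0 smB at vs _ v(1,2)[unfolded dP_def[abs_def]] vB
          vanishes_mono[OF vanishes_position(1)[OF i'(2)]] vanishes_mono[OF vanishes_position(2)[OF i'(2)]]
          vanishes_mono[OF vanishes_position(1)[OF i'(1)]] vanishes_mono[OF vanishes_position(2)[OF i'(1)]] eq1 eq0])
      (use k vs in auto)
  moreover have "dir_deriv 1 (\<lambda>x. Im (\<gamma>0 x)) x = sin (\<theta>0 x)" "dir_deriv 1 (\<lambda>x. Re (\<gamma>0 x)) x = cos (\<theta>0 x)" for x
    by (rule dir_deriv_eqI, rule t0.Im_gamma_deriv t0.Re_gamma_deriv)+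
  moreover have "sin (\<theta>0 (s (Suc i))) * cos b - cos (\<theta>0 (s (Suc i))) * sin b = sin (\<phi> (Suc i))"
    by (simp add: sin1 sin_diff)
  moreover have "sin (\<theta>0 (s i)) * cos b - cos (\<theta>0 (s i)) * sin b = - sin (\<phi> i)"
    using sin_diff[of "\<theta>0 (s i)" b] by (simp add: b_def)
  moreover have "(Im (\<gamma>0 (s (Suc i))) - Im (\<gamma>0 (s i))) * sin b + (Re (\<gamma>0 (s (Suc i))) - Re (\<gamma>0 (s i))) * cos b = L"
  proof -
    have "(Im (\<gamma>0 (s (Suc i))) - Im (\<gamma>0 (s i))) = L * sin b" "(Re (\<gamma>0 (s (Suc i))) - Re (\<gamma>0 (s i))) = L * cos b"
      using arg_cong[OF ch, of Im] arg_cong[OF ch, of Re] by simp_all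
    then have "(Im (\<gamma>0 (s (Suc i))) - Im (\<gamma>0 (s i))) * sin b + (Re (\<gamma>0 (s (Suc i))) - Re (\<gamma>0 (s i))) * cos b =
      L * ((sin b)\<^sup>2 + (cos b)\<^sup>2)" by (simp only: power2_eq_square distrib_left mult.assoc)
    then show ?thesis by simp
  qed
  moreover have "iter_deriv vs (\<lambda>p. dC i p + dA i p) p0 = iter_deriv vs (dC i) p0 + iter_deriv vs (dA i) p0"
    by (rule iter_deriv_add[OF open_strip smooth_d(3,2) p0_strip])
  ultimately show ?thesis by (simp add: L_def)
qed

text \<open>Induction along the orbit, and inside it on the order: once \<open>dP (Suc i)\<close>
  vanishes to order k, \<open>dP_Suc_lead\<close> expresses its k-th derivatives by differences at i
  that are already known to be flat. The reflection law then settles \<open>dA\<close>.\<close>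

lemma vanishes_d: "i \<le> N \<Longrightarrow> vanishes n p0 (dP i) \<and> vanishes n p0 (dA i)"
proof (induction i)
  case 0
  have "dP 0 = (\<lambda>x. 0)" "dA 0 = (\<lambda>x. 0)" by (auto simp: dP_def dA_def)
  then show ?case by (simp add: vanishes_zero)
next
  case (Suc i)
  then have i: "i < N" and IH: "vanishes n p0 (dP i)" "vanishes n p0 (dA i)" by auto
  have sin1: "sin (\<phi> (Suc i)) \<noteq> 0"
    using t0.sin_pos[OF at_p0(3)[OF Suc.prems]] by simp
  have P: "Suc k \<le> n \<Longrightarrow> vanishes (Suc k) p0 (dP (Suc i))" for k
  proof (induction k)
    case 0
    have "dP (Suc i) p0 = 0" using at_p0[OF Suc.prems] by (simp add: dP_def del: funpow.simps)
    then show ?case using vanishes_one by simp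
  next
    case (Suc k)
    show ?case
    proof (rule vanishes_SucI)
      show vk: "vanishes (Suc k) p0 (dP (Suc i))" using Suc by simp
      fix vs :: "(real \<times> real) list" assume vs: "length vs = Suc k"
      have kn: "1 \<le> Suc k" "Suc k \<le> n" "Suc (Suc k) \<le> n" using Suc.prems by auto
      have "iter_deriv vs (dP i) p0 = 0" "iter_deriv vs (dA i) p0 = 0" "iter_deriv vs (dC i) p0 = 0"
        using IH dC_lead(1)[OF less_imp_le[OF i] order_refl IH(1)] vs kn(3) by (simp_all add: vanishes_def)
      then have "sin (\<phi> (Suc i)) * iter_deriv vs (dP (Suc i)) p0 = 0"
        using dP_Suc_lead[OF i kn(1,2) vs vk vanishes_mono[OF IH(1) kn(2)] vanishes_mono[OF IH(2) kn(2)]] by simp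
      then show "iter_deriv vs (dP (Suc i)) p0 = 0" using sin1 by simp
    qed
  qed
  have P: "vanishes n p0 (dP (Suc i))" using P[of "n - 1"] n by simp
  have "vanishes n p0 (\<lambda>p. dC (Suc i) p - dC i p - dA i p)"
    by (intro sp.vanishes_diff smooth_on_diff open_strip smooth_d IH(2) dC_lead(1)[OF _ order_refl] P IH(1) Suc.prems less_imp_le[OF i])
  then have "vanishes n p0 (dA (Suc i))"
    using sp.vanishes_cong[OF smooth_d(2), of "Suc i" "\<lambda>p. dC (Suc i) p - dC i p - dA i p" n] dA_Suc[OF i] by simp
  with P show ?case by simp
qed

text \<open>The n-th derivatives of the differences obey the linearised map with a source at each
  bounce, and \<open>orbit_prop_source\<close> sums up the transported sources.\<close>

lemma jet_difference:
  assumes vs: "length vs = n" and e0: "e 0 = 0" "e N = 0"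
  shows "(iter_deriv vs (P1 N) p0 - iter_deriv vs (P0 N) p0, iter_deriv vs (A1 N) p0 - iter_deriv vs (A0 N) p0) =
    (\<Sum>i\<in>{1..N}. (2 * (e i * prod_list (map (\<lambda>v. dir_deriv v (P1 i) p0) vs))) *\<^sub>R
      orbit_prop (\<lambda>i. curvature \<gamma>0 (s i)) (\<lambda>i. sin (\<phi> i)) (\<lambda>i. cmod (\<gamma>0 (s (Suc i)) - \<gamma>0 (s i))) i (N - i) (0, 1))"
proof -
  define K where "K = (\<lambda>i. curvature \<gamma>0 (s i))"
  define S where "S = (\<lambda>i. sin (\<phi> i))"
  define L where "L = (\<lambda>i. cmod (\<gamma>0 (s (Suc i)) - \<gamma>0 (s i)))"
  define E where "E = (\<lambda>i. e i * prod_list (map (\<lambda>v. dir_deriv v (P1 i) p0) vs))"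
  define x where "x = (\<lambda>i. iter_deriv vs (dP i) p0)"
  define y where "y = (\<lambda>i. iter_deriv vs (dA i) p0)"
  define z where "z = (\<lambda>i. (x i, y i + E i))"
  \<comment> \<open>With the second coordinate of \<open>z\<close> shifted by E, the departure share
    of the source joins the arrival share, which gives the source 2 E. As E is 0 at both ends,
    \<open>z\<close> starts at 0 and ends at the true jet difference.\<close>
  have C: "iter_deriv vs (dC i) p0 = E i + K i * x i" if "i \<le> N" for i
    using dC_lead(2)[OF that order_refl _ refl vs] vanishes_d[OF that] by (simp add: E_def K_def x_def)
  have rec: "z (Suc i) = orbit_jac K S L i (z i) + (0, 2 * E (Suc i))" if i: "i < N" for i
  proof -
    have i': "i \<le> N" "Suc i \<le> N" using i by auto
    have S1: "S (Suc i) \<noteq> 0" using t0.sin_pos[OF at_p0(3)[OF i'(2)]] by (simp add: S_def)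
    have "S (Suc i) * x (Suc i) = - S i * x i + L i * ((E i + K i * x i) + y i)"
      using dP_Suc_lead[OF i n order_refl vs] vanishes_d[OF i'(1)] vanishes_d[OF i'(2)] C[OF i'(1)]
      by (simp add: x_def y_def S_def L_def)
    then have x': "x (Suc i) = ((K i * L i - S i) * x i + L i * (y i + E i)) / S (Suc i)"
      using S1 by (simp add: field_simps)
    have "y (Suc i) = iter_deriv vs (\<lambda>p. dC (Suc i) p - dC i p - dA i p) p0"
      unfolding y_def by (rule iter_deriv_cong[OF open_strip smooth_d(2) dA_Suc[OF i] p0_strip])
    also have "\<dots> = iter_deriv vs (dC (Suc i)) p0 - iter_deriv vs (dC i) p0 - y i"
      unfolding y_def
      by (simp add: iter_deriv_diff[OF open_strip smooth_on_diff[OF open_strip smooth_d(3) smooth_d(3)] smooth_d(2) p0_strip]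
          iter_deriv_diff[OF open_strip smooth_d(3) smooth_d(3) p0_strip])
    finally have "y (Suc i) = E (Suc i) + K (Suc i) * x (Suc i) - (E i + K i * x i) - y i"
      by (simp add: C i')
    then show ?thesis
      using x' by (simp add: z_def orbit_jac_def Let_def)
  qed
  have "dP 0 = (\<lambda>x. 0)" "dA 0 = (\<lambda>x. 0)" by (auto simp: dP_def dA_def)
  then have "z 0 = 0"
    using vanishes_zero[of "Suc n" p0] vs e0(1) by (simp add: z_def x_def y_def E_def vanishes_def zero_prod_def)
  from orbit_prop_source[OF this rec order_refl]
  have "z N = (\<Sum>i\<in>{1..N}. (2 * E i) *\<^sub>R orbit_prop K S L i (N - i) (0, 1))" .
  moreover have "z N = (iter_deriv vs (P1 N) p0 - iter_deriv vs (P0 N) p0, iter_deriv vs (A1 N) p0 - iter_deriv vs (A0 N) p0)"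
    using e0(2) iter_deriv_diff[OF open_strip smooth_P1 smooth_P0 p0_strip] iter_deriv_diff[OF open_strip smooth_A1 smooth_A0 p0_strip]
    by (simp add: z_def x_def y_def E_def dP_def[abs_def] dA_def[abs_def])
  ultimately show ?thesis by (simp add: E_def K_def S_def L_def)
qed

text \<open>Perturbed curvatures, but chord lengths of the unperturbed table: the vertices are
  common.\<close>

lemma dir_deriv_P1:
  assumes "i \<le> N"
  shows "dir_deriv v (P1 i) p0 =
    fst (orbit_prop (\<lambda>i. curvature \<gamma>1 (s i)) (\<lambda>i. sin (\<phi> i)) (\<lambda>i. cmod (\<gamma>0 (s (Suc i)) - \<gamma>0 (s i))) 0 i v)"
proof -
  have "((billiard_map \<gamma>1 ^^ i) has_derivative
      orbit_prop (\<lambda>i. curvature \<gamma>1 (s i)) (\<lambda>i. sin (\<phi> i)) (\<lambda>i. cmod (\<gamma>1 (s (Suc i)) - \<gamma>1 (s i))) 0 i) (at p0)"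
    using t1.orbit_iterate_has_derivative(3)[OF orbit1 phi0, of 0 i] assms by simp
  from dir_deriv_unique[OF has_derivative_fst[OF this]]
  have "dir_deriv v (P1 i) p0 =
    fst (orbit_prop (\<lambda>i. curvature \<gamma>1 (s i)) (\<lambda>i. sin (\<phi> i)) (\<lambda>i. cmod (\<gamma>1 (s (Suc i)) - \<gamma>1 (s i))) 0 i v)" .
  also have "\<dots> = fst (orbit_prop (\<lambda>i. curvature \<gamma>1 (s i)) (\<lambda>i. sin (\<phi> i)) (\<lambda>i. cmod (\<gamma>0 (s (Suc i)) - \<gamma>0 (s i))) 0 i v)"
    using assms by (subst orbit_prop_cong) (auto simp: vertex)
  finally show ?thesis .
qed

end

section \<open>Independence of the jet coordinates\<close>

lemma iterated_deriv_zero_near: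
  fixes h :: "real \<Rightarrow> real"
  assumes "open W" "\<And>x. x \<in> W \<Longrightarrow> h x = 0"
  shows "x \<in> W \<Longrightarrow> (deriv ^^ j) h x = 0"
proof (induction j arbitrary: x)
  case (Suc j)
  have "((\<lambda>x. 0) has_real_derivative 0) (at x)" by simp
  then have "((deriv ^^ j) h has_real_derivative 0) (at x)"
    by (rule has_field_derivative_transform_within_open[OF _ assms(1) Suc.prems]) (use Suc.IH in simp)
  then show ?case by (simp add: DERIV_imp_deriv)
qed (use assms in simp)

text \<open>Only continuity of the coefficients at \<open>0\<close> is needed, since they are multiplied by the
  coordinates of the argument.\<close>

lemma has_derivative_linear_continuous_coeff:
  fixes F :: "real ^ 'n \<Rightarrow> real ^ 'm" and G :: "'m \<Rightarrow> 'n \<Rightarrow> real ^ 'n \<Rightarrow> real"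
  assumes U: "open U" "0 \<in> U"
    and F: "\<And>\<epsilon> r. \<epsilon> \<in> U \<Longrightarrow> F \<epsilon> $ r = F 0 $ r + (\<Sum>q\<in>UNIV. \<epsilon> $ q * G r q \<epsilon>)"
    and G: "\<And>r q. isCont (G r q) 0"
  shows "(F has_derivative (\<lambda>h. (\<chi> r q. G r q 0) *v h)) (at 0)"
proof -
  have 1: "((\<lambda>\<epsilon>. \<epsilon> $ q * g \<epsilon>) has_derivative (\<lambda>h. h $ q * g 0)) (at 0)" if g: "isCont g 0"
    for g :: "real ^ 'n \<Rightarrow> real" and q
    unfolding has_derivative_at
  proof (intro conjI)
    show "bounded_linear (\<lambda>h. h $ q * g 0)"
      by (intro bounded_linear_mult_const bounded_linear_vec_nth)
    have "((\<lambda>h. \<bar>g h - g 0\<bar>) \<longlongrightarrow> 0) (at 0)"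
      using g unfolding isCont_def by (metis LIM_zero_iff tendsto_rabs_zero_iff)
    then show "(\<lambda>h. norm ((0 + h) $ q * g (0 + h) - 0 $ q * g 0 - h $ q * g 0) / norm h) \<midarrow>0\<rightarrow> 0"
    proof (rule Lim_null_comparison[rotated])
      show "\<forall>\<^sub>F h in at 0. norm (norm ((0 + h) $ q * g (0 + h) - 0 $ q * g 0 - h $ q * g 0) / norm h) \<le> \<bar>g h - g 0\<bar>"
      proof (rule eventually_at_filter[THEN iffD2], intro always_eventually allI impI)
        fix h :: "real ^ 'n" assume "h \<noteq> 0"
        have "norm ((0 + h) $ q * g (0 + h) - 0 $ q * g 0 - h $ q * g 0) = \<bar>h $ q\<bar> * \<bar>g h - g 0\<bar>"
          by (simp add: abs_mult[symmetric] algebra_simps)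
        also have "\<dots> \<le> norm h * \<bar>g h - g 0\<bar>"
          by (intro mult_right_mono component_le_norm_cart) auto
        finally show "norm (norm ((0 + h) $ q * g (0 + h) - 0 $ q * g 0 - h $ q * g 0) / norm h) \<le> \<bar>g h - g 0\<bar>"
          using \<open>h \<noteq> 0\<close> by (simp add: divide_le_eq mult.commute)
      qed
    qed
  qed
  have comp: "((\<lambda>\<epsilon>. F \<epsilon> $ r) has_derivative (\<lambda>h. ((\<chi> r q. G r q 0) *v h) $ r)) (at 0)" for r
  proof -
    have "((\<lambda>\<epsilon>. F 0 $ r + (\<Sum>q\<in>UNIV. \<epsilon> $ q * G r q \<epsilon>)) has_derivative (\<lambda>h. 0 + (\<Sum>q\<in>UNIV. h $ q * G r q 0))) (at 0)"
      by (intro has_derivative_add has_derivative_const has_derivative_sum 1 G)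
    then have "((\<lambda>\<epsilon>. F \<epsilon> $ r) has_derivative (\<lambda>h. 0 + (\<Sum>q\<in>UNIV. h $ q * G r q 0))) (at 0)"
      by (rule has_derivative_transform_within_open[OF _ U]) (simp add: F)
    then show ?thesis by (simp add: matrix_vector_mult_def mult.commute)
  qed
  show ?thesis
    unfolding has_derivative_componentwise_within[of F]
  proof
    fix i :: "real ^ 'm" assume "i \<in> Basis"
    then obtain r where "i = axis r 1" by (auto simp: Basis_vec_def)
    then show "((\<lambda>x. F x \<bullet> i) has_derivative (\<lambda>x. ((\<chi> r q. G r q 0) *v x) \<bullet> i)) (at 0)"
      using comp[of r] by (simp add: inner_axis)
  qed
qed

text \<open>Along k directions (0, 1) and l directions (1, 0) the product of first derivatives
  becomes \<open>c ^ k * a ^ l\<close>. The term of the last vertex drops since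
  \<open>e N = 0\<close>, which leaves one term per coordinate.\<close>

lemma (in billiard_pair) jet_vector_diff:
  fixes ix :: "'m::finite \<Rightarrow> nat"
  assumes NN: "N = n + 3" and ix: "bij_betw ix UNIV {1..n + 2}" and e0: "e 0 = 0" "e N = 0"
  defines "S \<equiv> \<lambda>i. sin (\<phi> i)" and "L \<equiv> \<lambda>i. cmod (\<gamma>0 (s (Suc i)) - \<gamma>0 (s i))"
  defines "bd \<equiv> \<lambda>i. orbit_prop (\<lambda>i. curvature \<gamma>0 (s i)) S L i (N - i) (0, 1)"
    and "a \<equiv> \<lambda>i. fst (orbit_prop (\<lambda>i. curvature \<gamma>1 (s i)) S L 0 i (1, 0))"
    and "c \<equiv> \<lambda>i. fst (orbit_prop (\<lambda>i. curvature \<gamma>1 (s i)) S L 0 i (0, 1))"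
  shows "jet_vector n ix \<gamma>1 p0 $ r = jet_vector n ix \<gamma>0 p0 $ r +
    (\<Sum>q\<in>UNIV. e (ix q) * (2 * (if ix r \<le> n + 1
       then fst (bd (ix q)) * (c (ix q) ^ (ix r - 1) * a (ix q) ^ (n + 1 - ix r))
       else snd (bd (ix q)) * a (ix q) ^ n)))"
proof -
  have ixr: "1 \<le> ix r" "ix r \<le> n + 2" using ix by (auto simp: bij_betw_def)
  have diff: "(iter_deriv vs (P1 N) p0 - iter_deriv vs (P0 N) p0, iter_deriv vs (A1 N) p0 - iter_deriv vs (A0 N) p0) =
     (\<Sum>q\<in>UNIV. (2 * (e (ix q) * (c (ix q) ^ k * a (ix q) ^ l))) *\<^sub>R bd (ix q))"
    if vs: "vs = replicate k (0, 1) @ replicate l (1, 0)" and kl: "k + l = n" for vs k l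
  proof -
    have len: "length vs = n" using vs kl by simp
    have "(iter_deriv vs (P1 N) p0 - iter_deriv vs (P0 N) p0, iter_deriv vs (A1 N) p0 - iter_deriv vs (A0 N) p0) =
      (\<Sum>i\<in>{1..N}. (2 * (e i * prod_list (map (\<lambda>v. dir_deriv v (P1 i) p0) vs))) *\<^sub>R bd i)"
      using jet_difference[OF len e0] by (simp add: bd_def S_def L_def)
    also have "\<dots> = (\<Sum>i\<in>{1..N}. (2 * (e i * (c i ^ k * a i ^ l))) *\<^sub>R bd i)"
    proof (rule sum.cong[OF refl])
      fix i assume "i \<in> {1..N}"
      then have "dir_deriv (0, 1) (P1 i) p0 = c i" "dir_deriv (1, 0) (P1 i) p0 = a i"
        using dir_deriv_P1[of i] by (simp_all add: a_def c_def S_def L_def)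
      then show "(2 * (e i * prod_list (map (\<lambda>v. dir_deriv v (P1 i) p0) vs))) *\<^sub>R bd i =
          (2 * (e i * (c i ^ k * a i ^ l))) *\<^sub>R bd i"
        by (simp add: vs prod_list_replicate)
    qed
    also have "{1..N} = insert N {1..n + 2}" using NN by auto
    also have "(\<Sum>i\<in>insert N {1..n + 2}. (2 * (e i * (c i ^ k * a i ^ l))) *\<^sub>R bd i) =
        (\<Sum>i\<in>{1..n + 2}. (2 * (e i * (c i ^ k * a i ^ l))) *\<^sub>R bd i)"
      using NN e0 by simp
    also have "\<dots> = (\<Sum>q\<in>UNIV. (2 * (e (ix q) * (c (ix q) ^ k * a (ix q) ^ l))) *\<^sub>R bd (ix q))"
      by (rule sum.reindex_bij_betw[OF ix, symmetric])
    finally show ?thesis .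
  qed
  show ?thesis
  proof (cases "ix r \<le> n + 1")
    case True
    let ?vs = "replicate (ix r - 1) (0, 1) @ replicate (n + 1 - ix r) (1, 0) :: (real \<times> real) list"
    have j1: "jet_vector n ix \<gamma>1 p0 $ r = iter_deriv ?vs (P1 N) p0"
      using True by (simp add: jet_vector_def NN[symmetric] mixed_deriv_eq_iter_deriv[OF smooth_P1 p0_strip])
    have j0: "jet_vector n ix \<gamma>0 p0 $ r = iter_deriv ?vs (P0 N) p0"
      using True by (simp add: jet_vector_def NN[symmetric] mixed_deriv_eq_iter_deriv[OF smooth_P0 p0_strip])
    have "jet_vector n ix \<gamma>1 p0 $ r - jet_vector n ix \<gamma>0 p0 $ r =
        (\<Sum>q\<in>UNIV. 2 * (e (ix q) * (c (ix q) ^ (ix r - 1) * a (ix q) ^ (n + 1 - ix r))) * fst (bd (ix q)))"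
      using arg_cong[OF diff[OF refl, of "ix r - 1" "n + 1 - ix r"], of fst] True ixr
      by (simp add: j1 j0 fst_sum)
    also have "\<dots> = (\<Sum>q\<in>UNIV. e (ix q) * (2 * (fst (bd (ix q)) * (c (ix q) ^ (ix r - 1) * a (ix q) ^ (n + 1 - ix r)))))"
      by (intro sum.cong refl) (simp only: mult_ac)
    finally show ?thesis using True by simp
  next
    case False
    let ?vs = "replicate 0 (0, 1) @ replicate n (1, 0) :: (real \<times> real) list"
    have j1: "jet_vector n ix \<gamma>1 p0 $ r = iter_deriv ?vs (A1 N) p0"
      using False by (simp add: jet_vector_def NN[symmetric] mixed_deriv_eq_iter_deriv[OF smooth_A1 p0_strip])
    have j0: "jet_vector n ix \<gamma>0 p0 $ r = iter_deriv ?vs (A0 N) p0"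
      using False by (simp add: jet_vector_def NN[symmetric] mixed_deriv_eq_iter_deriv[OF smooth_A0 p0_strip])
    have "jet_vector n ix \<gamma>1 p0 $ r - jet_vector n ix \<gamma>0 p0 $ r =
        (\<Sum>q\<in>UNIV. 2 * (e (ix q) * (c (ix q) ^ 0 * a (ix q) ^ n)) * snd (bd (ix q)))"
      using arg_cong[OF diff[OF refl, of 0 n], of snd]
      by (simp add: j1 j0 snd_sum)
    also have "\<dots> = (\<Sum>q\<in>UNIV. e (ix q) * (2 * (snd (bd (ix q)) * a (ix q) ^ n)))"
      by (intro sum.cong refl) simp
    finally show ?thesis using False by simp
  qed
qed

theorem theorem2:
  fixes \<Omega> :: "complex set" and \<gamma> :: "real \<Rightarrow> complex" and n :: nat and ix :: "'m::finite \<Rightarrow> nat"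
  assumes "\<Omega> \<in> Dinf" and "arc_param \<Omega> \<gamma>"
    and "n \<ge> 1"
    and "bij_betw ix (UNIV :: 'm set) {1..n + 2}"
  shows "\<exists>\<delta>>0. \<forall>(s :: nat \<Rightarrow> real) (\<phi> :: nat \<Rightarrow> real).
    orbit_segment \<gamma> (n + 3) s \<phi> \<longrightarrow>
    (\<forall>i\<le>n + 3. \<forall>j\<le>n + 3. i \<noteq> j \<longrightarrow> s i - s j \<notin> \<int>) \<longrightarrow>
    (\<forall>i\<le>n + 3. 0 < \<phi> i \<and> \<phi> i < \<delta>) \<longrightarrow>
    (\<forall>i j. i < j \<and> j \<le> n + 3 \<longrightarrow>
       deriv (\<lambda>y. fst ((billiard_map \<gamma> ^^ (j - i)) (s i, y))) (\<phi> i) \<noteq> 0) \<longrightarrow>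
    (\<forall>(U :: (real ^ 'm) set) Om \<Gamma> (V :: nat \<Rightarrow> real set).
       let \<Delta>\<kappa> = (\<lambda>\<epsilon> x. curvature (\<Gamma> \<epsilon>) x - curvature \<gamma> x) in
       smooth_family U Om \<Gamma> \<longrightarrow> Om 0 = \<Omega> \<longrightarrow> \<Gamma> 0 = \<gamma> \<longrightarrow>
       fixes_orbit U \<Gamma> \<gamma> (n + 3) s \<phi> \<longrightarrow>
       (\<forall>i\<in>{1..n + 2}. circle_open (V i) \<and> s i \<in> V i \<and> s 0 \<notin> V i \<and> s (n + 3) \<notin> V i) \<longrightarrow>
       (\<forall>\<epsilon>\<in>U. closure {x. \<Delta>\<kappa> \<epsilon> x \<noteq> 0} \<subseteq> (\<Union>i\<in>{1..n + 2}. V i)) \<longrightarrow>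
       (\<forall>\<epsilon>\<in>U. \<forall>i\<in>{1..n + 2}. \<forall>j. j + 2 \<le> n \<longrightarrow> (deriv ^^ j) (\<Delta>\<kappa> \<epsilon>) (s i) = 0) \<longrightarrow>
       (\<forall>\<epsilon>\<in>U. \<forall>r. (deriv ^^ (n - 1)) (\<Delta>\<kappa> \<epsilon>) (s (ix r)) = \<epsilon> $ r) \<longrightarrow>
       (\<lambda>\<epsilon>. jet_vector n ix (\<Gamma> \<epsilon>) (s 0, \<phi> 0)) differentiable (at 0) \<and>
       det (jacobian (\<lambda>\<epsilon>. jet_vector n ix (\<Gamma> \<epsilon>) (s 0, \<phi> 0)) (at 0)) \<noteq> 0)"
proof -
  note n = \<open>n \<ge> 1\<close> and ix = \<open>bij_betw ix (UNIV :: 'm set) {1..n + 2}\<close>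
  define N where "N = n + 3"
  interpret b: billiard_table \<Omega> \<gamma> by unfold_locales (rule assms(2))
  obtain \<delta>1 where \<delta>1: "\<delta>1 > 0" and near: "\<And>p x y. p \<in> strip \<Longrightarrow> (\<forall>i<N. snd ((billiard_map \<gamma> ^^ i) p) < \<delta>1) \<Longrightarrow>
      x 0 = 1 \<Longrightarrow> y 0 = 0 \<Longrightarrow>
      (\<forall>i<N. x (Suc i) = b.jacobi ((billiard_map \<gamma> ^^ i) p) (x i, y i) \<and>
      y (Suc i) = curvature \<gamma> (fst ((billiard_map \<gamma> ^^ Suc i) p)) * x (Suc i) - curvature \<gamma> (fst ((billiard_map \<gamma> ^^ i) p)) * x i - y i)
      \<Longrightarrow> x N > 0"
    using b.near_boundary_derivative_pos[of N] by metis
  \<comment> \<open>The bound pi keeps the angles inside the strip, and \<open>\<delta>1\<close>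
    gives \<open>a N > 0\<close>.\<close>
  define \<delta> where "\<delta> = min \<delta>1 pi"
  have main: "(\<lambda>\<epsilon>. jet_vector n ix (\<Gamma> \<epsilon>) (s 0, \<phi> 0)) differentiable (at 0) \<and>
       det (jacobian (\<lambda>\<epsilon>. jet_vector n ix (\<Gamma> \<epsilon>) (s 0, \<phi> 0)) (at 0)) \<noteq> 0"
    if orbit: "orbit_segment \<gamma> (n + 3) s \<phi>"
      and small: "\<forall>i\<le>n + 3. 0 < \<phi> i \<and> \<phi> i < \<delta>"
      and twist: "\<forall>i j. i < j \<and> j \<le> n + 3 \<longrightarrow>
       deriv (\<lambda>y. fst ((billiard_map \<gamma> ^^ (j - i)) (s i, y))) (\<phi> i) \<noteq> 0"
      and fam: "smooth_family U Om \<Gamma>" and G0: "\<Gamma> 0 = \<gamma>"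
      and fix_orbit: "fixes_orbit U \<Gamma> \<gamma> (n + 3) s \<phi>"
      and V: "\<forall>i\<in>{1..n + 2}. circle_open (V i) \<and> s i \<in> V i \<and> s 0 \<notin> V i \<and> s (n + 3) \<notin> V i"
      and supp: "\<forall>\<epsilon>\<in>U. closure {x. curvature (\<Gamma> \<epsilon>) x - curvature \<gamma> x \<noteq> 0} \<subseteq> (\<Union>i\<in>{1..n + 2}. V i)"
      and low: "\<forall>\<epsilon>\<in>U. \<forall>i\<in>{1..n + 2}. \<forall>j. j + 2 \<le> n \<longrightarrow> (deriv ^^ j) (\<lambda>x. curvature (\<Gamma> \<epsilon>) x - curvature \<gamma> x) (s i) = 0"
      and top: "\<forall>\<epsilon>\<in>U. \<forall>r. (deriv ^^ (n - 1)) (\<lambda>x. curvature (\<Gamma> \<epsilon>) x - curvature \<gamma> x) (s (ix r)) = \<epsilon> $ r"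
    for s \<phi> and U :: "(real ^ 'm) set" and Om \<Gamma> V
  proof -
    define K where "K = (\<lambda>i. curvature \<gamma> (s i))"
    define S where "S = (\<lambda>i. sin (\<phi> i))"
    define L where "L = (\<lambda>i. cmod (\<gamma> (s (Suc i)) - \<gamma> (s i)))"
    define p0 where "p0 = (s 0, \<phi> 0)"
    have orb: "orbit_segment \<gamma> N s \<phi>" using orbit by (simp add: N_def)
    have ph: "0 < \<phi> i" "\<phi> i < pi" "\<phi> i < \<delta>1" if "i \<le> N" for i
      using small that by (auto simp: N_def \<delta>_def)
    have S: "S i > 0" if "i \<le> N" for i using ph[OF that] by (simp add: S_def sin_gt_zero)
    have S_ne: "S i \<noteq> 0" if "i \<le> N" for i using S[OF that] by simp
    note it = b.orbit_iterate_has_derivative[OF orb ph(1)[of 0] ph(2)[of 0], folded K_def S_def L_def]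
    have prop_ne: "fst (orbit_prop K S L i (j - i) (0, 1)) \<noteq> 0" if ij: "i < j" "j \<le> N" for i j
    proof -
      have "((billiard_map \<gamma> ^^ (j - i)) has_derivative orbit_prop K S L i (j - i)) (at (s i, \<phi> i))"
        using it(3)[of i "j - i"] ij by simp
      moreover have "((\<lambda>y. (s i, y)) has_derivative (\<lambda>t. (0, t))) (at (\<phi> i))"
        by (auto intro!: derivative_eq_intros)
      ultimately have D: "((\<lambda>y. (billiard_map \<gamma> ^^ (j - i)) (s i, y)) has_derivative (\<lambda>t. orbit_prop K S L i (j - i) (0, t))) (at (\<phi> i))"
        by (rule has_derivative_compose[rotated])
      have lin: "linear (\<lambda>t. fst (orbit_prop K S L i (j - i) (0, t)))"
        by (rule has_derivative_linear[OF has_derivative_fst[OF D]])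
      have "(\<lambda>t. fst (orbit_prop K S L i (j - i) (0, t))) = (*) (fst (orbit_prop K S L i (j - i) (0, 1)))"
      proof
        fix t
        show "fst (orbit_prop K S L i (j - i) (0, t)) = fst (orbit_prop K S L i (j - i) (0, 1)) * t"
          using linear.scaleR[OF lin, of t 1] by (simp add: mult.commute)
      qed
      with has_derivative_fst[OF D]
      have "((\<lambda>y. fst ((billiard_map \<gamma> ^^ (j - i)) (s i, y))) has_real_derivative fst (orbit_prop K S L i (j - i) (0, 1))) (at (\<phi> i))"
        by (simp add: has_field_derivative_def)
      then have "deriv (\<lambda>y. fst ((billiard_map \<gamma> ^^ (j - i)) (s i, y))) (\<phi> i) = fst (orbit_prop K S L i (j - i) (0, 1))"
        by (rule DERIV_imp_deriv)
      moreover have "deriv (\<lambda>y. fst ((billiard_map \<gamma> ^^ (j - i)) (s i, y))) (\<phi> i) \<noteq> 0"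
        using twist ij unfolding N_def by blast
      ultimately show ?thesis by simp
    qed
    define a where "a = (\<lambda>i. fst (orbit_prop K S L 0 i (1, 0)))"
    define a' where "a' = (\<lambda>i. snd (orbit_prop K S L 0 i (1, 0)))"
    define c where "c = (\<lambda>i. fst (orbit_prop K S L 0 i (0, 1)))"
    define c' where "c' = (\<lambda>i. snd (orbit_prop K S L 0 i (0, 1)))"
    define bd where "bd = (\<lambda>i. orbit_prop K S L i (N - i) (0, 1))"
    have wr0: "a i * c' i - a' i * c i = S 0 / S i" "S 0 / S i \<noteq> 0" if "i \<le> N" for i
    proof -
      have "wronskian (orbit_prop K S L 0 i (1, 0)) (orbit_prop K S L 0 i (0, 1)) = S 0 / S (0 + i) * wronskian (1, 0) (0, 1)"
        by (rule wronskian_orbit_prop) (use that S_ne in auto)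
      then show "a i * c' i - a' i * c i = S 0 / S i" by (simp add: wronskian_def a_def a'_def c_def c'_def)
      show "S 0 / S i \<noteq> 0" using S[of 0] S[OF that] by simp
    qed
    \<comment> \<open>Both vectors are compared at i first, where the Wronskian of (0, 1) with a
      vector is minus its first component, here \<open>a i\<close> or \<open>c i\<close>.\<close>
    have wr: "fst (orbit_prop K S L i (j - i) (0, 1)) * a' j - snd (orbit_prop K S L i (j - i) (0, 1)) * a j = - (S i / S j) * a i"
      "fst (orbit_prop K S L i (j - i) (0, 1)) * c' j - snd (orbit_prop K S L i (j - i) (0, 1)) * c j = - (S i / S j) * c i"
      if ij: "i \<le> j" "j \<le> N" for i j
    proof -
      have w: "wronskian (orbit_prop K S L i (j - i) (0, 1)) (orbit_prop K S L 0 j v) = - (S i / S j) * fst (orbit_prop K S L 0 i v)" for v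
      proof -
        have "orbit_prop K S L 0 j v = orbit_prop K S L i (j - i) (orbit_prop K S L 0 i v)"
          using orbit_prop_add[of K S L 0 i "j - i" v] ij by simp
        moreover have "wronskian (orbit_prop K S L i (j - i) (0, 1)) (orbit_prop K S L i (j - i) (orbit_prop K S L 0 i v)) =
            S i / S (i + (j - i)) * wronskian (0, 1) (orbit_prop K S L 0 i v)"
          by (rule wronskian_orbit_prop) (use ij S_ne in auto)
        ultimately show ?thesis using ij by (simp add: wronskian_def)
      qed
      show "fst (orbit_prop K S L i (j - i) (0, 1)) * a' j - snd (orbit_prop K S L i (j - i) (0, 1)) * a j = - (S i / S j) * a i"
        "fst (orbit_prop K S L i (j - i) (0, 1)) * c' j - snd (orbit_prop K S L i (j - i) (0, 1)) * c j = - (S i / S j) * c i"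
        using w[of "(1, 0)"] w[of "(0, 1)"] by (simp_all add: wronskian_def a_def a'_def c_def c'_def)
    qed
    have aN: "a N \<noteq> 0"
    proof -
      have itp: "(billiard_map \<gamma> ^^ i) p0 = (s i, \<phi> i)" if "i \<le> N" for i
        using it(2)[of 0 i] that by (simp add: p0_def)
      have "a N > 0"
      proof (rule near[of p0 a a'])
        show "p0 \<in> strip" using ph[of 0] by (simp add: p0_def mem_strip)
        show "\<forall>i<N. snd ((billiard_map \<gamma> ^^ i) p0) < \<delta>1" using itp ph by simp
        show "\<forall>i<N. a (Suc i) = b.jacobi ((billiard_map \<gamma> ^^ i) p0) (a i, a' i) \<and>
            a' (Suc i) = curvature \<gamma> (fst ((billiard_map \<gamma> ^^ Suc i) p0)) * a (Suc i) -
              curvature \<gamma> (fst ((billiard_map \<gamma> ^^ i) p0)) * a i - a' i"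
        proof (intro allI impI)
          fix i assume i: "i < N"
          have fi: "billiard_map \<gamma> (s i, \<phi> i) = (s (Suc i), \<phi> (Suc i))"
            using it(2)[of i 1] i by simp
          have "a (Suc i) = b.jacobi (s i, \<phi> i) (a i, a' i)"
            by (simp add: a_def a'_def orbit_jac_fst b.jacobi_def b.len_def fi K_def L_def S_def)
          moreover have "a' (Suc i) = K (Suc i) * a (Suc i) - K i * a i - a' i"
            by (simp add: a_def a'_def orbit_jac_snd)
          ultimately show "a (Suc i) = b.jacobi ((billiard_map \<gamma> ^^ i) p0) (a i, a' i) \<and>
            a' (Suc i) = curvature \<gamma> (fst ((billiard_map \<gamma> ^^ Suc i) p0)) * a (Suc i) -
              curvature \<gamma> (fst ((billiard_map \<gamma> ^^ i) p0)) * a i - a' i"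
            using itp[of i] itp[of "Suc i"] i by (simp add: K_def del: funpow.simps)
        qed
      qed (simp_all add: a_def a'_def)
      then show ?thesis by simp
    qed
    have U: "open U" "0 \<in> U" and arcs: "\<And>\<epsilon>. \<epsilon> \<in> U \<Longrightarrow> arc_param (Om \<epsilon>) (\<Gamma> \<epsilon>)"
      using fam by (auto simp: smooth_family_def)
    \<comment> \<open>The coordinates of \<epsilon> moved to their vertices and extended by 0 to the
      two end vertices.\<close>
    define e where "e = (\<lambda>\<epsilon> :: real ^ 'm. \<lambda>i. if i \<in> {1..n + 2} then \<epsilon> $ inv_into UNIV ix i else 0)"
    have e_ix: "e \<epsilon> (ix q) = \<epsilon> $ q" for \<epsilon> q
      using ix by (auto simp: e_def bij_betw_def)
    \<comment> \<open>The end vertices avoid all \<open>V i\<close> and hence the closed support, so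
      the curvature difference is 0 near them.\<close>
    have ends: "(deriv ^^ j) (\<lambda>x. curvature (\<Gamma> \<epsilon>) x - curvature \<gamma> x) (s i) = 0"
      if \<epsilon>: "\<epsilon> \<in> U" and i: "i = 0 \<or> i = N" for \<epsilon> i j
    proof (rule iterated_deriv_zero_near)
      show "open (- closure {x. curvature (\<Gamma> \<epsilon>) x - curvature \<gamma> x \<noteq> 0})" by (simp add: open_Compl)
      show "curvature (\<Gamma> \<epsilon>) x - curvature \<gamma> x = 0"
        if "x \<in> - closure {x. curvature (\<Gamma> \<epsilon>) x - curvature \<gamma> x \<noteq> 0}" for x
        using that closure_subset[of "{x. curvature (\<Gamma> \<epsilon>) x - curvature \<gamma> x \<noteq> 0}"] by blast
      have "s i \<notin> (\<Union>i\<in>{1..n + 2}. V i)" using V i by (auto simp: N_def)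
      then show "s i \<in> - closure {x. curvature (\<Gamma> \<epsilon>) x - curvature \<gamma> x \<noteq> 0}" using supp \<epsilon> by blast
    qed
    have low': "(deriv ^^ j) (\<lambda>x. curvature (\<Gamma> \<epsilon>) x - curvature \<gamma> x) (s i) = 0"
      if "\<epsilon> \<in> U" "i \<le> N" "j + 2 \<le> n" for \<epsilon> i j
    proof (cases "i \<in> {1..n + 2}")
      case True
      then show ?thesis using low that by blast
    next
      case False
      then have "i = 0 \<or> i = N" using that by (auto simp: N_def)
      then show ?thesis using ends that by blast
    qed
    have top': "(deriv ^^ (n - 1)) (\<lambda>x. curvature (\<Gamma> \<epsilon>) x - curvature \<gamma> x) (s i) = e \<epsilon> i"
      if "\<epsilon> \<in> U" "i \<le> N" for \<epsilon> i
    proof (cases "i \<in> {1..n + 2}")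
      case True
      then obtain q where "i = ix q" using ix by (metis bij_betw_imp_surj_on imageE)
      then show ?thesis using top that e_ix by simp
    next
      case False
      then have "i = 0 \<or> i = N" using that by (auto simp: N_def)
      moreover have "e \<epsilon> i = 0" using False by (auto simp: e_def)
      ultimately show ?thesis using ends[OF that(1)] by simp
    qed
    \<comment> \<open>For n = 1 the prescribed derivative is the curvature difference itself, so
      \<epsilon> moves the curvatures at the vertices; for larger n these stay fixed.\<close>
    define K' where "K' = (\<lambda>\<epsilon> i. K i + (if n = 1 then e \<epsilon> i else 0))"
    have K': "curvature (\<Gamma> \<epsilon>) (s i) = K' \<epsilon> i" if "\<epsilon> \<in> U" "i \<le> N" for \<epsilon> i
    proof (cases "n = 1")
      case True
      then show ?thesis using top'[OF that] by (simp add: K'_def K_def)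
    next
      case False
      then show ?thesis using low'[OF that, of 0] n by (simp add: K'_def K_def)
    qed
    define a1 where "a1 = (\<lambda>\<epsilon> i. fst (orbit_prop (K' \<epsilon>) S L 0 i (1, 0)))"
    define c1 where "c1 = (\<lambda>\<epsilon> i. fst (orbit_prop (K' \<epsilon>) S L 0 i (0, 1)))"
    \<comment> \<open>The powers of first derivatives belong to the perturbed table, the transport
      \<open>bd\<close> to the unperturbed one; this mixture makes the jet identity exact for every
      \<epsilon> in U.\<close>
    define G where "G = (\<lambda>r q \<epsilon>. 2 * (if ix r \<le> n + 1
       then fst (bd (ix q)) * (c1 \<epsilon> (ix q) ^ (ix r - 1) * a1 \<epsilon> (ix q) ^ (n + 1 - ix r))
       else snd (bd (ix q)) * a1 \<epsilon> (ix q) ^ n))"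
    have contK: "isCont (\<lambda>\<epsilon>. K' \<epsilon> j) 0" for j
    proof -
      have "isCont (\<lambda>\<epsilon>. e \<epsilon> j) 0"
        unfolding e_def by (cases "j \<in> {1..n + 2}") (simp_all only: if_True if_False continuous_component continuous_ident continuous_const)
      then show ?thesis
        unfolding K'_def by (cases "n = 1") (auto intro: continuous_intros)
    qed
    have contG: "isCont (G r q) 0" for r q
    proof -
      have ac: "isCont (\<lambda>\<epsilon>. a1 \<epsilon> i) 0" "isCont (\<lambda>\<epsilon>. c1 \<epsilon> i) 0" for i
        unfolding a1_def c1_def using isCont_orbit_prop[where K = K', OF contK] by blast+
      show ?thesis
        unfolding G_def
        by (cases "ix r \<le> n + 1"; simp only: if_True if_False;
            intro continuous_mult continuous_power continuous_const ac)
    qed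
    have jet: "jet_vector n ix (\<Gamma> \<epsilon>) (s 0, \<phi> 0) $ r =
        jet_vector n ix (\<Gamma> 0) (s 0, \<phi> 0) $ r + (\<Sum>q\<in>UNIV. \<epsilon> $ q * G r q \<epsilon>)" if \<epsilon>: "\<epsilon> \<in> U" for \<epsilon> r
    proof -
      interpret pair: billiard_pair \<Omega> \<gamma> "Om \<epsilon>" "\<Gamma> \<epsilon>" n N s \<phi> "e \<epsilon>"
        by unfold_locales
          (use n orb ph[of 0] arcs[OF \<epsilon>] fix_orbit \<epsilon> low'[OF \<epsilon>] top'[OF \<epsilon>] in \<open>auto simp: fixes_orbit_def N_def\<close>)
      have K1: "orbit_prop (\<lambda>i. curvature (\<Gamma> \<epsilon>) (s i)) S L 0 (ix q) v = orbit_prop (K' \<epsilon>) S L 0 (ix q) v" for q v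
      proof (rule orbit_prop_cong_curvature)
        have "ix q \<in> {1..n + 2}" using ix by (auto simp: bij_betw_def)
        then show "curvature (\<Gamma> \<epsilon>) (s j) = K' \<epsilon> j" if "j \<le> 0 + ix q" for j
          using that by (intro K'[OF \<epsilon>]) (auto simp: N_def)
      qed
      have "e \<epsilon> 0 = 0" "e \<epsilon> N = 0" by (simp_all add: e_def N_def)
      from pair.jet_vector_diff[OF N_def ix this, of r, folded S_def L_def K_def, unfolded K1]
      show ?thesis
        unfolding G0 G_def a1_def c1_def bd_def e_ix .
    qed
    have D: "((\<lambda>\<epsilon>. jet_vector n ix (\<Gamma> \<epsilon>) (s 0, \<phi> 0)) has_derivative (\<lambda>h. (\<chi> r q. G r q 0) *v h)) (at 0)"
      by (rule has_derivative_linear_continuous_coeff[OF U jet contG])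
    have K'0: "K' 0 = K" by (auto simp: K'_def e_def)
    have range: "i \<le> N" "0 < i" "i < N" if "i \<in> {1..n + 2}" for i
      using that by (auto simp: N_def)
    have "det (\<chi> r q. 2 * (if ix r \<le> n + 1 then fst (bd (ix q)) * (c (ix q) ^ (ix r - 1) * a (ix q) ^ (n + 1 - ix r))
        else snd (bd (ix q)) * a (ix q) ^ n) :: real ^ 'm ^ 'm) \<noteq> 0"
    proof (rule det_jet_matrix_nonzero[OF ix, where A = "a N" and B = "c N" and C = "a' N" and D = "c' N"])
      show "fst (bd i) \<noteq> 0" if "i \<in> {1..n + 2}" for i
        using prop_ne[of i N] range[OF that] by (simp add: bd_def)
      show "c i \<noteq> 0" if "i \<in> {1..n + 2}" for i
        using prop_ne[of 0 i] range[OF that] by (simp add: c_def)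
      \<comment> \<open>The two identities \<open>wr\<close> at N share the factor
        \<open>S i / S N\<close>, and cross-multiplication removes it.\<close>
      show "snd (bd i) * (c N * a i - a N * c i) = fst (bd i) * (c' N * a i - a' N * c i)" if "i \<in> {1..n + 2}" for i
      proof -
        have "(fst (bd i) * a' N - snd (bd i) * a N) * c i = (fst (bd i) * c' N - snd (bd i) * c N) * a i"
          using wr[of i N] range[OF that] by (simp add: bd_def)
        then show ?thesis by (simp add: algebra_simps)
      qed
      show "a i * c j \<noteq> a j * c i" if i: "i \<in> {1..n + 2}" and j: "j \<in> {1..n + 2}" and "i < j" for i j
      proof
        assume eq: "a i * c j = a j * c i"
        define g where "g = orbit_prop K S L i (j - i) (0, 1)"
        have g: "fst g \<noteq> 0" using prop_ne[of i j] range[OF j] \<open>i < j\<close> by (simp add: g_def)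
        have w: "fst g * a' j - snd g * a j = - (S i / S j) * a i" "fst g * c' j - snd g * c j = - (S i / S j) * c i"
          using wr[of i j] range[OF j] \<open>i < j\<close> by (simp_all add: g_def)
        \<comment> \<open>Expands the determinant at j, which is not 0, by the identities
          \<open>w\<close>; equal ratios at i and j would make it vanish.\<close>
        have "fst g * (a j * c' j - a' j * c j) =
            a j * (fst g * c' j - snd g * c j) - c j * (fst g * a' j - snd g * a j)"
          by (simp add: algebra_simps)
        also have "\<dots> = (S i / S j) * (a i * c j - a j * c i)"
          unfolding w by (simp add: algebra_simps)
        also have "\<dots> = 0" by (simp add: eq)
        finally show False using g wr0[of j] range[OF j] by simp
      qed
      show "a N \<noteq> 0" by (rule aN)
      show "c N \<noteq> 0" using prop_ne[of 0 N] by (simp add: c_def N_def)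
      show "a N * c' N - c N * a' N \<noteq> 0" using wr0[of N] by (simp add: mult.commute)
    qed
    then have det: "det (\<chi> r q. G r q 0) \<noteq> 0"
      unfolding G_def a1_def c1_def K'0 a_def c_def .
    have "jacobian (\<lambda>\<epsilon>. jet_vector n ix (\<Gamma> \<epsilon>) (s 0, \<phi> 0)) (at 0) = (\<chi> r q. G r q 0)"
      unfolding jacobian_def frechet_derivative_at[OF D, symmetric] by (rule matrix_of_matrix_vector_mul)
    with det D show ?thesis by (auto simp: differentiable_def)
  qed
  have "\<delta> > 0" using \<delta>1 by (simp add: \<delta>_def)
  show ?thesis
    unfolding Let_def
    by (intro exI[of _ \<delta>] conjI[OF \<open>\<delta> > 0\<close>] allI impI) (rule main; assumption)
qed

end
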